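(* Let $\mathcal{U}$ be an ultrafilter on a set $\mathcal{I}$, let $\mathfrak{X}_i=(X_i,\Sigma_i,\nu_i)$, $i\in\mathcal{I}$, be probability spaces and let $\mathfrak{X}=(X,\Sigma,\nu)=\mathcal{U}\lim\mathfrak{X}_i$. Then for every $\rho\in\mathbf{M}$ the mapping $(f_i)\mapsto\mathcal{U}\lim f_i$ induces a continuous linear operator $$\Phi_\rho:\mathcal{U}\lim\mathcal{C}_\rho(\mathfrak{X}_i)\to\mathcal{C}_\rho(\mathfrak{X})$$ that satisfies $\|\Phi_\rho\|\le1$ and commutes with integration, i.e. $\int_X\Phi_\rho((f_i)+\mathcal{N}_{\mathcal{U}})\,d\nu=\mathcal{U}\lim\int_{X_i}f_i\,d\nu_i$. Moreover, $$\ker\Phi_\rho=\Big\{(f_i)+\mathcal{N}_{\mathcal{U}}\ \Big|\ \mathcal{U}\lim\int_{X_i}|f_i|\,d\nu_i=0\Big\}$$ and the induced map $$\overline{\Phi_\rho}:\frac{\mathcal{U}\lim\mathcal{C}_\rho(\mathfrak{X}_i)}{\ker\Phi_\rho}\longrightarrow\mathcal{C}_\rho(\mathfrak{X})$$ is an isometric isomorphism.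
   Context: For numbers $x_i\in[-\infty,\infty]$, $\mathcal{U}\lim x_i$ is the unique $x\in[-\infty,\infty]$ such that $\{i:x_i\in W\}\in\mathcal{U}$ for every neighbourhood $W$ of $x$. Ultralimit of probability spaces: $X=\prod_iX_i/\!\sim$ with $(x_i)\sim(y_i)$ iff $\{i:x_i=y_i\}\in\mathcal{U}$. For $A_i\in\Sigma_i$, $\mathcal{U}\lim A_i=\{[x_i]:\{i:x_i\in A_i\}\in\mathcal{U}\}$; these sets form an algebra, $\Sigma$ is the $\sigma$-algebra it generates, and $\nu$ is the unique probability measure on $\Sigma$ with $\nu(\mathcal{U}\lim A_i)=\mathcal{U}\lim\nu_i(A_i)$. For functions $f_i$ on $X_i$, $(\mathcal{U}\lim f_i)([x_i])=\mathcal{U}\lim f_i(x_i)$ (for complex functions, taken on real and imaginary parts); changing each $f_i$ on a null set changes $\mathcal{U}\lim f_i$ only on a $\nu$-null set. Ultralimit of Banach spaces $B_i$: $\mathcal{U}\lim B_i=\ell^\infty(\mathcal{I},\{B_i\})/\mathcal{N}_{\mathcal{U}}$ with the quotient norm, where $\ell^\infty(\mathcal{I},\{B_i\})$ is the Banach space of bounded families $(v_i)\in\prod B_i$ and $\mathcal{N}_{\mathcal{U}}$ is the closed subspace of families with $\mathcal{U}\lim\|v_i\|=0$. The space of majorants $\mathbf{M}$ is the set of concave functions $\rho:[0,1]\to[0,1]$ with $\rho(0)=\rho(0^+)=0$ and $\rho(1)=1$. For a probability space $\mathfrak{X}=(X,\Sigma,\nu)$ and $\rho\in\mathbf{M}$,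 $\mathcal{C}_\rho(\mathfrak{X})$ is the Banach space of $f\in L^1(\mathfrak{X})$ (mod a.e. equality) with $$\|f\|_\rho=\sup_{A\in\Sigma,\ \nu(A)\ne0}\frac1{\rho(\nu(A))}\int_A|f|\,d\nu<\infty.$$ *)

theory Defs
  imports "HOL-Probability.Probability"
begin

section \<open>Normed spaces with explicit carriers\<close>

text \<open>
  The Banach spaces involved are indexed families of quotients of sets of functions, so they are
  represented by records with a carrier. Scalars are complex.
\<close>

record 'v nspace =
  carrier :: "'v set"
  vadd :: "'v \<Rightarrow> 'v \<Rightarrow> 'v"
  vzero :: "'v"
  vscale :: "complex \<Rightarrow> 'v \<Rightarrow> 'v"
  vnorm :: "'v \<Rightarrow> real"

definition coset :: "'v nspace \<Rightarrow> 'v set \<Rightarrow> 'v \<Rightarrow> 'v set" where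
  "coset E N v = {vadd E v n | n. n \<in> N}"

text \<open>
  In the scalar multiplication, adding \<open>N\<close> only matters for the scalar \<open>0\<close>.
\<close>

definition quotient_space :: "'v nspace \<Rightarrow> 'v set \<Rightarrow> 'v set nspace" where
  "quotient_space E N =
    \<lparr> carrier = coset E N ` carrier E,
      vadd = (\<lambda>P Q. {vadd E p q | p q. p \<in> P \<and> q \<in> Q}),
      vzero = N,
      vscale = (\<lambda>c P. {vadd E (vscale E c p) n | p n. p \<in> P \<and> n \<in> N}),
      vnorm = (\<lambda>P. INF p\<in>P. vnorm E p) \<rparr>"

definition linear_map :: "'v nspace \<Rightarrow> 'w nspace \<Rightarrow> ('v \<Rightarrow> 'w) \<Rightarrow> bool" where
  "linear_map E F T \<longleftrightarrow>
    (\<forall>v\<in>carrier E. T v \<in> carrier F) \<and>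
    (\<forall>v\<in>carrier E. \<forall>w\<in>carrier E. T (vadd E v w) = vadd F (T v) (T w)) \<and>
    (\<forall>c. \<forall>v\<in>carrier E. T (vscale E c v) = vscale F c (T v))"

definition continuous_linear_map :: "'v nspace \<Rightarrow> 'w nspace \<Rightarrow> ('v \<Rightarrow> 'w) \<Rightarrow> bool" where
  "continuous_linear_map E F T \<longleftrightarrow>
    linear_map E F T \<and> (\<exists>K. \<forall>v\<in>carrier E. vnorm F (T v) \<le> K * vnorm E v)"

definition op_norm :: "'v nspace \<Rightarrow> 'w nspace \<Rightarrow> ('v \<Rightarrow> 'w) \<Rightarrow> real" where
  "op_norm E F T = (SUP v\<in>{v \<in> carrier E. vnorm E v \<le> 1}. vnorm F (T v))"

definition ker :: "'v nspace \<Rightarrow> 'w nspace \<Rightarrow> ('v \<Rightarrow> 'w) \<Rightarrow> 'v set" where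
  "ker E F T = {v \<in> carrier E. T v = vzero F}"

text \<open>The map induced by \<open>T\<close> on a quotient: the common value of \<open>T\<close> on a coset.\<close>

definition induced_map :: "('v \<Rightarrow> 'w) \<Rightarrow> 'v set \<Rightarrow> 'w" where
  "induced_map T P = the_elem (T ` P)"

definition isometric_isomorphism :: "'v nspace \<Rightarrow> 'w nspace \<Rightarrow> ('v \<Rightarrow> 'w) \<Rightarrow> bool" where
  "isometric_isomorphism E F T \<longleftrightarrow>
    linear_map E F T \<and> bij_betw T (carrier E) (carrier F) \<and>
    (\<forall>v\<in>carrier E. vnorm F (T v) = vnorm E v)"

section \<open>Ultralimits\<close>

text \<open>
  The index set is the type \<open>'i\<close>; \<open>A \<in> \<U>\<close> is rendered as \<open>eventually (\<lambda>i. i \<in> A) U\<close>.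
  The library's \<open>Lim U x\<close> is the ultralimit of a family \<open>x\<close> of extended reals.
\<close>

definition ultrafilter :: "'i filter \<Rightarrow> bool" where
  "ultrafilter U \<longleftrightarrow>
    U \<noteq> bot \<and> (\<forall>P. eventually P U \<or> eventually (\<lambda>i. \<not> P i) U)"

definition linf_space :: "('i \<Rightarrow> 'v nspace) \<Rightarrow> ('i \<Rightarrow> 'v) nspace" where
  "linf_space B =
    \<lparr> carrier = {v. (\<forall>i. v i \<in> carrier (B i)) \<and> bdd_above (range (\<lambda>i. vnorm (B i) (v i)))},
      vadd = (\<lambda>v w i. vadd (B i) (v i) (w i)),
      vzero = (\<lambda>i. vzero (B i)),
      vscale = (\<lambda>c v i. vscale (B i) c (v i)),
      vnorm = (\<lambda>v. SUP i. vnorm (B i) (v i)) \<rparr>"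

definition null_families :: "'i filter \<Rightarrow> ('i \<Rightarrow> 'v nspace) \<Rightarrow> ('i \<Rightarrow> 'v) set" where
  "null_families U B =
    {v \<in> carrier (linf_space B). ((\<lambda>i. vnorm (B i) (v i)) \<longlongrightarrow> 0) U}"

definition ulim_space :: "'i filter \<Rightarrow> ('i \<Rightarrow> 'v nspace) \<Rightarrow> ('i \<Rightarrow> 'v) set nspace" where
  "ulim_space U B = quotient_space (linf_space B) (null_families U B)"

definition ueq :: "'i filter \<Rightarrow> ('i \<Rightarrow> 'a measure) \<Rightarrow> (('i \<Rightarrow> 'a) \<times> ('i \<Rightarrow> 'a)) set" where
  "ueq U M = {(x, y). (\<forall>i. x i \<in> space (M i)) \<and> (\<forall>i. y i \<in> space (M i)) \<and>
    eventually (\<lambda>i. x i = y i) U}"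

definition ulim_points :: "'i filter \<Rightarrow> ('i \<Rightarrow> 'a measure) \<Rightarrow> ('i \<Rightarrow> 'a) set set" where
  "ulim_points U M = {x. \<forall>i. x i \<in> space (M i)} // ueq U M"

definition ulim_set ::
  "'i filter \<Rightarrow> ('i \<Rightarrow> 'a measure) \<Rightarrow> ('i \<Rightarrow> 'a set) \<Rightarrow> ('i \<Rightarrow> 'a) set set" where
  "ulim_set U M A =
    {ueq U M `` {x} | x. (\<forall>i. x i \<in> space (M i)) \<and> eventually (\<lambda>i. x i \<in> A i) U}"

text \<open>
  The measure extending \<open>ulim_set U M A \<mapsto> \<U>lim (M i) (A i)\<close> to the generated
  \<open>\<sigma>\<close>-algebra. (\<open>extend_measure\<close> yields the null measure if no extension exists.)
\<close>

definition ulim_measure :: "'i filter \<Rightarrow> ('i \<Rightarrow> 'a measure) \<Rightarrow> ('i \<Rightarrow> 'a) set measure" where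
  "ulim_measure U M =
    extend_measure (ulim_points U M) {A. \<forall>i. A i \<in> sets (M i)} (ulim_set U M)
      (\<lambda>A. Lim U (\<lambda>i. emeasure (M i) (A i)))"

text \<open>The common value over all representatives \<open>x\<close> of the point \<open>\<xi>\<close>.\<close>

definition ulim_fun :: "'i filter \<Rightarrow> ('i \<Rightarrow> 'a \<Rightarrow> real) \<Rightarrow> ('i \<Rightarrow> 'a) set \<Rightarrow> ereal" where
  "ulim_fun U f \<xi> = the_elem ((\<lambda>x. Lim U (\<lambda>i. ereal (f i (x i)))) ` \<xi>)"

text \<open>
  The ultralimit of a family of complex functions may have infinite real or imaginary part. A
  complex function \<open>g\<close> represents it if the extended real values agree almost everywhere; in
  particular the ultralimit is then finite almost everywhere.
\<close>

definition represents_ulim ::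
  "'i filter \<Rightarrow> ('i \<Rightarrow> 'a measure) \<Rightarrow> ('i \<Rightarrow> 'a \<Rightarrow> complex) \<Rightarrow> (('i \<Rightarrow> 'a) set \<Rightarrow> complex) \<Rightarrow> bool"
  where
  "represents_ulim U M f g \<longleftrightarrow>
    (AE \<xi> in ulim_measure U M.
      ereal (Re (g \<xi>)) = ulim_fun U (\<lambda>i x. Re (f i x)) \<xi> \<and>
      ereal (Im (g \<xi>)) = ulim_fun U (\<lambda>i x. Im (f i x)) \<xi>)"

section \<open>Majorants and the spaces they define\<close>

definition majorants :: "(real \<Rightarrow> real) set" where
  "majorants = {\<rho>. concave_on {0..1} \<rho> \<and> \<rho> ` {0..1} \<subseteq> {0..1} \<and>
    \<rho> 0 = 0 \<and> (\<rho> \<longlongrightarrow> 0) (at_right 0) \<and> \<rho> 1 = 1}"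

definition rho_averages :: "'a measure \<Rightarrow> (real \<Rightarrow> real) \<Rightarrow> ('a \<Rightarrow> complex) \<Rightarrow> real set" where
  "rho_averages M \<rho> f =
    {1 / \<rho> (measure M A) * (LINT x:A|M. norm (f x)) | A. A \<in> sets M \<and> measure M A \<noteq> 0}"

text \<open>The seminormed space of functions, before identification of a.e. equal ones.\<close>

definition C_rho_fun :: "'a measure \<Rightarrow> (real \<Rightarrow> real) \<Rightarrow> ('a \<Rightarrow> complex) nspace" where
  "C_rho_fun M \<rho> =
    \<lparr> carrier = {f. integrable M f \<and> bdd_above (rho_averages M \<rho> f)},
      vadd = (\<lambda>f g x. f x + g x),
      vzero = (\<lambda>x. 0),
      vscale = (\<lambda>c f x. c * f x),
      vnorm = (\<lambda>f. Sup (rho_averages M \<rho> f)) \<rparr>"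

definition ae_zero :: "'a measure \<Rightarrow> (real \<Rightarrow> real) \<Rightarrow> ('a \<Rightarrow> complex) set" where
  "ae_zero M \<rho> = {f \<in> carrier (C_rho_fun M \<rho>). AE x in M. f x = 0}"

definition C_rho :: "'a measure \<Rightarrow> (real \<Rightarrow> real) \<Rightarrow> ('a \<Rightarrow> complex) set nspace" where
  "C_rho M \<rho> = quotient_space (C_rho_fun M \<rho>) (ae_zero M \<rho>)"

definition ae_class :: "'a measure \<Rightarrow> (real \<Rightarrow> real) \<Rightarrow> ('a \<Rightarrow> complex) \<Rightarrow> ('a \<Rightarrow> complex) set" where
  "ae_class M \<rho> f = coset (C_rho_fun M \<rho>) (ae_zero M \<rho>) f"

definition class_integral :: "'a measure \<Rightarrow> ('a \<Rightarrow> complex) set \<Rightarrow> complex" where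
  "class_integral M P = the_elem ((\<lambda>f. integral\<^sup>L M f) ` P)"

text \<open>Families of functions whose classes form an element of \<open>\<ell>\<^sup>\<infinity>(\<I>, {\<C>\<^sub>\<rho>(M i)})\<close>.\<close>

definition bounded_families ::
  "('i \<Rightarrow> 'a measure) \<Rightarrow> (real \<Rightarrow> real) \<Rightarrow> ('i \<Rightarrow> 'a \<Rightarrow> complex) set" where
  "bounded_families M \<rho> =
    {f. (\<forall>i. f i \<in> carrier (C_rho_fun (M i) \<rho>)) \<and>
        (\<lambda>i. ae_class (M i) \<rho> (f i)) \<in> carrier (linf_space (\<lambda>i. C_rho (M i) \<rho>))}"

text \<open>The element \<open>(f\<^sub>i) + \<N>\<^sub>\<U>\<close> of the ultralimit.\<close>

definition ulim_class ::
  "'i filter \<Rightarrow> ('i \<Rightarrow> 'a measure) \<Rightarrow> (real \<Rightarrow> real) \<Rightarrow> ('i \<Rightarrow> 'a \<Rightarrow> complex) \<Rightarrow>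
    ('i \<Rightarrow> ('a \<Rightarrow> complex) set) set" where
  "ulim_class U M \<rho> f =
    coset (linf_space (\<lambda>i. C_rho (M i) \<rho>)) (null_families U (\<lambda>i. C_rho (M i) \<rho>))
      (\<lambda>i. ae_class (M i) \<rho> (f i))"

end

theory Submission
  imports Defs
begin

text \<open>
  Call a set \<open>ulim_set U M A\<close> with \<open>A i \<in> sets (M i)\<close> internal. Caratheodory's theorem yields
  the ultraproduct measure \<open>N\<close> once a decreasing sequence of internal sets with empty
  intersection is known to have measures tending to \<open>0\<close>. Here, and again when functions are lifted
  from the ultraproduct, the tool is \<open>diagonal_choice\<close>: if \<open>S n i\<close>
  decreases in \<open>n\<close> and the intersection over \<open>n\<close> is nonempty whenever all \<open>S n i\<close> are, a single
  \<open>y i\<close> lies in \<open>S n i\<close> for all \<open>n\<close> with \<open>S n i \<noteq> {}\<close>. So \<open>y\<close> satisfies countably many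
  conditions each of which can be met for almost all \<open>i\<close>. This covers countably complete and
  countably incomplete ultrafilters at once, and nothing but maximality of \<open>U\<close> is needed.

  Write \<open>ulim_AE f g\<close> if \<open>g\<close> is almost everywhere the pointwise ultralimit of \<open>f\<close>. For uniformly
  bounded families, integrals converge along \<open>U\<close>, by uniform approximation with step functions over
  internal sets. Hence \<open>\<integral>|g| \<le> K\<close> if \<open>\<integral>|f i| \<le> K\<close> for almost all \<open>i\<close> (\<open>ulim_Fatou\<close>), and
  \<open>\<integral>f i\<close> tends to \<open>\<integral>g\<close> if the family is uniformly integrable (\<open>ulim_integral\<close>). A bound
  \<open>\<parallel>f i\<parallel> \<le> K\<close> in \<open>C_rho\<close> says \<open>\<integral>\<^bsub>A\<^esub>|f i| \<le> K \<rho>(\<nu>(A))\<close> for all \<open>A\<close>; as \<open>\<rho>(0\<^sup>+) = 0\<close>, it implies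
  uniform integrability. The bound passes to \<open>g\<close> on internal sets because \<open>\<rho>\<close> is continuous, and
  on all sets because internal sets are dense in \<open>sets N\<close> with respect to measure (\<open>ulim_rho_bounded\<close>). So \<open>\<Phi>\<close> is a
  contraction that commutes with integration, and since \<open>\<integral>|f i|\<close> tends to \<open>\<integral>|g|\<close>, its kernel is
  the stated one.

  The induced map is isometric and onto because each \<open>g\<close> in \<open>C_rho N \<rho>\<close> is the ultralimit of a
  family with \<open>\<parallel>f i\<parallel> \<le> \<parallel>g\<parallel> + e\<close>, for every \<open>e > 0\<close> (\<open>rho_bounded_lift\<close>). To prove this, approximate
  \<open>g\<close> in \<open>L\<^sup>1\<close> by the ultralimit of a bounded family \<open>h\<close>, with \<open>|h i| \<le> B\<close>. Sets \<open>A\<close> that violate the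
  bound \<open>\<integral>\<^bsub>A\<^esub>|h i| \<le> (\<parallel>g\<parallel> + e) \<rho>(\<nu>(A))\<close> for almost all \<open>i\<close> would form an internal set that
  violates it in the limit, provided that their measures stay away from \<open>0\<close>. Sets of small measure
  are harmless if \<open>B\<close> is at most about the essential supremum of \<open>|g|\<close>: concavity of \<open>\<rho>\<close> then gives
  \<open>B t \<le> (\<parallel>g\<parallel> + e) \<rho>(t)\<close> for small \<open>t\<close> (\<open>majorant_level\<close>). Finally \<open>diagonal_choice\<close>, applied to
  \<open>L\<^sup>1\<close>-balls around such approximations, produces \<open>f\<close>; its hypothesis holds since \<open>L\<^sup>1\<close> is complete
  and a bound on \<open>\<parallel>f\<parallel>\<close> is closed in \<open>L\<^sup>1\<close>.
\<close>

section \<open>Ultrafilters and diagonal choice\<close>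

lemma ultrafilter_tendsto_compact:
  assumes U: "ultrafilter U" and "compact S" and S: "eventually (\<lambda>i. f i \<in> S) U"
  shows "\<exists>l\<in>S. (f \<longlongrightarrow> l) U"
proof -
  have "filtermap f U \<noteq> bot" using U by (simp add: ultrafilter_def filtermap_bot_iff)
  moreover have "eventually (\<lambda>x. x \<in> S) (filtermap f U)" using S by (simp add: eventually_filtermap)
  ultimately obtain l where l: "l \<in> S" "inf (nhds l) (filtermap f U) \<noteq> bot"
    using \<open>compact S\<close> unfolding compact_filter by blast
  have "(f \<longlongrightarrow> l) U"
  proof (rule topological_tendstoI)
    fix T assume T: "open T" "l \<in> T"
    show "eventually (\<lambda>i. f i \<in> T) U"
    proof (rule ccontr)
      assume "\<not> ?thesis"
      then have "eventually (\<lambda>i. f i \<notin> T) U" using U by (auto simp: ultrafilter_def)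
      then have "eventually (\<lambda>x. x \<notin> T) (filtermap f U)" by (simp add: eventually_filtermap)
      moreover have "eventually (\<lambda>x. x \<in> T) (nhds l)" using T by (rule eventually_nhds_in_open)
      ultimately have "eventually (\<lambda>x. False) (inf (nhds l) (filtermap f U))"
        unfolding eventually_inf by blast
      then show False using l by (simp add: eventually_False)
    qed
  qed
  then show ?thesis using l by blast
qed

text \<open>
  The selection principle behind all countable saturation arguments below. There is no filter in it:
  for each \<open>i\<close> take a point of the last nonempty \<open>S n i\<close>, or of the intersection if all are nonempty.
\<close>

lemma diagonal_choice:
  fixes S :: "nat \<Rightarrow> 'i \<Rightarrow> 'b set"
  assumes dec: "\<And>n i. S (Suc n) i \<subseteq> S n i"
    and cpt: "\<And>i. (\<And>n. S n i \<noteq> {}) \<Longrightarrow> (\<Inter>n. S n i) \<noteq> {}"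
  shows "\<exists>y. \<forall>n i. S n i \<noteq> {} \<longrightarrow> y i \<in> S n i"
proof -
  have mono: "S n i \<subseteq> S m i" if "m \<le> n" for m n i
    using that by (induction rule: dec_induct) (use dec in auto)
  have "\<exists>y. \<forall>n. S n i \<noteq> {} \<longrightarrow> y \<in> S n i" for i
  proof (cases "\<forall>n. S n i \<noteq> {}")
    case True
    then show ?thesis using cpt[of i] by blast
  next
    case False
    then have "\<exists>m. S m i = {}" by blast
    then obtain m where m: "S m i = {}" "\<And>k. k < m \<Longrightarrow> S k i \<noteq> {}"
      using exists_least_iff[of "\<lambda>m. S m i = {}"] by blast
    show ?thesis
    proof (cases m)
      case 0
      then have "S n i = {}" for n using mono[of 0 n i] m by auto
      then show ?thesis by blast
    next
      case (Suc k)
      then obtain y where y: "y \<in> S k i" using m(2)[of k] by auto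
      have "y \<in> S n i" if "S n i \<noteq> {}" for n
      proof -
        have "\<not> m \<le> n" using that mono[of m n i] m by auto
        then show ?thesis using Suc y mono[of n k i] by auto
      qed
      then show ?thesis by blast
    qed
  qed
  then show ?thesis by metis
qed

section \<open>The ultraproduct of probability spaces\<close>

locale prob_ultraproduct =
  fixes U :: "'i filter" and M :: "'i \<Rightarrow> 'a measure"
  assumes ultra: "ultrafilter U"
    and prob: "\<And>i. prob_space (M i)"
begin

abbreviation "N \<equiv> ulim_measure U M"

text \<open>
  The families of points that represent the points of the ultraproduct, and the point that a family
  represents.
\<close>

definition families :: "('i \<Rightarrow> 'a) set" where
  "families = {x. \<forall>i. x i \<in> space (M i)}"

definition pt :: "('i \<Rightarrow> 'a) \<Rightarrow> ('i \<Rightarrow> 'a) set" where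
  "pt x = ueq U M `` {x}"

text \<open>
  The families of measurable sets. The sets \<open>ulim_set U M A\<close> with \<open>A \<in> internal\<close> are the internal
  sets; they form the algebra that generates \<open>sets N\<close>.
\<close>

definition internal :: "('i \<Rightarrow> 'a set) set" where
  "internal = {A. \<forall>i. A i \<in> sets (M i)}"

lemma U_nonbot [simp]: "U \<noteq> bot"
  using ultra by (simp add: ultrafilter_def)

lemma not_eventually_iff: "\<not> eventually P U \<longleftrightarrow> eventually (\<lambda>i. \<not> P i) U"
proof
  assume "eventually (\<lambda>i. \<not> P i) U"
  then show "\<not> eventually P U"
    using eventually_conj[of "\<lambda>i. \<not> P i" U P] by (auto simp: eventually_False)
qed (use ultra in \<open>auto simp: ultrafilter_def\<close>)

lemma eventually_disj_iff:
  "eventually (\<lambda>i. P i \<or> Q i) U \<longleftrightarrow> eventually P U \<or> eventually Q U"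
proof -
  have "\<not> eventually (\<lambda>i. P i \<or> Q i) U \<longleftrightarrow> \<not> eventually P U \<and> \<not> eventually Q U"
    unfolding not_eventually_iff by (simp add: eventually_conj_iff)
  then show ?thesis by blast
qed

lemma bounded_real_tendsto:
  fixes f :: "'i \<Rightarrow> real"
  assumes "eventually (\<lambda>i. a \<le> f i \<and> f i \<le> b) U"
  shows "\<exists>l. a \<le> l \<and> l \<le> b \<and> (f \<longlongrightarrow> l) U"
  using ultrafilter_tendsto_compact[OF ultra compact_Icc[of a b], of f] assms by auto

lemma pt_refl: "x \<in> families \<Longrightarrow> x \<in> pt x"
  by (auto simp: families_def pt_def ueq_def)

lemma pt_iff: "y \<in> pt x \<longleftrightarrow> x \<in> families \<and> y \<in> families \<and> eventually (\<lambda>i. x i = y i) U"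
  by (auto simp: pt_def ueq_def families_def)

lemma pt_eq_iff:
  assumes "x \<in> families" "y \<in> families"
  shows "pt x = pt y \<longleftrightarrow> eventually (\<lambda>i. x i = y i) U"
proof
  assume "pt x = pt y"
  then show "eventually (\<lambda>i. x i = y i) U" using pt_refl[OF assms(2)] pt_iff by blast
next
  assume e: "eventually (\<lambda>i. x i = y i) U"
  have "z \<in> pt x \<longleftrightarrow> z \<in> pt y" for z
  proof -
    have "eventually (\<lambda>i. x i = z i) U \<longleftrightarrow> eventually (\<lambda>i. y i = z i) U"
      by (rule eventually_subst) (use e in eventually_elim, simp)
    then show ?thesis using assms by (simp add: pt_iff)
  qed
  then show "pt x = pt y" by blast
qed

lemma points_eq: "ulim_points U M = pt ` families"
  by (auto simp: ulim_points_def quotient_def pt_def families_def)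

lemma exists_family: "\<exists>x. x \<in> families"
proof -
  have "\<exists>x. x \<in> space (M i)" for i
    using prob_space.not_empty[OF prob, of i] by blast
  then show ?thesis unfolding families_def by (auto intro: choice)
qed

lemma ulim_set_eq: "ulim_set U M A = {pt x | x. x \<in> families \<and> eventually (\<lambda>i. x i \<in> A i) U}"
  by (auto simp: ulim_set_def pt_def families_def)

lemma ulim_set_subset: "ulim_set U M A \<subseteq> ulim_points U M"
  by (auto simp: points_eq ulim_set_eq)

lemma pt_in_ulim_set [simp]:
  assumes x: "x \<in> families"
  shows "pt x \<in> ulim_set U M A \<longleftrightarrow> eventually (\<lambda>i. x i \<in> A i) U"
proof
  assume "pt x \<in> ulim_set U M A"
  then obtain y where y: "pt x = pt y" "y \<in> families" "eventually (\<lambda>i. y i \<in> A i) U"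
    by (auto simp: ulim_set_eq)
  then have "eventually (\<lambda>i. x i = y i) U" using pt_eq_iff x by auto
  with y(3) show "eventually (\<lambda>i. x i \<in> A i) U" by eventually_elim simp
qed (use x in \<open>auto simp: ulim_set_eq\<close>)

lemma in_ulim_set_member:
  assumes "\<xi> \<in> ulim_points U M" "x \<in> \<xi>"
  shows "\<xi> \<in> ulim_set U M A \<longleftrightarrow> eventually (\<lambda>i. x i \<in> A i) U" "x \<in> families" "\<xi> = pt x"
proof -
  obtain y where y: "\<xi> = pt y" "y \<in> families" using assms(1) by (auto simp: points_eq)
  with assms(2) show x: "x \<in> families" by (simp add: pt_iff)
  show "\<xi> = pt x" using y x assms(2) pt_eq_iff[OF y(2) x] by (simp add: pt_iff)
  then show "\<xi> \<in> ulim_set U M A \<longleftrightarrow> eventually (\<lambda>i. x i \<in> A i) U" using x by simp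
qed

lemma ulim_set_eqI:
  assumes S: "S \<subseteq> ulim_points U M"
    and iff: "\<And>x. x \<in> families \<Longrightarrow> pt x \<in> S \<longleftrightarrow> eventually (\<lambda>i. x i \<in> A i) U"
  shows "S = ulim_set U M A"
proof (rule set_eqI)
  fix \<xi>
  show "\<xi> \<in> S \<longleftrightarrow> \<xi> \<in> ulim_set U M A"
  proof (cases "\<xi> \<in> ulim_points U M")
    case True
    then obtain x where "\<xi> = pt x" "x \<in> families" by (auto simp: points_eq)
    then show ?thesis using iff[of x] pt_in_ulim_set[of x A] by simp
  next
    case False
    then show ?thesis using S ulim_set_subset[of A] by blast
  qed
qed

lemma ulim_set_Un: "ulim_set U M A \<union> ulim_set U M B = ulim_set U M (\<lambda>i. A i \<union> B i)"
  by (rule ulim_set_eqI) (simp_all add: ulim_set_subset eventually_disj_iff)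

lemma ulim_set_Int: "ulim_set U M A \<inter> ulim_set U M B = ulim_set U M (\<lambda>i. A i \<inter> B i)"
  by (rule ulim_set_eqI) (simp_all add: ulim_set_subset le_infI1 eventually_conj_iff)

lemma ulim_set_empty [simp]: "ulim_set U M (\<lambda>i. {}) = {}"
  by (auto simp: ulim_set_eq eventually_False)

lemma ulim_set_compl:
  "ulim_points U M - ulim_set U M A = ulim_set U M (\<lambda>i. space (M i) - A i)"
proof (rule ulim_set_eqI)
  fix x assume x: "x \<in> families"
  have "pt x \<in> ulim_points U M" unfolding points_eq using x by (rule imageI)
  then have "pt x \<in> ulim_points U M - ulim_set U M A \<longleftrightarrow> eventually (\<lambda>i. x i \<notin> A i) U"
    using x not_eventually_iff[of "\<lambda>i. x i \<in> A i"] by simp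
  also have "\<dots> \<longleftrightarrow> eventually (\<lambda>i. x i \<in> space (M i) - A i) U"
    using x by (simp add: families_def)
  finally show "pt x \<in> ulim_points U M - ulim_set U M A \<longleftrightarrow>
    eventually (\<lambda>i. x i \<in> space (M i) - A i) U" .
qed (rule Diff_subset)

lemma ulim_set_space: "ulim_set U M (\<lambda>i. space (M i)) = ulim_points U M"
  using ulim_set_compl[of "\<lambda>i. {}"] by simp

lemma ulim_set_eq_emptyD:
  assumes A: "\<And>i. A i \<subseteq> space (M i)" and e: "ulim_set U M A = {}"
  shows "eventually (\<lambda>i. A i = {}) U"
proof (rule ccontr)
  assume "\<not> ?thesis"
  then have ev: "eventually (\<lambda>i. A i \<noteq> {}) U" by (simp add: not_eventually_iff)
  obtain z where z: "z \<in> families" using exists_family by blast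
  define x where "x = (\<lambda>i. if A i = {} then z i else SOME a. a \<in> A i)"
  have xA: "x i \<in> A i" if "A i \<noteq> {}" for i
    using that someI_ex[of "\<lambda>a. a \<in> A i"] by (auto simp: x_def)
  have "x i \<in> space (M i)" for i
  proof (cases "A i = {}")
    case True
    then show ?thesis using z by (simp add: x_def families_def)
  next
    case False
    then show ?thesis using xA[of i] A[of i] by blast
  qed
  then have x: "x \<in> families" by (simp add: families_def)
  have "eventually (\<lambda>i. x i \<in> A i) U" using ev by eventually_elim (rule xA)
  then have "pt x \<in> ulim_set U M A" using x by simp
  then show False using e by simp
qed

lemma internal_subset: "A \<in> internal \<Longrightarrow> A i \<subseteq> space (M i)"
  by (auto simp: internal_def dest: sets.sets_into_space)

text \<open>
  An internal set determines its family up to a set of indices outside the ultrafilter, so that the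
  limit of the measures depends on the internal set only.
\<close>

lemma ulim_set_inject:
  assumes A: "A \<in> internal" and B: "B \<in> internal" and e: "ulim_set U M A = ulim_set U M B"
  shows "eventually (\<lambda>i. A i = B i) U"
proof -
  have *: "eventually (\<lambda>i. A i \<inter> (space (M i) - B i) = {}) U"
    if "A \<in> internal" "ulim_set U M A = ulim_set U M B" for A B
  proof (rule ulim_set_eq_emptyD)
    show "ulim_set U M (\<lambda>i. A i \<inter> (space (M i) - B i)) = {}"
      unfolding ulim_set_Int[symmetric] ulim_set_compl[symmetric] using that by auto
  qed (use that internal_subset in auto)
  show ?thesis
    using *[OF A e] *[OF B e[symmetric]]
    by eventually_elim (use internal_subset[OF A] internal_subset[OF B] in fast)
qed

text \<open>
  The measure of the internal set given by \<open>A\<close>, as the limit along \<open>U\<close> of a bounded real family.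
\<close>

definition lim_measure :: "('i \<Rightarrow> 'a set) \<Rightarrow> real" where
  "lim_measure A = Lim U (\<lambda>i. measure (M i) (A i))"

lemma lim_measure_tendsto:
  shows "((\<lambda>i. measure (M i) (A i)) \<longlongrightarrow> lim_measure A) U"
    and "0 \<le> lim_measure A" and "lim_measure A \<le> 1"
proof -
  have "eventually (\<lambda>i. 0 \<le> measure (M i) (A i) \<and> measure (M i) (A i) \<le> 1) U"
    using prob_space.prob_le_1[OF prob] by simp
  then obtain l where l: "0 \<le> l" "l \<le> 1" "((\<lambda>i. measure (M i) (A i)) \<longlongrightarrow> l) U"
    using bounded_real_tendsto[of 0 "\<lambda>i. measure (M i) (A i)" 1] by blast
  moreover have "lim_measure A = l"
    unfolding lim_measure_def by (rule tendsto_Lim) (use l in auto)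
  ultimately show "((\<lambda>i. measure (M i) (A i)) \<longlongrightarrow> lim_measure A) U"
    "0 \<le> lim_measure A" "lim_measure A \<le> 1" by auto
qed

lemma lim_measureI: "((\<lambda>i. measure (M i) (A i)) \<longlongrightarrow> l) U \<Longrightarrow> lim_measure A = l"
  using tendsto_unique[OF U_nonbot lim_measure_tendsto(1)] by blast

lemma lim_measure_cong: "eventually (\<lambda>i. A i = B i) U \<Longrightarrow> lim_measure A = lim_measure B"
  by (rule lim_measureI, rule tendsto_cong[THEN iffD1, OF _ lim_measure_tendsto(1)[of B]])
    (auto elim: eventually_mono)

lemma Lim_emeasure: "Lim U (\<lambda>i. emeasure (M i) (A i)) = ennreal (lim_measure A)"
proof (rule tendsto_Lim)
  have "emeasure (M i) (A i) = ennreal (measure (M i) (A i))" for i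
    using prob_space.finite_measure[OF prob] finite_measure.emeasure_eq_measure by blast
  then show "((\<lambda>i. emeasure (M i) (A i)) \<longlongrightarrow> ennreal (lim_measure A)) U"
    using lim_measure_tendsto(1)[of A] by (simp add: tendsto_ennrealI)
qed simp

lemma algebra_internal: "algebra (ulim_points U M) (ulim_set U M ` internal)"
  unfolding algebra_iff_Un
proof (intro conjI ballI)
  show "ulim_set U M ` internal \<subseteq> Pow (ulim_points U M)" using ulim_set_subset by auto
  show "{} \<in> ulim_set U M ` internal"
    by (rule image_eqI[of _ _ "\<lambda>i. {}"]) (auto simp: internal_def)
next
  fix a assume "a \<in> ulim_set U M ` internal"
  then obtain A where A: "A \<in> internal" "a = ulim_set U M A" by auto
  show "ulim_points U M - a \<in> ulim_set U M ` internal"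
    unfolding A ulim_set_compl using A(1) by (intro imageI) (auto simp: internal_def)
next
  fix a b assume "a \<in> ulim_set U M ` internal" "b \<in> ulim_set U M ` internal"
  then obtain A B where A: "A \<in> internal" "a = ulim_set U M A"
    and B: "B \<in> internal" "b = ulim_set U M B" by auto
  show "a \<union> b \<in> ulim_set U M ` internal"
    unfolding A B ulim_set_Un using A(1) B(1) by (intro imageI) (auto simp: internal_def)
qed

text \<open>
  Continuity at the empty set, in contrapositive form. The sets passed to \<open>diagonal_choice\<close> are cut off
  when the measure drops to \<open>c / 2\<close>: if this never happens for an index \<open>i\<close>, the sets \<open>b n i\<close> intersect
  because their intersection has measure at least \<open>c / 2\<close>.
\<close>

lemma internal_decreasing_nonempty:
  assumes b: "\<And>n. b n \<in> internal" and dec: "\<And>n i. b (Suc n) i \<subseteq> b n i"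
    and c: "c > 0" "\<And>n. c \<le> lim_measure (b n)"
  shows "(\<Inter>n. ulim_set U M (b n)) \<noteq> {}"
proof -
  define S where "S = (\<lambda>n i. if measure (M i) (b n i) > c / 2 then b n i else {})"
  have bs: "b n i \<in> sets (M i)" for n i using b[of n] by (auto simp: internal_def)
  have fin: "finite_measure (M i)" for i using prob prob_space.finite_measure by blast
  have "\<exists>y. \<forall>n i. S n i \<noteq> {} \<longrightarrow> y i \<in> S n i"
  proof (rule diagonal_choice)
    show "S (Suc n) i \<subseteq> S n i" for n i
      using finite_measure.finite_measure_mono[OF fin dec[where n=n] bs, of i] dec[of n i]
      by (auto simp: S_def)
  next
    fix i assume ne: "\<And>n. S n i \<noteq> {}"
    then have gt: "measure (M i) (b n i) > c / 2" for n
      by (metis S_def)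
    have "(\<lambda>n. measure (M i) (b n i)) \<longlonglongrightarrow> measure (M i) (\<Inter>n. b n i)"
      by (rule finite_measure.finite_Lim_measure_decseq[OF fin])
        (use bs dec in \<open>auto simp: decseq_Suc_iff\<close>)
    then have "c / 2 \<le> measure (M i) (\<Inter>n. b n i)"
      by (rule LIMSEQ_le_const) (use gt less_imp_le in blast)
    then have "(\<Inter>n. b n i) \<noteq> {}" using c(1) by auto
    then show "(\<Inter>n. S n i) \<noteq> {}" using gt by (auto simp: S_def)
  qed
  then obtain y where y: "\<And>n i. S n i \<noteq> {} \<Longrightarrow> y i \<in> S n i" by blast
  obtain z where z: "z \<in> families" using exists_family by blast
  \<comment> \<open>At indices where no \<open>b n i\<close> exceeds measure \<open>c / 2\<close>, \<open>y i\<close> may lie outside \<open>space (M i)\<close>.\<close>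
  define x where "x = (\<lambda>i. if y i \<in> space (M i) then y i else z i)"
  have x: "x \<in> families" using z by (auto simp: families_def x_def)
  have "eventually (\<lambda>i. x i \<in> b n i) U" for n
  proof -
    have "eventually (\<lambda>i. measure (M i) (b n i) > c / 2) U"
      using order_tendstoD(1)[OF lim_measure_tendsto(1)[of "b n"], of "c/2"] c(1) c(2)[of n] by auto
    then show ?thesis
    proof eventually_elim
      case (elim i)
      then have "b n i \<noteq> {}" using c(1) by auto
      then have "y i \<in> b n i" using y[of n i] elim by (auto simp: S_def)
      then show ?case using sets.sets_into_space[OF bs[of n i]] by (auto simp: x_def)
    qed
  qed
  then have "pt x \<in> (\<Inter>n. ulim_set U M (b n))" using x by simp
  then show ?thesis by blast
qed

lemma ulim_measure_extension:
  "\<exists>\<mu> :: ('i \<Rightarrow> 'a) set set \<Rightarrow> ennreal.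
    (\<forall>A\<in>internal. \<mu> (ulim_set U M A) = ennreal (lim_measure A)) \<and>
    measure_space (ulim_points U M) (sigma_sets (ulim_points U M) (ulim_set U M ` internal)) \<mu>"
proof -
  interpret algebra "ulim_points U M" "ulim_set U M ` internal" by (rule algebra_internal)
  define \<mu>0 where
    "\<mu>0 = (\<lambda>a. ennreal (lim_measure (SOME A. A \<in> internal \<and> ulim_set U M A = a)))"
  have \<mu>0: "\<mu>0 (ulim_set U M A) = ennreal (lim_measure A)" if "A \<in> internal" for A
  proof -
    have "(SOME B. B \<in> internal \<and> ulim_set U M B = ulim_set U M A) \<in> internal \<and>
      ulim_set U M (SOME B. B \<in> internal \<and> ulim_set U M B = ulim_set U M A) = ulim_set U M A"
      by (rule someI[where P = "\<lambda>B. B \<in> internal \<and> ulim_set U M B = ulim_set U M A" and x = A])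
        (use that in simp)
    then have "lim_measure (SOME B. B \<in> internal \<and> ulim_set U M B = ulim_set U M A) = lim_measure A"
      using that by (intro lim_measure_cong ulim_set_inject) auto
    then show ?thesis by (simp add: \<mu>0_def)
  qed
  have emp: "(\<lambda>i. {}) \<in> internal" by (auto simp: internal_def)
  have "\<exists>\<mu> :: ('i \<Rightarrow> 'a) set set \<Rightarrow> ennreal. (\<forall>s\<in>ulim_set U M ` internal. \<mu> s = \<mu>0 s) \<and>
    measure_space (ulim_points U M) (sigma_sets (ulim_points U M) (ulim_set U M ` internal)) \<mu>"
  proof (rule caratheodory_empty_continuous)
    show "positive (ulim_set U M ` internal) \<mu>0"
      using \<mu>0[OF emp] lim_measureI[of "\<lambda>i. {}" 0] by (simp add: positive_def)
    show "additive (ulim_set U M ` internal) \<mu>0"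
      unfolding additive_def
    proof (intro ballI impI, elim imageE)
      fix a b A B
      assume d: "a \<inter> b = {}" and A: "a = ulim_set U M A" "A \<in> internal"
        and B: "b = ulim_set U M B" "B \<in> internal"
      have AB: "(\<lambda>i. A i \<union> B i) \<in> internal" using A(2) B(2) by (auto simp: internal_def)
      have "eventually (\<lambda>i. A i \<inter> B i = {}) U"
        by (rule ulim_set_eq_emptyD)
          (use d A B internal_subset in \<open>auto simp: ulim_set_Int[symmetric]\<close>)
      then have ev: "eventually (\<lambda>i. measure (M i) (A i \<union> B i) = measure (M i) (A i) + measure (M i) (B i)) U"
      proof eventually_elim
        case (elim i)
        have "finite_measure (M i)" using prob prob_space.finite_measure by blast
        then show ?case
          by (rule finite_measure.finite_measure_Union)
            (use A(2) B(2) elim in \<open>auto simp: internal_def\<close>)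
      qed
      have "lim_measure (\<lambda>i. A i \<union> B i) = lim_measure A + lim_measure B"
      proof (rule lim_measureI, rule tendsto_cong[THEN iffD2, OF ev])
        show "((\<lambda>i. measure (M i) (A i) + measure (M i) (B i)) \<longlongrightarrow> lim_measure A + lim_measure B) U"
          by (intro tendsto_add lim_measure_tendsto)
      qed
      then show "\<mu>0 (a \<union> b) = \<mu>0 a + \<mu>0 b"
        unfolding A(1) B(1) ulim_set_Un \<mu>0[OF AB] \<mu>0[OF A(2)] \<mu>0[OF B(2)]
        by (simp add: ennreal_plus lim_measure_tendsto)
    qed
    show "\<mu>0 A \<noteq> \<infinity>" for A by (simp add: \<mu>0_def)
  next
    fix a assume a: "range a \<subseteq> ulim_set U M ` internal" "decseq a" "(\<Inter>n. a n) = {}"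
    have "\<forall>n. \<exists>A. A \<in> internal \<and> a n = ulim_set U M A" using a(1) by blast
    then obtain A where A: "\<And>n. A n \<in> internal" "\<And>n. a n = ulim_set U M (A n)" by metis
    \<comment> \<open>The families are decreasing only up to negligible sets of indices; \<open>b\<close> decreases at every index.\<close>
    define b where "b = (\<lambda>n i. \<Inter>k\<le>n. A k i)"
    have bi: "b n \<in> internal" for n using A(1) by (auto simp: b_def internal_def)
    have b_Suc: "b (Suc n) = (\<lambda>i. b n i \<inter> A (Suc n) i)" for n
      by (auto simp: b_def atMost_Suc fun_eq_iff)
    have ab: "a n = ulim_set U M (b n)" for n
    proof (induction n)
      case 0
      show ?case by (simp add: A(2) b_def)
    next
      case (Suc n)
      have "a (Suc n) = a n \<inter> a (Suc n)" using decseqD[OF a(2), of n "Suc n"] by auto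
      also have "\<dots> = ulim_set U M (b (Suc n))"
        unfolding b_Suc ulim_set_Int[symmetric] using Suc A(2) by simp
      finally show ?case .
    qed
    have fin: "finite_measure (M i)" for i using prob prob_space.finite_measure by blast
    have mono: "lim_measure (b m) \<le> lim_measure (b n)" if "n \<le> m" for m n
    proof (rule tendsto_le[OF U_nonbot lim_measure_tendsto(1) lim_measure_tendsto(1)])
      show "eventually (\<lambda>i. measure (M i) (b m i) \<le> measure (M i) (b n i)) U"
        by (intro always_eventually allI finite_measure.finite_measure_mono fin)
          (use bi that in \<open>auto simp: internal_def b_def\<close>)
    qed
    have "(\<lambda>n. lim_measure (b n)) \<longlonglongrightarrow> 0"
    proof (rule LIMSEQ_I)
      fix c :: real assume c: "c > 0"
      have "\<exists>n. lim_measure (b n) < c"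
      proof (rule ccontr)
        assume "\<not> ?thesis"
        then have "(\<Inter>n. ulim_set U M (b n)) \<noteq> {}"
          by (intro internal_decreasing_nonempty[OF bi _ c]) (auto simp: b_Suc not_less)
        then show False using a(3) ab by simp
      qed
      then obtain n where n: "lim_measure (b n) < c" by blast
      show "\<exists>n0. \<forall>n\<ge>n0. norm (lim_measure (b n) - 0) < c"
        using n mono lim_measure_tendsto(2) by (auto intro!: exI[of _ n] intro: le_less_trans)
    qed
    then show "(\<lambda>n. \<mu>0 (a n)) \<longlonglongrightarrow> 0"
      unfolding ab using \<mu>0[OF bi] tendsto_ennrealI by fastforce
  qed
  then show ?thesis using \<mu>0 by auto
qed

lemma space_N: "space N = ulim_points U M"
  and sets_N: "sets N = sigma_sets (ulim_points U M) (ulim_set U M ` internal)"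
  using ulim_set_subset
  by (auto simp: ulim_measure_def internal_def intro!: space_extend_measure sets_extend_measure)

lemma internal_sets [measurable]: "A \<in> internal \<Longrightarrow> ulim_set U M A \<in> sets N"
  unfolding sets_N by (rule sigma_sets.Basic) simp

lemma emeasure_internal:
  assumes "A \<in> internal" shows "emeasure N (ulim_set U M A) = ennreal (lim_measure A)"
proof -
  obtain \<mu> :: "('i \<Rightarrow> 'a) set set \<Rightarrow> ennreal" where
    \<mu>: "\<And>A. A \<in> internal \<Longrightarrow> \<mu> (ulim_set U M A) = ennreal (lim_measure A)"
    "measure_space (ulim_points U M) (sigma_sets (ulim_points U M) (ulim_set U M ` internal)) \<mu>"
    using ulim_measure_extension by blast
  show ?thesis
    unfolding Lim_emeasure[symmetric]
    by (rule emeasure_extend_measure[OF ulim_measure_def, where \<mu>' = \<mu>])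
      (use \<mu> assms ulim_set_subset in
        \<open>auto simp: Lim_emeasure internal_def[symmetric] sets_N measure_space_def\<close>)
qed

lemma prob_space_N: "prob_space N"
proof
  have "(\<lambda>i. space (M i)) \<in> internal" by (simp add: internal_def)
  moreover have "lim_measure (\<lambda>i. space (M i)) = 1"
    by (rule lim_measureI) (simp add: prob_space.prob_space[OF prob])
  ultimately show "emeasure N (space N) = 1"
    using emeasure_internal by (fastforce simp: ulim_set_space space_N)
qed

lemma measure_internal:
  assumes "A \<in> internal" shows "measure N (ulim_set U M A) = lim_measure A"
  using emeasure_internal[OF assms] by (simp add: measure_def lim_measure_tendsto)

lemma measure_tendsto:
  assumes "A \<in> internal"
  shows "((\<lambda>i. measure (M i) (A i)) \<longlongrightarrow> measure N (ulim_set U M A)) U"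
  using measure_internal[OF assms] lim_measure_tendsto(1) by simp

end

section \<open>Bounded families of functions\<close>

lemma tendsto_approx:
  fixes F :: "'i \<Rightarrow> 'b::real_normed_vector"
  assumes "\<And>e. e > 0 \<Longrightarrow> \<exists>a b. eventually (\<lambda>i. norm (F i - a i) \<le> e) U \<and> (a \<longlongrightarrow> b) U \<and> norm (b - L) \<le> e"
  shows "(F \<longlongrightarrow> L) U"
proof (rule tendstoI)
  fix e :: real assume e: "e > 0"
  obtain a b where ab: "eventually (\<lambda>i. norm (F i - a i) \<le> e/4) U" "(a \<longlongrightarrow> b) U" "norm (b - L) \<le> e/4"
    using assms[of "e/4"] e by auto
  have "eventually (\<lambda>i. dist (a i) b < e/4) U" using tendstoD[OF ab(2), of "e/4"] e by simp
  with ab(1) show "eventually (\<lambda>i. dist (F i) L < e) U"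
  proof eventually_elim
    case (elim i)
    have "dist (F i) L \<le> norm (F i - a i) + dist (a i) b + norm (b - L)"
      unfolding dist_norm
      using norm_triangle_ineq[of "F i - a i + (a i - b)" "b - L"]
        norm_triangle_ineq[of "F i - a i" "a i - b"] by simp
    then show ?case using elim ab(3) e by linarith
  qed
qed

lemma min_real_of_nat_tendsto: "(\<lambda>k. min r (real k)) \<longlonglongrightarrow> r"
proof -
  obtain k0 :: nat where "r \<le> real k0" using real_arch_simple by blast
  then have "min r (real k) = r" if "k0 \<le> k" for k using that by (simp add: min_absorb1)
  then show ?thesis by (intro tendsto_eventually eventually_sequentiallyI)
qed

lemma sum_indicator_floor:
  assumes "0 \<le> z" "z \<le> real n"
  shows "(\<Sum>k=1..n. if real k \<le> z then 1 else 0) = real_of_int \<lfloor>z\<rfloor>"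
proof -
  have iff: "real k \<le> z \<longleftrightarrow> k \<le> nat \<lfloor>z\<rfloor>" for k
    using assms(1) by (simp add: le_nat_iff le_floor_iff)
  have fl: "nat \<lfloor>z\<rfloor> \<le> n" using assms by linarith
  have "(\<Sum>k=1..n. if real k \<le> z then 1 else (0::real)) = (\<Sum>k=1..n. if k \<in> {..nat \<lfloor>z\<rfloor>} then 1 else 0)"
    by (rule sum.cong) (simp_all add: iff)
  also have "\<dots> = (\<Sum>k\<in>{1..n} \<inter> {..nat \<lfloor>z\<rfloor>}. 1)"
    by (rule sum.inter_restrict[symmetric]) simp
  also have "{1..n} \<inter> {..nat \<lfloor>z\<rfloor>} = {1..nat \<lfloor>z\<rfloor>}" using fl by fastforce
  finally show ?thesis using assms(1) by simp
qed

text \<open>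
  Radial truncation of complex numbers at the level \<open>B\<close>, for \<open>B > 0\<close>.
\<close>

definition trunc :: "real \<Rightarrow> complex \<Rightarrow> complex" where
  "trunc B z = complex_of_real (B / max B (norm z)) * z"

lemma trunc_measurable [measurable]: "trunc B \<in> borel_measurable borel"
  unfolding trunc_def[abs_def] by measurable

lemma continuous_trunc: "B > 0 \<Longrightarrow> continuous_on UNIV (trunc B)"
  unfolding trunc_def[abs_def] by (intro continuous_intros) auto

lemma norm_trunc:
  assumes "B > 0" shows "norm (trunc B z) = min (norm z) B"
  using assms by (auto simp: trunc_def norm_mult norm_divide max_def min_def field_simps)

lemma norm_trunc_le: "norm (trunc B z) \<le> norm z" if "B > 0"
  using norm_trunc[OF that] by simp

lemma trunc_eq: "B > 0 \<Longrightarrow> norm z \<le> B \<Longrightarrow> trunc B z = z"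
  by (simp add: trunc_def max_absorb1)

lemma norm_diff_trunc:
  assumes "B > 0" shows "norm (z - trunc B z) = max 0 (norm z - B)"
proof (cases "norm z \<le> B")
  case True
  then show ?thesis using assms by (simp add: trunc_eq)
next
  case False
  then have "z - trunc B z = complex_of_real (1 - B / norm z) * z"
    by (simp add: trunc_def max_absorb2 algebra_simps)
  then have "norm (z - trunc B z) = \<bar>1 - B / norm z\<bar> * norm z"
    by (metis norm_mult norm_of_real)
  also have "\<bar>1 - B / norm z\<bar> = 1 - B / norm z"
  proof -
    have "B / norm z \<le> 1" using False assms by (simp add: divide_le_eq)
    then show ?thesis by simp
  qed
  also have "(1 - B / norm z) * norm z = norm z - B" using False assms by (auto simp: left_diff_distrib)
  finally show ?thesis using False by simp
qed

context prob_ultraproduct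
begin

lemma prob_meas [simp]: "prob_space (M i)" "finite_measure (M i)" "prob_space N" "finite_measure N"
  using prob prob_space_N by (simp_all add: prob_space.finite_measure)

lemma internalI: "(\<And>i. A i \<in> sets (M i)) \<Longrightarrow> A \<in> internal"
  by (simp add: internal_def)

text \<open>
  The function \<open>g\<close> is almost everywhere the finite ultralimit of the family \<open>f\<close>. As points of the
  ultraproduct are equivalence classes, convergence is required along every representative.
\<close>

definition ulim_AE :: "('i \<Rightarrow> 'a \<Rightarrow> 'b::topological_space) \<Rightarrow> (('i \<Rightarrow> 'a) set \<Rightarrow> 'b) \<Rightarrow> bool" where
  "ulim_AE f g \<longleftrightarrow> (AE \<xi> in N. \<forall>x\<in>\<xi>. ((\<lambda>i. f i (x i)) \<longlongrightarrow> g \<xi>) U)"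

lemma ulim_AE_continuous:
  assumes "ulim_AE f g" "continuous_on UNIV h"
  shows "ulim_AE (\<lambda>i x. h (f i x)) (\<lambda>\<xi>. h (g \<xi>))"
  using assms(1) unfolding ulim_AE_def
  by eventually_elim (auto intro!: continuous_on_tendsto_compose[OF assms(2)])

lemma ulim_AE_add:
  fixes g :: "_ \<Rightarrow> 'b::real_normed_vector"
  assumes "ulim_AE f g" "ulim_AE f' g'"
  shows "ulim_AE (\<lambda>i x. f i x + f' i x) (\<lambda>\<xi>. g \<xi> + g' \<xi>)"
  using assms unfolding ulim_AE_def by eventually_elim (auto intro!: tendsto_intros)

lemma ulim_AE_diff:
  fixes g :: "_ \<Rightarrow> 'b::real_normed_vector"
  assumes "ulim_AE f g" "ulim_AE f' g'"
  shows "ulim_AE (\<lambda>i x. f i x - f' i x) (\<lambda>\<xi>. g \<xi> - g' \<xi>)"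
  using assms unfolding ulim_AE_def by eventually_elim (auto intro!: tendsto_intros)

lemma ulim_AE_mult:
  fixes g :: "_ \<Rightarrow> 'b::real_normed_algebra"
  assumes "ulim_AE f g" "ulim_AE f' g'"
  shows "ulim_AE (\<lambda>i x. f i x * f' i x) (\<lambda>\<xi>. g \<xi> * g' \<xi>)"
  using assms unfolding ulim_AE_def by eventually_elim (auto intro!: tendsto_intros)

lemma ulim_AE_const: "ulim_AE (\<lambda>i x. c) (\<lambda>\<xi>. c)"
  by (simp add: ulim_AE_def)

lemma in_space_N:
  assumes "\<xi> \<in> space N" "x \<in> \<xi>" shows "x i \<in> space (M i)"
  using in_ulim_set_member(2)[of \<xi> x] assms by (auto simp: space_N families_def)

lemma nonempty_N:
  assumes "\<xi> \<in> space N" shows "\<exists>x. x \<in> \<xi>"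
  using assms pt_refl by (auto simp: space_N points_eq)

lemma ulim_AE_unique:
  fixes g :: "_ \<Rightarrow> 'b::t2_space"
  assumes "ulim_AE f g" "ulim_AE f g'"
  shows "AE \<xi> in N. g \<xi> = g' \<xi>"
proof -
  have "AE \<xi> in N. \<xi> \<in> space N" by simp
  with assms[unfolded ulim_AE_def] show ?thesis
  proof eventually_elim
    case (elim \<xi>)
    then obtain x where "x \<in> \<xi>" using nonempty_N by blast
    then show ?case using elim tendsto_unique[OF U_nonbot] by blast
  qed
qed

lemma ulim_indicator:
  assumes "\<xi> \<in> space N" "x \<in> \<xi>"
  shows "((\<lambda>i. indicator (A i) (x i) :: 'b::{zero_neq_one, topological_space})
    \<longlongrightarrow> indicator (ulim_set U M A) \<xi>) U"
proof (cases "\<xi> \<in> ulim_set U M A")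
  case True
  then have ev: "eventually (\<lambda>i. x i \<in> A i) U" using in_ulim_set_member(1) assms by (simp add: space_N)
  show ?thesis by (rule tendsto_eventually) (use ev True in \<open>auto elim: eventually_mono\<close>)
next
  case False
  then have ev: "eventually (\<lambda>i. x i \<notin> A i) U"
    using in_ulim_set_member(1)[of \<xi> x A] assms by (simp add: space_N not_eventually_iff)
  show ?thesis by (rule tendsto_eventually) (use ev False in \<open>auto elim: eventually_mono\<close>)
qed

lemma ulim_AE_indicator:
  "ulim_AE (\<lambda>i. indicator (A i) :: 'a \<Rightarrow> 'b::{zero_neq_one, topological_space})
    (indicator (ulim_set U M A))"
  unfolding ulim_AE_def by (rule AE_I2, rule ballI, rule ulim_indicator)

text \<open>
  The function \<open>\<gamma> n\<close> below is the ultralimit of \<open>\<phi> n\<close>, the family obtained from \<open>f\<close> by rounding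
  down to a grid of \<open>n\<close> steps on \<open>[-T, T]\<close>. It is a step function over internal sets, and it is
  uniformly close to the ultralimit \<open>g\<close> of \<open>f\<close>. This gives measurability of \<open>g\<close> and convergence of
  the integrals.
\<close>

lemma bounded_real_ulim:
  fixes f :: "'i \<Rightarrow> 'a \<Rightarrow> real"
  assumes f [measurable]: "\<And>i. f i \<in> borel_measurable (M i)" and T: "T > 0"
    and bd: "\<And>i x. x \<in> space (M i) \<Longrightarrow> \<bar>f i x\<bar> \<le> T"
  shows "\<exists>g. g \<in> borel_measurable N \<and>
    (\<forall>\<xi>\<in>space N. \<bar>g \<xi>\<bar> \<le> T \<and> (\<forall>x\<in>\<xi>. ((\<lambda>i. f i (x i)) \<longlongrightarrow> g \<xi>) U)) \<and>
    ((\<lambda>i. integral\<^sup>L (M i) (f i)) \<longlongrightarrow> integral\<^sup>L N g) U"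
proof -
  have "\<exists>l. \<bar>l\<bar> \<le> T \<and> (\<forall>x\<in>\<xi>. ((\<lambda>i. f i (x i)) \<longlongrightarrow> l) U)" if \<xi>: "\<xi> \<in> space N" for \<xi>
  proof -
    obtain y where y: "y \<in> \<xi>" using nonempty_N[OF \<xi>] by blast
    have "- T \<le> f i (y i) \<and> f i (y i) \<le> T" for i
      using bd[OF in_space_N[OF \<xi> y], of i] by linarith
    then obtain l where l: "- T \<le> l" "l \<le> T" "((\<lambda>i. f i (y i)) \<longlongrightarrow> l) U"
      using bounded_real_tendsto[of "-T" "\<lambda>i. f i (y i)" T] by auto
    have "((\<lambda>i. f i (x i)) \<longlongrightarrow> l) U" if x: "x \<in> \<xi>" for x
    proof (rule Lim_transform_eventually[OF l(3)])
      have "y \<in> pt x" using in_ulim_set_member(3)[of \<xi> x] x y \<xi> by (simp add: space_N)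
      then have "eventually (\<lambda>i. x i = y i) U" by (simp add: pt_iff)
      then show "eventually (\<lambda>i. f i (y i) = f i (x i)) U" by eventually_elim simp
    qed
    then show ?thesis using l by (intro exI[of _ l]) auto
  qed
  then obtain g where g: "\<And>\<xi>. \<xi> \<in> space N \<Longrightarrow> \<bar>g \<xi>\<bar> \<le> T"
    "\<And>\<xi> x. \<xi> \<in> space N \<Longrightarrow> x \<in> \<xi> \<Longrightarrow> ((\<lambda>i. f i (x i)) \<longlongrightarrow> g \<xi>) U"
    by metis
  \<comment> \<open>The condition in \<open>A n k i\<close> says that \<open>f i x\<close> has reached the \<open>k\<close>-th of \<open>n\<close> grid points.\<close>
  define A where "A = (\<lambda>(n::nat) (k::nat) i. {x\<in>space (M i). real k \<le> real n * ((f i x + T) / (2 * T))})"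
  have A [measurable]: "A n k i \<in> sets (M i)" for n k i unfolding A_def by measurable
  have Ai: "A n k \<in> internal" for n k by (rule internalI) (rule A)
  have A' [measurable]: "ulim_set U M (A n k) \<in> sets N" for n k by (rule internal_sets[OF Ai])
  define \<phi> where "\<phi> = (\<lambda>n i x. 2 * T / real n * (\<Sum>k=1..n. indicator (A n k i) x) - T)"
  define \<gamma> where "\<gamma> = (\<lambda>n \<xi>. 2 * T / real n * (\<Sum>k=1..n. indicator (ulim_set U M (A n k)) \<xi>) - T)"
  have \<phi>_meas [measurable]: "\<phi> n i \<in> borel_measurable (M i)" for n i unfolding \<phi>_def by measurable
  have \<gamma>_meas [measurable]: "\<gamma> n \<in> borel_measurable N" for n unfolding \<gamma>_def by measurable
  have near: "\<bar>f i x - \<phi> n i x\<bar> \<le> 2 * T / real n" if x: "x \<in> space (M i)" and n: "n > 0" for i x n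
  proof -
    define z where "z = real n * ((f i x + T) / (2 * T))"
    have "0 \<le> f i x + T" "f i x + T \<le> 2 * T" using bd[OF x] by linarith+
    then have y: "0 \<le> (f i x + T) / (2 * T)" "(f i x + T) / (2 * T) \<le> 1" using T by auto
    then have z: "0 \<le> z" "z \<le> real n"
      unfolding z_def by (intro mult_nonneg_nonneg mult_left_le; simp)+
    have "(\<Sum>k=1..n. indicator (A n k i) x) = (\<Sum>k=1..n. if real k \<le> z then 1 else (0::real))"
      using x by (intro sum.cong) (auto simp: A_def z_def indicator_def)
    then have \<phi>: "\<phi> n i x = 2 * T / real n * real_of_int \<lfloor>z\<rfloor> - T"
      unfolding \<phi>_def using sum_indicator_floor[OF z] by simp
    have fz: "f i x = 2 * T / real n * z - T" using n T by (simp add: z_def field_simps)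
    have "f i x - \<phi> n i x = 2 * T / real n * (z - real_of_int \<lfloor>z\<rfloor>)"
      unfolding \<phi> fz right_diff_distrib by linarith
    moreover have "0 \<le> z - real_of_int \<lfloor>z\<rfloor>" "z - real_of_int \<lfloor>z\<rfloor> \<le> 1" by linarith+
    moreover have "0 \<le> 2 * T / real n" using T by simp
    ultimately show ?thesis
      using mult_left_le[of "z - real_of_int \<lfloor>z\<rfloor>" "2 * T / real n"] T by (simp add: abs_mult)
  qed
  have lim: "((\<lambda>i. \<phi> n i (x i)) \<longlongrightarrow> \<gamma> n \<xi>) U" if "\<xi> \<in> space N" "x \<in> \<xi>" for n \<xi> x
    unfolding \<phi>_def \<gamma>_def by (intro tendsto_intros ulim_indicator that)
  have near': "\<bar>g \<xi> - \<gamma> n \<xi>\<bar> \<le> 2 * T / real n" if \<xi>: "\<xi> \<in> space N" and n: "n > 0" for n \<xi>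
  proof -
    obtain x where x: "x \<in> \<xi>" using nonempty_N[OF \<xi>] by blast
    have "((\<lambda>i. \<bar>f i (x i) - \<phi> n i (x i)\<bar>) \<longlongrightarrow> \<bar>g \<xi> - \<gamma> n \<xi>\<bar>) U"
      by (intro tendsto_intros lim g \<xi> x)
    then show ?thesis
      by (rule tendsto_upperbound) (use near in_space_N[OF \<xi> x] n in \<open>auto intro: always_eventually\<close>)
  qed
  have to0: "(\<lambda>n. 2 * T / real n) \<longlonglongrightarrow> 0" by (rule lim_const_over_n)
  have gm [measurable]: "g \<in> borel_measurable N"
  proof (rule borel_measurable_LIMSEQ_real)
    fix \<xi> assume "\<xi> \<in> space N"
    then have "eventually (\<lambda>n. norm (\<gamma> n \<xi> - g \<xi>) \<le> 2 * T / real n) sequentially"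
      using near'[of \<xi>] by (intro eventually_sequentiallyI[of 1]) (simp add: abs_minus_commute)
    from Lim_null_comparison[OF this to0] show "(\<lambda>n. \<gamma> n \<xi>) \<longlonglongrightarrow> g \<xi>"
      by (rule LIM_zero_cancel)
  qed (rule \<gamma>_meas)
  have int_close: "\<bar>integral\<^sup>L Q u - integral\<^sup>L Q v\<bar> \<le> e"
    if Q: "prob_space Q" and u: "u \<in> borel_measurable Q" and v: "v \<in> borel_measurable Q"
      and bu: "\<And>x. x \<in> space Q \<Longrightarrow> \<bar>u x\<bar> \<le> T" and uv: "\<And>x. x \<in> space Q \<Longrightarrow> \<bar>u x - v x\<bar> \<le> e"
    for Q :: "'c measure" and u v e
  proof -
    interpret prob_space Q by fact
    have iu: "integrable Q u" by (rule integrable_const_bound[of _ T]) (use u bu in auto)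
    have ie: "integrable Q (\<lambda>x. u x - v x)" by (rule integrable_const_bound[of _ e]) (use u v uv in auto)
    have iv: "integrable Q v" using Bochner_Integration.integrable_diff[OF iu ie] by simp
    have "\<bar>integral\<^sup>L Q u - integral\<^sup>L Q v\<bar> = \<bar>\<integral>x. u x - v x \<partial>Q\<bar>" using iu iv by simp
    also have "\<dots> \<le> (\<integral>x. \<bar>u x - v x\<bar> \<partial>Q)" by (rule integral_abs_bound)
    also have "\<dots> \<le> (\<integral>x. e \<partial>Q)" by (rule integral_mono) (use ie uv in auto)
    finally show ?thesis by (simp add: prob_space)
  qed
  have \<phi>_int: "integral\<^sup>L (M i) (\<phi> n i) = 2 * T / real n * (\<Sum>k=1..n. measure (M i) (A n k i)) - T" for n i
  proof -
    interpret prob_space "M i" by simp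
    show ?thesis unfolding \<phi>_def by (simp add: prob_space emeasure_eq_measure)
  qed
  have \<gamma>_int: "integral\<^sup>L N (\<gamma> n) = 2 * T / real n * (\<Sum>k=1..n. measure N (ulim_set U M (A n k))) - T" for n
  proof -
    interpret prob_space N by simp
    show ?thesis unfolding \<gamma>_def by (simp add: prob_space emeasure_eq_measure)
  qed
  have "((\<lambda>i. integral\<^sup>L (M i) (f i)) \<longlongrightarrow> integral\<^sup>L N g) U"
  proof (rule tendsto_approx)
    fix e :: real assume e: "e > 0"
    obtain n where n1: "2 * T / e < real n" using reals_Archimedean2 by blast
    have "0 < 2 * T / e" using T e by simp
    with n1 have n0: "n > 0" by (metis gr0I less_trans of_nat_0 less_irrefl)
    with n1 e have n: "n > 0" "2 * T / real n < e" by (simp_all add: divide_less_eq mult.commute)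
    show "\<exists>a b. (\<forall>\<^sub>F i in U. norm (integral\<^sup>L (M i) (f i) - a i) \<le> e) \<and> (a \<longlongrightarrow> b) U \<and>
      norm (b - integral\<^sup>L N g) \<le> e"
    proof (intro exI conjI)
      show "\<forall>\<^sub>F i in U. norm (integral\<^sup>L (M i) (f i) - integral\<^sup>L (M i) (\<phi> n i)) \<le> e"
      proof (intro always_eventually allI)
        fix i
        have "\<bar>integral\<^sup>L (M i) (f i) - integral\<^sup>L (M i) (\<phi> n i)\<bar> \<le> 2 * T / real n"
          by (rule int_close[OF _ f \<phi>_meas bd near[OF _ n(1)]]) simp_all
        then show "norm (integral\<^sup>L (M i) (f i) - integral\<^sup>L (M i) (\<phi> n i)) \<le> e"
          using n(2) by simp
      qed
      show "((\<lambda>i. integral\<^sup>L (M i) (\<phi> n i)) \<longlongrightarrow> integral\<^sup>L N (\<gamma> n)) U"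
        unfolding \<phi>_int \<gamma>_int by (intro tendsto_intros measure_tendsto Ai)
      have "\<bar>integral\<^sup>L N g - integral\<^sup>L N (\<gamma> n)\<bar> \<le> 2 * T / real n"
        by (rule int_close[OF _ gm \<gamma>_meas g(1) near'[OF _ n(1)]]) simp_all
      then show "norm (integral\<^sup>L N (\<gamma> n) - integral\<^sup>L N g) \<le> e"
        using n by (simp add: abs_minus_commute)
    qed
  qed
  then show ?thesis using g gm by blast
qed

lemma integral_bounded_real:
  fixes f :: "'i \<Rightarrow> 'a \<Rightarrow> real"
  assumes f: "\<And>i. f i \<in> borel_measurable (M i)" "\<And>i x. x \<in> space (M i) \<Longrightarrow> \<bar>f i x\<bar> \<le> T" and T: "T > 0"
    and fg: "ulim_AE f g" and g: "g \<in> borel_measurable N"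
  shows "((\<lambda>i. integral\<^sup>L (M i) (f i)) \<longlongrightarrow> integral\<^sup>L N g) U"
proof -
  obtain g' where g': "g' \<in> borel_measurable N"
    "\<And>\<xi> x. \<xi> \<in> space N \<Longrightarrow> x \<in> \<xi> \<Longrightarrow> ((\<lambda>i. f i (x i)) \<longlongrightarrow> g' \<xi>) U"
    "((\<lambda>i. integral\<^sup>L (M i) (f i)) \<longlongrightarrow> integral\<^sup>L N g') U"
    using bounded_real_ulim[OF f(1) T f(2)] by metis
  have "ulim_AE f g'" unfolding ulim_AE_def by (rule AE_I2, rule ballI, rule g'(2))
  then have "integral\<^sup>L N g' = integral\<^sup>L N g"
    by (intro integral_cong_AE g g' ulim_AE_unique[OF _ fg])
  then show ?thesis using g'(3) by simp
qed

lemma integrable_bounded: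
  fixes f :: "'c \<Rightarrow> 'b::{banach, second_countable_topology}"
  assumes "prob_space Q" "f \<in> borel_measurable Q" "\<And>x. x \<in> space Q \<Longrightarrow> norm (f x) \<le> T"
  shows "integrable Q f"
proof -
  interpret prob_space Q by fact
  show ?thesis by (rule integrable_const_bound[of _ T]) (use assms in auto)
qed

lemma bounded_complex_ulim:
  fixes f :: "'i \<Rightarrow> 'a \<Rightarrow> complex"
  assumes f [measurable]: "\<And>i. f i \<in> borel_measurable (M i)" and T: "T > 0"
    and bd: "\<And>i x. x \<in> space (M i) \<Longrightarrow> norm (f i x) \<le> T"
  shows "\<exists>g. g \<in> borel_measurable N \<and> ulim_AE f g \<and> (\<forall>\<xi>\<in>space N. norm (g \<xi>) \<le> T)"
proof -
  have Re: "\<bar>Re (f i x)\<bar> \<le> T" "\<bar>Im (f i x)\<bar> \<le> T" if "x \<in> space (M i)" for i x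
    using bd[OF that] abs_Re_le_cmod[of "f i x"] abs_Im_le_cmod[of "f i x"] by linarith+
  obtain a where a: "a \<in> borel_measurable N"
    "\<And>\<xi> x. \<xi> \<in> space N \<Longrightarrow> x \<in> \<xi> \<Longrightarrow> ((\<lambda>i. Re (f i (x i))) \<longlongrightarrow> a \<xi>) U"
    using bounded_real_ulim[of "\<lambda>i x. Re (f i x)", OF _ T Re(1)] by auto
  obtain b where b: "b \<in> borel_measurable N"
    "\<And>\<xi> x. \<xi> \<in> space N \<Longrightarrow> x \<in> \<xi> \<Longrightarrow> ((\<lambda>i. Im (f i (x i))) \<longlongrightarrow> b \<xi>) U"
    using bounded_real_ulim[of "\<lambda>i x. Im (f i x)", OF _ T Re(2)] by auto
  define g where "g = (\<lambda>\<xi>. Complex (a \<xi>) (b \<xi>))"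
  have lim: "((\<lambda>i. f i (x i)) \<longlongrightarrow> g \<xi>) U" if "\<xi> \<in> space N" "x \<in> \<xi>" for \<xi> x
    unfolding tendsto_complex_iff g_def using a(2) b(2) that by simp
  have "norm (g \<xi>) \<le> T" if \<xi>: "\<xi> \<in> space N" for \<xi>
  proof -
    obtain x where x: "x \<in> \<xi>" using nonempty_N[OF \<xi>] by blast
    show ?thesis
      by (rule tendsto_upperbound[OF tendsto_norm[OF lim[OF \<xi> x]]])
        (use bd in_space_N[OF \<xi> x] in \<open>auto intro: always_eventually\<close>)
  qed
  moreover have "g \<in> borel_measurable N"
    unfolding g_def Complex_eq using a(1) b(1) by measurable
  moreover have "ulim_AE f g" unfolding ulim_AE_def by (rule AE_I2, rule ballI, rule lim)
  ultimately show ?thesis by blast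
qed

lemma integral_bounded_complex:
  fixes f :: "'i \<Rightarrow> 'a \<Rightarrow> complex"
  assumes f [measurable]: "\<And>i. f i \<in> borel_measurable (M i)"
    and bd: "\<And>i x. x \<in> space (M i) \<Longrightarrow> norm (f i x) \<le> T" and T: "T > 0"
    and fg: "ulim_AE f g" and g [measurable]: "g \<in> borel_measurable N"
  shows "((\<lambda>i. integral\<^sup>L (M i) (f i)) \<longlongrightarrow> integral\<^sup>L N g) U"
proof -
  obtain g' where g': "g' \<in> borel_measurable N" "ulim_AE f g'" "\<And>\<xi>. \<xi> \<in> space N \<Longrightarrow> norm (g' \<xi>) \<le> T"
    using bounded_complex_ulim[OF f T bd] by metis
  have eq: "integral\<^sup>L N g = integral\<^sup>L N g'"
    by (intro integral_cong_AE g g' ulim_AE_unique[OF fg])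
  have ig: "integrable N g'" by (rule integrable_bounded) (use g' in auto)
  have int_f: "integrable (M i) (f i)" for i by (rule integrable_bounded) (use bd in auto)
  have Re: "\<bar>Re (f i x)\<bar> \<le> T" "\<bar>Im (f i x)\<bar> \<le> T" if "x \<in> space (M i)" for i x
    using bd[OF that] abs_Re_le_cmod[of "f i x"] abs_Im_le_cmod[of "f i x"] by linarith+
  have "((\<lambda>i. \<integral>x. Re (f i x) \<partial>M i) \<longlongrightarrow> (\<integral>x. Re (g' x) \<partial>N)) U"
    by (rule integral_bounded_real[OF _ Re(1) T ulim_AE_continuous[OF g'(2), of Re]])
      (use g'(1) in \<open>auto intro: continuous_intros\<close>)
  moreover have "((\<lambda>i. \<integral>x. Im (f i x) \<partial>M i) \<longlongrightarrow> (\<integral>x. Im (g' x) \<partial>N)) U"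
    by (rule integral_bounded_real[OF _ Re(2) T ulim_AE_continuous[OF g'(2), of Im]])
      (use g'(1) in \<open>auto intro: continuous_intros\<close>)
  ultimately show ?thesis
    unfolding eq tendsto_complex_iff using ig int_f by simp
qed

end

section \<open>Convergence of integrals\<close>

lemma Fatou_integral_le:
  fixes u :: "nat \<Rightarrow> 'c \<Rightarrow> real"
  assumes u: "\<And>k. integrable Q (u k)" "\<And>k x. 0 \<le> u k x"
    and lim: "AE x in Q. (\<lambda>k. u k x) \<longlonglongrightarrow> v x" and v: "v \<in> borel_measurable Q"
    and K: "\<And>k. integral\<^sup>L Q (u k) \<le> K"
  shows "integrable Q v" "integral\<^sup>L Q v \<le> K"
proof -
  have "0 \<le> integral\<^sup>L Q (u 0)" using u(2) by simp
  also have "\<dots> \<le> K" by (rule K)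
  finally have K0: "0 \<le> K" .
  have um [measurable]: "u k \<in> borel_measurable Q" for k using u(1) by auto
  have pos: "AE x in Q. 0 \<le> v x"
    using lim by eventually_elim (rule LIMSEQ_le_const, use u(2) in auto)
  have "(\<integral>\<^sup>+x. ennreal (v x) \<partial>Q) = (\<integral>\<^sup>+x. liminf (\<lambda>k. ennreal (u k x)) \<partial>Q)"
    using lim
    by (intro nn_integral_cong_AE, eventually_elim)
      (rule lim_imp_Liminf[symmetric], simp, erule tendsto_ennrealI)
  also have "\<dots> \<le> liminf (\<lambda>k. \<integral>\<^sup>+x. ennreal (u k x) \<partial>Q)"
    by (rule nn_integral_liminf) measurable
  also have "\<dots> \<le> ennreal K"
  proof (rule Liminf_le)
    have "(\<integral>\<^sup>+x. ennreal (u k x) \<partial>Q) = ennreal (integral\<^sup>L Q (u k))" for k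
      by (rule nn_integral_eq_integral) (use u in auto)
    then show "\<forall>\<^sub>F k in sequentially. (\<integral>\<^sup>+x. ennreal (u k x) \<partial>Q) \<le> ennreal K"
      using K by (simp add: ennreal_leI)
  qed simp
  finally have le: "(\<integral>\<^sup>+x. ennreal (v x) \<partial>Q) \<le> ennreal K" .
  then have "(\<integral>\<^sup>+x. ennreal (v x) \<partial>Q) < \<infinity>" by (metis ennreal_less_top infinity_ennreal_def le_less_trans)
  then show int: "integrable Q v" by (intro integrableI_nonneg v pos)
  show "integral\<^sup>L Q v \<le> K"
    using le nn_integral_eq_integral[OF int pos] K0 by (simp add: ennreal_le_iff)
qed

context prob_ultraproduct
begin

text \<open>
  A family that is bounded in \<open>L\<^sup>1\<close> has an almost everywhere finite ultralimit. Dividing by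
  \<open>1 + |f|\<close> reduces this to bounded families: \<open>f = v / u\<close> with \<open>u = 1 / (1 + |f|)\<close> and \<open>v = u f\<close>, and
  by Markov's inequality the ultralimit \<open>w\<close> of \<open>u\<close> vanishes on a null set only.
\<close>

lemma ulim_AE_exists:
  fixes f :: "'i \<Rightarrow> 'a \<Rightarrow> complex"
  assumes f: "\<And>i. integrable (M i) (f i)"
    and K: "eventually (\<lambda>i. (\<integral>x. norm (f i x) \<partial>M i) \<le> K) U"
  shows "\<exists>g. g \<in> borel_measurable N \<and> ulim_AE f g"
proof -
  have fm [measurable]: "f i \<in> borel_measurable (M i)" for i using f by auto
  define u where "u = (\<lambda>i x. complex_of_real (1 / (1 + norm (f i x))))"
  define v where "v = (\<lambda>i x. u i x * f i x)"
  have pos: "1 + norm (f i x) > 0" for i x by (simp add: add_pos_nonneg)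
  have nu: "norm (u i x) = 1 / (1 + norm (f i x))" for i x
    unfolding u_def norm_of_real using pos[of i x] by simp
  have um [measurable]: "u i \<in> borel_measurable (M i)" for i unfolding u_def by measurable
  have vm [measurable]: "v i \<in> borel_measurable (M i)" for i unfolding v_def by measurable
  have u0: "u i x \<noteq> 0" for i x using nu[of i x] pos[of i x] by auto
  have nu1: "norm (u i x) \<le> 1" for i x unfolding nu using pos[of i x] by (simp add: divide_le_eq)
  have nv1: "norm (v i x) \<le> 1" for i x
    unfolding v_def norm_mult nu using pos[of i x] by (simp add: divide_le_eq)
  obtain w where w [measurable]: "w \<in> borel_measurable N" and uw: "ulim_AE u w"
    using bounded_complex_ulim[of u 1] nu1 um by auto
  obtain z where z [measurable]: "z \<in> borel_measurable N" and vz: "ulim_AE v z"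
    using bounded_complex_ulim[of v 1] nv1 vm by auto
  define A where "A = (\<lambda>(n::nat) i. {x\<in>space (M i). norm (f i x) \<ge> real n})"
  have Ai: "A n \<in> internal" for n by (rule internalI) (simp add: A_def)
  have mA: "measure N (ulim_set U M (A n)) \<le> K / real n" if n: "n > 0" for n
  proof (rule tendsto_upperbound[OF measure_tendsto[OF Ai]])
    show "eventually (\<lambda>i. measure (M i) (A n i) \<le> K / real n) U"
      using K
    proof eventually_elim
      case (elim i)
      have "measure (M i) (A n i) \<le> (\<integral>x. norm (f i x) \<partial>M i) / real n"
        unfolding A_def by (rule integral_Markov_inequality_measure[where A = "{}"]) (use f n in auto)
      also have "\<dots> \<le> K / real n" using elim n by (simp add: divide_right_mono)
      finally show ?case .
    qed
  qed simp
  define Z where "Z = {\<xi>\<in>space N. w \<xi> = 0}"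
  have Zm [measurable]: "Z \<in> sets N" unfolding Z_def by measurable
  have sp: "AE \<xi> in N. \<xi> \<in> space N" by simp
  have ZA: "AE \<xi> in N. \<xi> \<in> Z \<longrightarrow> \<xi> \<in> ulim_set U M (A n)" for n
    using uw[unfolded ulim_AE_def] sp
  proof eventually_elim
    case (elim \<xi>)
    show ?case
    proof
      assume "\<xi> \<in> Z"
      obtain x where x: "x \<in> \<xi>" using nonempty_N elim(2) by blast
      have "((\<lambda>i. u i (x i)) \<longlongrightarrow> 0) U" using elim(1) x \<open>\<xi> \<in> Z\<close> by (auto simp: Z_def)
      then have "eventually (\<lambda>i. norm (u i (x i)) < 1 / (1 + real n)) U"
        by (intro order_tendstoD(2)[OF tendsto_norm_zero]) auto
      then have "eventually (\<lambda>i. x i \<in> A n i) U"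
      proof eventually_elim
        case (elim i)
        then have "norm (f i (x i)) \<ge> real n"
          using pos[of i "x i"] by (simp add: nu field_simps)
        then show ?case using in_space_N[OF \<open>\<xi> \<in> space N\<close> x] by (simp add: A_def)
      qed
      then show "\<xi> \<in> ulim_set U M (A n)"
        using in_ulim_set_member(1)[of \<xi> x] elim(2) x by (simp add: space_N)
    qed
  qed
  have le: "measure N Z \<le> K / real n" if "n > 0" for n
  proof -
    interpret finite_measure N by simp
    have "measure N Z \<le> measure N (ulim_set U M (A n))"
      by (rule finite_measure_mono_AE[OF ZA internal_sets[OF Ai]])
    then show ?thesis using mA[OF that] by simp
  qed
  have "measure N Z \<le> 0"
    by (rule LIMSEQ_le_const[OF lim_const_over_n[of K]]) (use le in \<open>auto intro!: exI[of _ 1]\<close>)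
  then have "measure N Z = 0" by (simp add: measure_le_0_iff)
  then have "emeasure N Z = 0"
    by (simp add: finite_measure.emeasure_eq_measure)
  then have "AE \<xi> in N. \<xi> \<notin> Z" by (intro AE_not_in) (simp add: null_sets_def)
  then have "AE \<xi> in N. w \<xi> \<noteq> 0" using sp by eventually_elim (simp add: Z_def)
  then have "ulim_AE f (\<lambda>\<xi>. z \<xi> / w \<xi>)"
    using uw vz unfolding ulim_AE_def
  proof eventually_elim
    case (elim \<xi>)
    have "((\<lambda>i. v i (x i) / u i (x i)) \<longlongrightarrow> z \<xi> / w \<xi>) U" if "x \<in> \<xi>" for x
      using elim that by (intro tendsto_divide) auto
    then show ?case using u0 by (simp add: v_def)
  qed
  then show ?thesis by (intro exI[of _ "\<lambda>\<xi>. z \<xi> / w \<xi>"]) auto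
qed

lemma ulim_Fatou:
  fixes f :: "'i \<Rightarrow> 'a \<Rightarrow> complex"
  assumes f: "\<And>i. integrable (M i) (f i)"
    and K: "eventually (\<lambda>i. (\<integral>x. norm (f i x) \<partial>M i) \<le> K) U"
    and fg: "ulim_AE f g" and g [measurable]: "g \<in> borel_measurable N"
  shows "integrable N g" "(\<integral>\<xi>. norm (g \<xi>) \<partial>N) \<le> K"
proof -
  have fm [measurable]: "f i \<in> borel_measurable (M i)" for i using f by auto
  define u where "u = (\<lambda>(k::nat) \<xi>. min (norm (g \<xi>)) (real (Suc k)))"
  have ui: "integrable N (u k)" for k
    by (rule integrable_bounded[where T = "real (Suc k)"]) (auto simp: u_def)
  have uK: "integral\<^sup>L N (u k) \<le> K" for k
  proof (rule tendsto_upperbound)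
    show "((\<lambda>i. \<integral>x. min (norm (f i x)) (real (Suc k)) \<partial>M i) \<longlongrightarrow> integral\<^sup>L N (u k)) U"
      unfolding u_def
      by (rule integral_bounded_real[where T = "real (Suc k)"])
        (auto intro!: ulim_AE_continuous[OF fg] continuous_intros)
    show "eventually (\<lambda>i. (\<integral>x. min (norm (f i x)) (real (Suc k)) \<partial>M i) \<le> K) U"
      using K
    proof eventually_elim
      case (elim i)
      have "(\<integral>x. min (norm (f i x)) (real (Suc k)) \<partial>M i) \<le> (\<integral>x. norm (f i x) \<partial>M i)"
        by (rule integral_mono) (use f in \<open>auto intro!: integrable_bounded[where T = "real (Suc k)"]\<close>)
      with elim show ?case by simp
    qed
  qed simp
  have lim: "AE \<xi> in N. (\<lambda>k. u k \<xi>) \<longlonglongrightarrow> norm (g \<xi>)"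
    unfolding u_def by (rule AE_I2, rule LIMSEQ_Suc, rule min_real_of_nat_tendsto)
  note * = Fatou_integral_le[OF ui _ lim _ uK]
  have "integrable N (\<lambda>\<xi>. norm (g \<xi>))" by (rule *(1)) (auto simp: u_def)
  then show "integrable N g" by (simp add: integrable_norm_iff)
  show "(\<integral>\<xi>. norm (g \<xi>) \<partial>N) \<le> K" by (rule *(2)) (auto simp: u_def)
qed

text \<open>
  Uniform integrability along the ultrafilter: the part of \<open>f i\<close> above a level \<open>B\<close> is small in \<open>L\<^sup>1\<close>
  for almost all \<open>i\<close>.
\<close>

definition unif_integrable :: "('i \<Rightarrow> 'a \<Rightarrow> complex) \<Rightarrow> bool" where
  "unif_integrable f \<longleftrightarrow> (\<forall>i. integrable (M i) (f i)) \<and>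
    (\<forall>e>0. \<exists>B>0. eventually (\<lambda>i. (\<integral>x. norm (f i x - trunc B (f i x)) \<partial>M i) \<le> e) U)"

lemma integrable_trunc:
  assumes "integrable Q f" "B > 0" shows "integrable Q (\<lambda>x. trunc B (f x))"
  by (rule Bochner_Integration.integrable_bound[OF assms(1)])
    (use assms norm_trunc_le in \<open>auto\<close>)

lemma unif_integrable_mono:
  assumes f: "unif_integrable f" and f' [measurable]: "\<And>i. f' i \<in> borel_measurable (M i)"
    and le: "\<And>i x. x \<in> space (M i) \<Longrightarrow> norm (f' i x) \<le> norm (f i x)"
  shows "unif_integrable f'"
  unfolding unif_integrable_def
proof (intro conjI allI impI)
  have fi: "integrable (M i) (f i)" for i using f by (simp add: unif_integrable_def)
  show fi': "integrable (M i) (f' i)" for i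
    by (rule Bochner_Integration.integrable_bound[OF fi]) (use le in auto)
  fix e :: real assume "e > 0"
  then obtain B where B: "B > 0"
    "eventually (\<lambda>i. (\<integral>x. norm (f i x - trunc B (f i x)) \<partial>M i) \<le> e) U"
    using f by (auto simp: unif_integrable_def)
  have "(\<integral>x. norm (f' i x - trunc B (f' i x)) \<partial>M i) \<le> (\<integral>x. norm (f i x - trunc B (f i x)) \<partial>M i)" for i
  proof (rule integral_mono)
    show "integrable (M i) (\<lambda>x. norm (f' i x - trunc B (f' i x)))"
      "integrable (M i) (\<lambda>x. norm (f i x - trunc B (f i x)))"
      by (intro integrable_norm Bochner_Integration.integrable_diff integrable_trunc fi fi' B(1))+
    show "norm (f' i x - trunc B (f' i x)) \<le> norm (f i x - trunc B (f i x))" if "x \<in> space (M i)" for x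
      using le[OF that] B(1) by (simp add: norm_diff_trunc)
  qed
  then show "\<exists>B>0. eventually (\<lambda>i. (\<integral>x. norm (f' i x - trunc B (f' i x)) \<partial>M i) \<le> e) U"
    using B by (intro exI[of _ B] conjI) (auto elim!: eventually_mono intro: order_trans)
qed

lemma ulim_integral:
  assumes f: "unif_integrable f" and fg: "ulim_AE f g" and g [measurable]: "g \<in> borel_measurable N"
  shows "integrable N g" "((\<lambda>i. integral\<^sup>L (M i) (f i)) \<longlongrightarrow> integral\<^sup>L N g) U"
proof -
  have fi: "integrable (M i) (f i)" for i using f by (simp add: unif_integrable_def)
  have fm [measurable]: "f i \<in> borel_measurable (M i)" for i using fi by auto
  have tr: "ulim_AE (\<lambda>i x. trunc B (f i x)) (\<lambda>\<xi>. trunc B (g \<xi>))" if "B > 0" for B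
    by (rule ulim_AE_continuous[OF fg continuous_trunc[OF that]])
  have gb: "integrable N (\<lambda>\<xi>. trunc B (g \<xi>))" if "B > 0" for B
    by (rule integrable_bounded[where T = B]) (use that in \<open>auto simp: norm_trunc\<close>)
  have diff: "integrable N (\<lambda>\<xi>. g \<xi> - trunc B (g \<xi>))" "(\<integral>\<xi>. norm (g \<xi> - trunc B (g \<xi>)) \<partial>N) \<le> e"
    if "B > 0" "eventually (\<lambda>i. (\<integral>x. norm (f i x - trunc B (f i x)) \<partial>M i) \<le> e) U" for B e
    using ulim_Fatou[OF _ that(2) ulim_AE_diff[OF fg tr[OF that(1)]]] fi that(1)
    by (auto simp: integrable_trunc)
  obtain B1 where "B1 > 0" "eventually (\<lambda>i. (\<integral>x. norm (f i x - trunc B1 (f i x)) \<partial>M i) \<le> 1) U"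
    using f unfolding unif_integrable_def by (meson zero_less_one)
  then have "integrable N (\<lambda>\<xi>. (g \<xi> - trunc B1 (g \<xi>)) + trunc B1 (g \<xi>))"
    by (intro Bochner_Integration.integrable_add diff(1) gb)
  then show gi: "integrable N g" by simp
  show "((\<lambda>i. integral\<^sup>L (M i) (f i)) \<longlongrightarrow> integral\<^sup>L N g) U"
  proof (rule tendsto_approx)
    fix e :: real assume "e > 0"
    then obtain B where B: "B > 0"
      "eventually (\<lambda>i. (\<integral>x. norm (f i x - trunc B (f i x)) \<partial>M i) \<le> e) U"
      using f unfolding unif_integrable_def by meson
    have le: "norm (integral\<^sup>L Q h - (\<integral>x. trunc B (h x) \<partial>Q)) \<le> (\<integral>x. norm (h x - trunc B (h x)) \<partial>Q)"
      if "integrable Q h" for Q :: "'c measure" and h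
      using integral_norm_bound[of Q "\<lambda>x. h x - trunc B (h x)"] integrable_trunc[OF that B(1)] that
      by simp
    show "\<exists>a b. (\<forall>\<^sub>F i in U. norm (integral\<^sup>L (M i) (f i) - a i) \<le> e) \<and> (a \<longlongrightarrow> b) U \<and>
      norm (b - integral\<^sup>L N g) \<le> e"
    proof (intro exI conjI)
      show "\<forall>\<^sub>F i in U. norm (integral\<^sup>L (M i) (f i) - (\<integral>x. trunc B (f i x) \<partial>M i)) \<le> e"
        using B(2) by eventually_elim (use le[OF fi] in \<open>auto intro: order_trans\<close>)
      show "((\<lambda>i. \<integral>x. trunc B (f i x) \<partial>M i) \<longlongrightarrow> (\<integral>\<xi>. trunc B (g \<xi>) \<partial>N)) U"
        by (rule integral_bounded_complex[OF _ _ B(1) tr[OF B(1)]])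
          (use B(1) in \<open>auto simp: norm_trunc\<close>)
      show "norm ((\<integral>\<xi>. trunc B (g \<xi>) \<partial>N) - integral\<^sup>L N g) \<le> e"
        using le[OF gi] diff(2)[OF B] by (simp add: norm_minus_commute)
    qed
  qed
qed

lemma ulim_set_integral_norm:
  assumes f: "unif_integrable f" and fg: "ulim_AE f g" and g [measurable]: "g \<in> borel_measurable N"
    and A: "A \<in> internal"
  shows "((\<lambda>i. LINT x:A i|M i. norm (f i x)) \<longlongrightarrow> (LINT \<xi>:ulim_set U M A|N. norm (g \<xi>))) U"
proof -
  have fi: "integrable (M i) (f i)" for i using f by (simp add: unif_integrable_def)
  have fm [measurable]: "f i \<in> borel_measurable (M i)" for i using fi by auto
  have Am [measurable]: "A i \<in> sets (M i)" for i using A by (simp add: internal_def)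
  note [measurable] = internal_sets[OF A]
  define f' where "f' = (\<lambda>i x. indicator (A i) x * complex_of_real (norm (f i x)))"
  define g' where "g' = (\<lambda>\<xi>. indicator (ulim_set U M A) \<xi> * complex_of_real (norm (g \<xi>)))"
  have f': "f' i x = complex_of_real (indicator (A i) x *\<^sub>R norm (f i x))" for i x
    by (simp add: f'_def indicator_def)
  have g': "g' \<xi> = complex_of_real (indicator (ulim_set U M A) \<xi> *\<^sub>R norm (g \<xi>))" for \<xi>
    by (simp add: g'_def indicator_def)
  have "unif_integrable f'"
    by (rule unif_integrable_mono[OF f]) (auto simp: f'_def norm_mult indicator_def)
  moreover have "ulim_AE f' g'"
    unfolding f'_def g'_def
    by (intro ulim_AE_mult ulim_AE_indicator ulim_AE_continuous[OF fg] continuous_intros)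
  moreover have "g' \<in> borel_measurable N" unfolding g'_def by measurable
  ultimately have "((\<lambda>i. integral\<^sup>L (M i) (f' i)) \<longlongrightarrow> integral\<^sup>L N g') U"
    by (rule ulim_integral(2))
  then show ?thesis
    unfolding f' g' integral_complex_of_real set_lebesgue_integral_def tendsto_of_real_iff .
qed

end

section \<open>Majorants\<close>

lemma majorantD:
  assumes "\<rho> \<in> majorants"
  shows majorant_0: "\<rho> 0 = 0" and majorant_1: "\<rho> 1 = 1"
    and majorant_nonneg: "0 \<le> t \<Longrightarrow> t \<le> 1 \<Longrightarrow> 0 \<le> \<rho> t"
    and majorant_le_1: "0 \<le> t \<Longrightarrow> t \<le> 1 \<Longrightarrow> \<rho> t \<le> 1"
  using assms by (auto simp: majorants_def image_subset_iff)

lemma majorant_concave: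
  assumes "\<rho> \<in> majorants" "0 \<le> x" "x \<le> 1" "0 \<le> y" "y \<le> 1" "0 \<le> u" "u \<le> 1"
  shows "(1 - u) * \<rho> x + u * \<rho> y \<le> \<rho> ((1 - u) * x + u * y)"
  using concave_onD[of "{0..1}" \<rho> u x y] assms by (auto simp: majorants_def)

text \<open>
  The quotient \<open>\<rho>(t) / t\<close> is nonincreasing, written without division.
\<close>

lemma majorant_ratio:
  assumes \<rho>: "\<rho> \<in> majorants" and t: "0 \<le> t" "t \<le> a" "a \<le> 1"
  shows "\<rho> a * t \<le> \<rho> t * a"
proof (cases "a = 0")
  case False
  then have "a > 0" using t by simp
  then have "t / a * \<rho> a \<le> \<rho> t"
    using majorant_concave[OF \<rho>, of 0 a "t/a"] t by (simp add: majorant_0[OF \<rho>])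
  then show ?thesis using \<open>a > 0\<close> by (simp add: field_simps)
qed (use t in simp)

lemma majorant_ge:
  assumes "\<rho> \<in> majorants" "0 \<le> t" "t \<le> 1" shows "t \<le> \<rho> t"
  using majorant_ratio[OF assms order_refl] by (simp add: majorant_1[OF assms(1)])

lemma majorant_mono:
  assumes \<rho>: "\<rho> \<in> majorants" and t: "0 \<le> t" "t \<le> a" "a \<le> 1"
  shows "\<rho> t \<le> \<rho> a"
proof (cases "t = 1")
  case False
  define u where "u = (a - t) / (1 - t)"
  have t1: "t < 1" using False t by simp
  have u: "0 \<le> u" "u \<le> 1" unfolding u_def using t t1 by (auto simp: divide_le_eq)
  have "(1 - u) * t + u = t + u * (1 - t)" by (simp add: algebra_simps)
  also have "\<dots> = a" using t1 by (simp add: u_def)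
  finally have a: "(1 - u) * t + u * 1 = a" by simp
  have "(1 - u) * \<rho> t + u * \<rho> 1 \<le> \<rho> a"
    using majorant_concave[OF \<rho>, of t 1 u] t u unfolding a by simp
  moreover have "u * \<rho> t \<le> u * \<rho> 1"
    using majorant_le_1[OF \<rho>, of t] majorant_1[OF \<rho>] u t by (intro mult_left_mono) auto
  ultimately show ?thesis by (simp add: algebra_simps)
qed (use t in auto)

lemma majorant_small:
  assumes \<rho>: "\<rho> \<in> majorants" and e: "e > 0"
  shows "\<exists>d>0. \<forall>t. 0 \<le> t \<longrightarrow> t \<le> d \<longrightarrow> \<rho> t \<le> e"
proof -
  have "(\<rho> \<longlongrightarrow> 0) (at_right 0)" using \<rho> by (simp add: majorants_def)
  then have "eventually (\<lambda>t. \<rho> t < e) (at_right 0)" by (rule order_tendstoD) (rule e)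
  then obtain b where b: "b > 0" "\<And>t. 0 < t \<Longrightarrow> t < b \<Longrightarrow> \<rho> t < e"
    by (auto simp: eventually_at_right_field)
  have "\<rho> t \<le> e" if "0 \<le> t" "t \<le> b / 2" for t
  proof (cases "t = 0")
    case False
    then show ?thesis using b(2)[of t] that b(1) by auto
  qed (use e majorant_0[OF \<rho>] in auto)
  then show ?thesis using b(1) by (intro exI[of _ "b/2"]) auto
qed

lemma majorant_continuous:
  assumes \<rho>: "\<rho> \<in> majorants" shows "continuous_on {0..1} \<rho>"
  unfolding continuous_on_iff
proof (intro ballI allI impI)
  fix a e :: real assume a: "a \<in> {0..1}" and e: "e > 0"
  show "\<exists>d>0. \<forall>t\<in>{0..1}. dist t a < d \<longrightarrow> dist (\<rho> t) (\<rho> a) < e"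
  proof (cases "a = 0")
    case True
    obtain d where d: "d > 0" "\<And>t. 0 \<le> t \<Longrightarrow> t \<le> d \<Longrightarrow> \<rho> t \<le> e / 2"
      using majorant_small[OF \<rho>, of "e/2"] e by auto
    have "dist (\<rho> t) (\<rho> a) < e" if "t \<in> {0..1}" "dist t a < d" for t
      using d(2)[of t] that majorant_nonneg[OF \<rho>, of t] e True majorant_0[OF \<rho>]
      by (auto simp: dist_real_def)
    then show ?thesis using d(1) by blast
  next
    case False
    then have a0: "a > 0" using a by simp
    have le: "(\<rho> s - \<rho> t) * a \<le> s - t" "\<rho> t \<le> \<rho> s" if "0 \<le> t" "t \<le> s" "s \<le> 1" "a \<le> s" for s t
    proof -
      have "\<rho> s * t \<le> \<rho> t * s" by (rule majorant_ratio[OF \<rho>]) (use that in auto)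
      then have "(\<rho> s - \<rho> t) * s \<le> \<rho> s * (s - t)" by (simp add: algebra_simps)
      also have "\<dots> \<le> 1 * (s - t)"
        by (rule mult_right_mono) (use majorant_le_1[OF \<rho>, of s] that in auto)
      finally have *: "(\<rho> s - \<rho> t) * s \<le> s - t" by simp
      show mono: "\<rho> t \<le> \<rho> s" by (rule majorant_mono[OF \<rho>]) (use that in auto)
      have "(\<rho> s - \<rho> t) * a \<le> (\<rho> s - \<rho> t) * s" by (rule mult_left_mono) (use that mono in auto)
      with * show "(\<rho> s - \<rho> t) * a \<le> s - t" by simp
    qed
    have "dist (\<rho> t) (\<rho> a) < e" if t: "t \<in> {0..1}" "dist t a < e * a" for t
    proof -
      have "\<bar>\<rho> t - \<rho> a\<bar> * a \<le> \<bar>t - a\<bar>"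
      proof (cases "t \<le> a")
        case True
        then show ?thesis using le[of t a] a t by (simp add: abs_if)
      next
        case False
        then show ?thesis using le[of a t] a t by (simp add: abs_if)
      qed
      also have "\<dots> < e * a" using t by (simp add: dist_real_def)
      finally show ?thesis using a0 by (simp add: dist_real_def)
    qed
    then show ?thesis using a0 e by (intro exI[of _ "e * a"]) auto
  qed
qed

section \<open>Bounded families in the spaces of a majorant\<close>

text \<open>
  For a probability space and a majorant, this is the condition \<open>\<parallel>f\<parallel> \<le> c\<close> in \<open>C_rho_fun Q \<rho>\<close>,
  including membership of \<open>f\<close>. Null sets \<open>A\<close> need not be excluded, as both sides vanish for them.
\<close>

definition rho_bounded :: "'c measure \<Rightarrow> (real \<Rightarrow> real) \<Rightarrow> real \<Rightarrow> ('c \<Rightarrow> complex) \<Rightarrow> bool" where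
  "rho_bounded Q \<rho> c f \<longleftrightarrow> integrable Q f \<and>
    (\<forall>A\<in>sets Q. (LINT x:A|Q. norm (f x)) \<le> c * \<rho> (measure Q A))"

lemma rho_bounded_integrable: "rho_bounded Q \<rho> c f \<Longrightarrow> integrable Q f"
  by (simp add: rho_bounded_def)

lemma rho_bounded_integral:
  assumes "prob_space Q" "\<rho> \<in> majorants" "rho_bounded Q \<rho> c f"
  shows "(\<integral>x. norm (f x) \<partial>Q) \<le> c" "0 \<le> c"
proof -
  interpret prob_space Q by fact
  have "(LINT x:space Q|Q. norm (f x)) = (\<integral>x. norm (f x) \<partial>Q)"
    by (rule set_integral_space) (use assms(3) in \<open>auto simp: rho_bounded_def\<close>)
  moreover have "(LINT x:space Q|Q. norm (f x)) \<le> c * \<rho> (measure Q (space Q))"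
    using assms(3) sets.top unfolding rho_bounded_def by blast
  ultimately show le: "(\<integral>x. norm (f x) \<partial>Q) \<le> c"
    by (simp add: prob_space majorant_1[OF assms(2)])
  have "0 \<le> (\<integral>x. norm (f x) \<partial>Q)" by simp
  with le show "0 \<le> c" by linarith
qed

lemma C_rho_bounded:
  assumes Q: "prob_space Q" and \<rho>: "\<rho> \<in> majorants"
  shows "rho_bounded Q \<rho> c f \<longleftrightarrow>
    f \<in> carrier (C_rho_fun Q \<rho>) \<and> vnorm (C_rho_fun Q \<rho>) f \<le> c" (is "_ \<longleftrightarrow> ?R")
proof -
  interpret prob_space Q by fact
  have pos: "\<rho> (measure Q A) > 0" if "measure Q A \<noteq> 0" for A
    using majorant_ge[OF \<rho>, of "measure Q A"] that measure_nonneg[of Q A] prob_le_1[of A] by linarith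
  have le: "1 / \<rho> (measure Q A) * I \<le> c \<longleftrightarrow> I \<le> c * \<rho> (measure Q A)" if "measure Q A \<noteq> 0" for A I c
    using pos[OF that] by (simp add: divide_le_eq)
  have zero: "(LINT x:A|Q. norm (f x)) \<le> c * \<rho> (measure Q A)" if A: "A \<in> sets Q" "measure Q A = 0" for A c
  proof -
    have "A \<in> null_sets Q" using A by (simp add: null_sets_def emeasure_eq_measure)
    then have "AE x in Q. x \<notin> A" by (rule AE_not_in)
    then have "AE x in Q. indicator A x *\<^sub>R norm (f x) = 0" by eventually_elim simp
    then have "(LINT x:A|Q. norm (f x)) = 0"
      unfolding set_lebesgue_integral_def by (rule integral_eq_zero_AE)
    then show ?thesis using A majorant_0[OF \<rho>] by simp
  qed
  have all: "(\<forall>A\<in>sets Q. (LINT x:A|Q. norm (f x)) \<le> c * \<rho> (measure Q A)) \<longleftrightarrow>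
    (\<forall>a\<in>rho_averages Q \<rho> f. a \<le> c)" for c
    unfolding rho_averages_def using le zero by blast
  have ne: "rho_averages Q \<rho> f \<noteq> {}"
  proof -
    have "1 / \<rho> (measure Q (space Q)) * (LINT x:space Q|Q. norm (f x)) \<in> rho_averages Q \<rho> f"
      unfolding rho_averages_def using prob_space sets.top[of Q] by fastforce
    then show ?thesis by blast
  qed
  show ?thesis
  proof
    assume f: "rho_bounded Q \<rho> c f"
    then have *: "\<And>a. a \<in> rho_averages Q \<rho> f \<Longrightarrow> a \<le> c" using all by (simp add: rho_bounded_def)
    then have "bdd_above (rho_averages Q \<rho> f)" by (rule bdd_aboveI)
    moreover have "Sup (rho_averages Q \<rho> f) \<le> c" using ne * by (rule cSup_least)
    ultimately show ?R using f by (simp add: C_rho_fun_def rho_bounded_def)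
  next
    assume R: ?R
    then have "bdd_above (rho_averages Q \<rho> f)" "Sup (rho_averages Q \<rho> f) \<le> c"
      by (auto simp: C_rho_fun_def)
    then have "\<forall>a\<in>rho_averages Q \<rho> f. a \<le> c" using cSup_upper order_trans by blast
    then show "rho_bounded Q \<rho> c f" using R all by (simp add: rho_bounded_def C_rho_fun_def)
  qed
qed

context prob_ultraproduct
begin

lemma unif_integrable_rho:
  assumes \<rho>: "\<rho> \<in> majorants" and f: "\<And>i. rho_bounded (M i) \<rho> K (f i)"
  shows "unif_integrable f"
  unfolding unif_integrable_def
proof (intro conjI allI impI)
  have fi: "integrable (M i) (f i)" for i using f by (rule rho_bounded_integrable)
  then show "integrable (M i) (f i)" for i .
  have fm [measurable]: "f i \<in> borel_measurable (M i)" for i using fi by auto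
  have K0: "0 \<le> K" and Kint: "(\<integral>x. norm (f i x) \<partial>M i) \<le> K" for i
    using rho_bounded_integral[OF _ \<rho> f] by simp_all
  fix e :: real assume e: "e > 0"
  obtain d where d: "d > 0" "\<And>t. 0 \<le> t \<Longrightarrow> t \<le> d \<Longrightarrow> \<rho> t \<le> e / (K + 1)"
    using majorant_small[OF \<rho>, of "e / (K + 1)"] e K0 by auto
  \<comment> \<open>By Markov's inequality \<open>|f i| \<ge> B\<close> holds on a set of measure at most \<open>K / B \<le> d\<close>.\<close>
  define B where "B = K / d + 1"
  have B: "B > 0" "K / B \<le> d" using d(1) K0 by (auto simp: B_def field_simps add_nonneg_pos)
  have "(\<integral>x. norm (f i x - trunc B (f i x)) \<partial>M i) \<le> e" for i
  proof -
    define A where "A = {x\<in>space (M i). norm (f i x) \<ge> B}"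
    have Am [measurable]: "A \<in> sets (M i)" unfolding A_def by measurable
    have "measure (M i) A \<le> (\<integral>x. norm (f i x) \<partial>M i) / B"
      unfolding A_def by (rule integral_Markov_inequality_measure[where A = "{}"]) (use fi B in auto)
    also have "\<dots> \<le> K / B" using Kint[of i] B by (simp add: divide_right_mono)
    finally have "measure (M i) A \<le> d" using B by simp
    then have \<rho>A: "\<rho> (measure (M i) A) \<le> e / (K + 1)" by (intro d) auto
    have "(\<integral>x. norm (f i x - trunc B (f i x)) \<partial>M i) \<le> (\<integral>x. indicator A x *\<^sub>R norm (f i x) \<partial>M i)"
    proof (rule integral_mono)
      show "integrable (M i) (\<lambda>x. norm (f i x - trunc B (f i x)))"
        by (intro integrable_norm Bochner_Integration.integrable_diff integrable_trunc fi B(1))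
      show "integrable (M i) (\<lambda>x. indicator A x *\<^sub>R norm (f i x))"
        by (intro integrable_mult_indicator Am integrable_norm fi)
    qed (use B in \<open>auto simp: norm_diff_trunc[OF B(1)] indicator_def A_def\<close>)
    also have "\<dots> \<le> K * \<rho> (measure (M i) A)"
      using f[of i] Am unfolding rho_bounded_def set_lebesgue_integral_def by blast
    also have "\<dots> \<le> K * (e / (K + 1))" by (rule mult_left_mono[OF \<rho>A K0])
    also have "\<dots> \<le> e" using e K0 by (simp add: field_simps)
    finally show ?thesis .
  qed
  then show "\<exists>B>0. eventually (\<lambda>i. (\<integral>x. norm (f i x - trunc B (f i x)) \<partial>M i) \<le> e) U"
    using B(1) by (intro exI[of _ B]) auto
qed

text \<open>
  Every measurable set of the ultraproduct is approximated in measure by internal sets.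
\<close>

lemma internal_approx:
  assumes "A \<in> sets N" "e > 0"
  shows "\<exists>B\<in>internal. measure N (sym_diff A (ulim_set U M B)) < e"
proof -
  interpret prob_space N by simp
  note ism = internal_sets
  define P where "P = (\<lambda>A. A \<in> sets N \<and> (\<forall>e>0. \<exists>B\<in>internal. measure N (sym_diff A (ulim_set U M B)) < e))"
  have P_D: "\<exists>B\<in>internal. measure N (sym_diff A (ulim_set U M B)) < e" if "P A" "e > 0" for A e
    using that by (simp add: P_def)
  have P_Un: "P (A \<union> B)" if PAB: "P A" "P B" for A B
    unfolding P_def
  proof (intro conjI allI impI)
    have AB: "A \<in> sets N" "B \<in> sets N" using PAB by (auto simp: P_def)
    then show "A \<union> B \<in> sets N" by blast
    fix e :: real assume "e > 0"
    then have "e / 2 > 0" by simp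
    then obtain A' B' where A': "A' \<in> internal" "measure N (sym_diff A (ulim_set U M A')) < e / 2"
      and B': "B' \<in> internal" "measure N (sym_diff B (ulim_set U M B')) < e / 2"
      using P_D[OF PAB(1)] P_D[OF PAB(2)] by metis
    have "measure N (sym_diff (A \<union> B) (ulim_set U M (\<lambda>i. A' i \<union> B' i)))
        \<le> measure N (sym_diff A (ulim_set U M A') \<union> sym_diff B (ulim_set U M B'))"
      unfolding ulim_set_Un[symmetric]
      by (rule finite_measure_mono) (use AB ism[OF A'(1)] ism[OF B'(1)] in auto)
    also have "\<dots> \<le> measure N (sym_diff A (ulim_set U M A')) + measure N (sym_diff B (ulim_set U M B'))"
      by (rule measure_Un_le) (use AB ism[OF A'(1)] ism[OF B'(1)] in auto)
    also have "\<dots> < e" using A'(2) B'(2) by simp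
    finally have "measure N (sym_diff (A \<union> B) (ulim_set U M (\<lambda>i. A' i \<union> B' i))) < e" .
    moreover have "(\<lambda>i. A' i \<union> B' i) \<in> internal" using A'(1) B'(1) by (simp add: internal_def)
    ultimately show "\<exists>C\<in>internal. measure N (sym_diff (A \<union> B) (ulim_set U M C)) < e" by blast
  qed
  have P_internal: "P (ulim_set U M A)" if "A \<in> internal" for A
    unfolding P_def using that ism by (auto intro!: bexI[of _ A])
  have emp: "(\<lambda>i. {}) \<in> internal" by (simp add: internal_def)
  have "P A" if "A \<in> sigma_sets (ulim_points U M) (ulim_set U M ` internal)" for A
    using that
  proof induction
    case (Basic a)
    then show ?case using P_internal by blast
  next
    case Empty
    then show ?case using P_internal[OF emp] by simp
  next
    case (Compl a)
    then have a: "a \<in> sets N" by (simp add: P_def)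
    show ?case
      unfolding P_def
    proof (intro conjI allI impI)
      show "ulim_points U M - a \<in> sets N" using a unfolding space_N[symmetric] by blast
      fix e :: real assume "e > 0"
      then obtain B where B: "B \<in> internal" "measure N (sym_diff a (ulim_set U M B)) < e"
        using P_D[OF Compl.IH] by metis
      have "sym_diff (ulim_points U M - a) (ulim_set U M (\<lambda>i. space (M i) - B i)) = sym_diff a (ulim_set U M B)"
        unfolding ulim_set_compl[symmetric]
        using sets.sets_into_space[OF a] ulim_set_subset[of B] unfolding space_N by blast
      moreover have "(\<lambda>i. space (M i) - B i) \<in> internal" using B(1) by (auto simp: internal_def)
      ultimately show "\<exists>B\<in>internal. measure N (sym_diff (ulim_points U M - a) (ulim_set U M B)) < e"
        using B(2) by (metis (no_types, lifting))
    qed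
  next
    case (Union a)
    define b where "b = (\<lambda>n. \<Union>k<n. a k)"
    have a: "a k \<in> sets N" for k using Union.IH by (simp add: P_def)
    have Pb: "P (b n)" for n
    proof (induction n)
      case 0
      then show ?case using P_internal[OF emp] by (simp add: b_def)
    next
      case (Suc n)
      then show ?case using P_Un[OF Suc Union.IH[of n]] by (simp add: b_def lessThan_Suc Un_commute)
    qed
    have bm: "b n \<in> sets N" for n using a by (auto simp: b_def)
    have Ua: "(\<Union>n. b n) = (\<Union>k. a k)" unfolding b_def by blast
    have Um: "(\<Union>k. a k) \<in> sets N" using a by blast
    have lim: "(\<lambda>n. measure N (b n)) \<longlonglongrightarrow> measure N (\<Union>k. a k)"
      unfolding Ua[symmetric]
    proof (rule finite_Lim_measure_incseq)
      show "incseq b" unfolding incseq_def b_def by (intro allI impI UN_mono) auto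
    qed (use bm in auto)
    show ?case
      unfolding P_def
    proof (intro conjI allI impI Um)
      fix e :: real assume e: "e > 0"
      have "eventually (\<lambda>n. measure N (b n) > measure N (\<Union>k. a k) - e / 2) sequentially"
        by (rule order_tendstoD(1)[OF lim]) (use e in auto)
      then obtain n where n: "measure N (b n) > measure N (\<Union>k. a k) - e / 2"
        by (auto simp: eventually_sequentially)
      have bsub: "b n \<subseteq> (\<Union>k. a k)" unfolding b_def by blast
      have small: "measure N ((\<Union>k. a k) - b n) < e / 2"
        using finite_measure_Diff[OF Um bm bsub] n by simp
      have "e / 2 > 0" using e by simp
      then obtain B where B: "B \<in> internal" "measure N (sym_diff (b n) (ulim_set U M B)) < e / 2"
        using P_D[OF Pb[of n]] by metis
      have "measure N (sym_diff (\<Union>k. a k) (ulim_set U M B))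
          \<le> measure N (((\<Union>k. a k) - b n) \<union> sym_diff (b n) (ulim_set U M B))"
        by (rule finite_measure_mono) (use bsub Um bm[of n] ism[OF B(1)] in auto)
      also have "\<dots> \<le> measure N ((\<Union>k. a k) - b n) + measure N (sym_diff (b n) (ulim_set U M B))"
        by (rule measure_Un_le) (use Um bm[of n] ism[OF B(1)] in auto)
      also have "\<dots> < e" using small B(2) by simp
      finally show "\<exists>B\<in>internal. measure N (sym_diff (\<Union>k. a k) (ulim_set U M B)) < e"
        using B(1) by blast
    qed
  qed
  then show ?thesis using assms unfolding sets_N P_def by blast
qed

lemma measure_sdiff_le:
  assumes "A \<in> sets N" "B \<in> sets N"
  shows "\<bar>measure N A - measure N B\<bar> \<le> measure N (sym_diff A B)"
proof -
  interpret prob_space N by simp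
  have *: "measure N A \<le> measure N B + measure N (sym_diff A B)"
    if "A \<in> sets N" "B \<in> sets N" for A B
  proof -
    have "measure N A \<le> measure N (B \<union> sym_diff A B)"
      by (rule finite_measure_mono) (use that in auto)
    also have "\<dots> \<le> measure N B + measure N (sym_diff A B)"
      by (rule measure_Un_le) (use that in auto)
    finally show ?thesis .
  qed
  show ?thesis using *[of A B] *[of B A] assms by (simp add: Un_commute abs_le_iff)
qed

text \<open>
  The norm does not increase in the limit. The inequality for an internal set is a limit of the
  inequalities for the sets of its family. To pass to a general set \<open>A\<close>, replace \<open>|g|\<close> by
  \<open>min |g| k\<close>, so that the error in the integral when \<open>A\<close> is replaced by an internal set is at most
  \<open>k\<close> times the measure of the symmetric difference; then let \<open>k\<close> tend to infinity.
\<close>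

lemma ulim_rho_bounded:
  assumes \<rho>: "\<rho> \<in> majorants" and f: "\<And>i. rho_bounded (M i) \<rho> K (f i)"
    and fg: "ulim_AE f g" and g [measurable]: "g \<in> borel_measurable N"
  shows "rho_bounded N \<rho> K g"
  unfolding rho_bounded_def
proof (intro conjI ballI)
  interpret prob_space N by simp
  note ui = unif_integrable_rho[OF \<rho> f]
  show gi: "integrable N g" by (rule ulim_integral(1)[OF ui fg g])
  have cont: "continuous_on {0..1} \<rho>" by (rule majorant_continuous[OF \<rho>])
  have int: "(LINT \<xi>:ulim_set U M A|N. norm (g \<xi>)) \<le> K * \<rho> (measure N (ulim_set U M A))"
    if A: "A \<in> internal" for A
  proof (rule tendsto_le[OF U_nonbot])
    have "((\<lambda>i. \<rho> (measure (M i) (A i))) \<longlongrightarrow> \<rho> (measure N (ulim_set U M A))) U"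
      by (rule continuous_on_tendsto_compose[OF cont measure_tendsto[OF A]])
        (simp_all add: prob_space.prob_le_1)
    then show "((\<lambda>i. K * \<rho> (measure (M i) (A i))) \<longlongrightarrow> K * \<rho> (measure N (ulim_set U M A))) U"
      by (rule tendsto_mult_left)
    show "((\<lambda>i. LINT x:A i|M i. norm (f i x)) \<longlongrightarrow> (LINT \<xi>:ulim_set U M A|N. norm (g \<xi>))) U"
      by (rule ulim_set_integral_norm[OF ui fg g A])
    show "eventually (\<lambda>i. (LINT x:A i|M i. norm (f i x)) \<le> K * \<rho> (measure (M i) (A i))) U"
      using f A by (simp add: rho_bounded_def internal_def)
  qed
  fix A assume A [measurable]: "A \<in> sets N"
  define u where "u = (\<lambda>(k::nat) \<xi>. indicator A \<xi> * min (norm (g \<xi>)) (real k))"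
  have um [measurable]: "u k \<in> borel_measurable N" for k unfolding u_def by measurable
  have u: "integrable N (u k)" "\<And>\<xi>. 0 \<le> u k \<xi>" for k
    by (rule integrable_bounded[where T = "real k"]) (auto simp: u_def indicator_def)
  have "\<exists>B. B \<in> internal \<and> measure N (sym_diff A (ulim_set U M B)) < 1 / real (Suc n)" for n
    using internal_approx[OF A, of "1 / real (Suc n)"] by auto
  then obtain B where B: "\<And>n. B n \<in> internal"
    "\<And>n. measure N (sym_diff A (ulim_set U M (B n))) < 1 / real (Suc n)" by metis
  have Bm [measurable]: "ulim_set U M (B n) \<in> sets N" for n by (rule internal_sets[OF B(1)])
  have inv: "(\<lambda>n. 1 / real (Suc n)) \<longlonglongrightarrow> 0" using LIMSEQ_inverse_real_of_nat by (simp add: inverse_eq_divide)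
  have "(\<lambda>n. measure N (ulim_set U M (B n)) - measure N A) \<longlonglongrightarrow> 0"
  proof (rule Lim_null_comparison[OF _ inv], rule always_eventually, rule allI)
    fix n
    show "norm (measure N (ulim_set U M (B n)) - measure N A) \<le> 1 / real (Suc n)"
      using measure_sdiff_le[OF A Bm, of n] B(2)[of n] by (simp add: abs_minus_commute)
  qed
  then have Blim: "(\<lambda>n. measure N (ulim_set U M (B n))) \<longlonglongrightarrow> measure N A" by (rule LIM_zero_cancel)
  have uK: "integral\<^sup>L N (u k) \<le> K * \<rho> (measure N A)" for k
  proof (rule LIMSEQ_le_const)
    have "(\<lambda>n. \<rho> (measure N (ulim_set U M (B n)))) \<longlonglongrightarrow> \<rho> (measure N A)"
      by (rule continuous_on_tendsto_compose[OF cont Blim]) simp_all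
    then have "(\<lambda>n. K * \<rho> (measure N (ulim_set U M (B n))) + real k * (1 / real (Suc n)))
      \<longlonglongrightarrow> K * \<rho> (measure N A) + real k * 0"
      by (intro tendsto_intros inv)
    then show "(\<lambda>n. K * \<rho> (measure N (ulim_set U M (B n))) + real k * (1 / real (Suc n)))
      \<longlonglongrightarrow> K * \<rho> (measure N A)" by simp
    have "integral\<^sup>L N (u k) \<le> K * \<rho> (measure N (ulim_set U M (B n))) + real k * (1 / real (Suc n))" for n
    proof -
      let ?B = "ulim_set U M (B n)"
      have sd: "sym_diff A ?B \<in> sets N" by measurable
      have i1: "integrable N (\<lambda>\<xi>. indicator ?B \<xi> *\<^sub>R norm (g \<xi>))"
        by (intro integrable_mult_indicator integrable_norm gi Bm)
      have i2: "integrable N (\<lambda>\<xi>. real k * indicator (sym_diff A ?B) \<xi>)"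
        by (intro integrable_mult_right integrable_real_indicator sd) (simp add: emeasure_eq_measure)
      have "integral\<^sup>L N (u k) \<le> (\<integral>\<xi>. indicator ?B \<xi> *\<^sub>R norm (g \<xi>) + real k * indicator (sym_diff A ?B) \<xi> \<partial>N)"
        by (rule integral_mono[OF u(1) Bochner_Integration.integrable_add[OF i1 i2]])
          (auto simp: u_def indicator_def)
      also have "\<dots> = (LINT \<xi>:?B|N. norm (g \<xi>)) + real k * measure N (sym_diff A ?B)"
        using i1 i2 sd by (simp add: set_lebesgue_integral_def emeasure_eq_measure)
      also have "\<dots> \<le> K * \<rho> (measure N ?B) + real k * (1 / real (Suc n))"
        using int[OF B(1)] B(2)[of n] by (intro add_mono mult_left_mono) auto
      finally show ?thesis .
    qed
    then show "\<exists>n0. \<forall>n\<ge>n0. integral\<^sup>L N (u k) \<le>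
      K * \<rho> (measure N (ulim_set U M (B n))) + real k * (1 / real (Suc n))" by blast
  qed
  have "AE \<xi> in N. (\<lambda>k. u k \<xi>) \<longlonglongrightarrow> indicator A \<xi> *\<^sub>R norm (g \<xi>)"
    unfolding u_def real_scaleR_def
    by (rule AE_I2, rule tendsto_mult_left, rule min_real_of_nat_tendsto)
  then show "(LINT \<xi>:A|N. norm (g \<xi>)) \<le> K * \<rho> (measure N A)"
    unfolding set_lebesgue_integral_def by (rule Fatou_integral_le(2)[OF u _ _ uK]) measurable
qed

end

lemma L1_triangle:
  fixes u v w :: "'c \<Rightarrow> complex"
  assumes "integrable Q u" "integrable Q v" "integrable Q w"
  shows "(\<integral>x. norm (u x - w x) \<partial>Q) \<le> (\<integral>x. norm (u x - v x) \<partial>Q) + (\<integral>x. norm (w x - v x) \<partial>Q)"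
proof -
  have "(\<integral>x. norm (u x - w x) \<partial>Q) \<le> (\<integral>x. norm (u x - v x) + norm (w x - v x) \<partial>Q)"
  proof (rule integral_mono)
    show "norm (u x - w x) \<le> norm (u x - v x) + norm (w x - v x)" for x
      using norm_triangle_ineq4[of "u x - v x" "w x - v x"] by simp
  qed (use assms in auto)
  then show ?thesis using assms by simp
qed

section \<open>Lifting functions from the ultraproduct\<close>

lemma integrable_L1_complete:
  fixes s :: "nat \<Rightarrow> 'c \<Rightarrow> complex"
  assumes s: "\<And>n. integrable Q (s n)"
    and C: "\<And>e. e > 0 \<Longrightarrow> \<exists>n0. \<forall>i\<ge>n0. \<forall>j\<ge>n0. (\<integral>x. norm (s i x - s j x) \<partial>Q) < e"
  obtains r f where "strict_mono r" "f \<in> borel_measurable Q" "AE x in Q. (\<lambda>n. s (r n) x) \<longlonglongrightarrow> f x"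
proof -
  obtain r where r: "strict_mono r" "AE x in Q. Cauchy (\<lambda>i. s (r i) x)"
    using cauchy_L1_AE_cauchy_subseq[OF s C] by blast
  have [measurable]: "s n \<in> borel_measurable Q" for n using s by auto
  have "(\<lambda>x. lim (\<lambda>i. s (r i) x)) \<in> borel_measurable Q" by measurable
  moreover have "AE x in Q. (\<lambda>n. s (r n) x) \<longlonglongrightarrow> lim (\<lambda>i. s (r i) x)"
    using r(2) by eventually_elim (simp add: Cauchy_convergent_iff convergent_LIMSEQ_iff)
  ultimately show ?thesis using that r(1) by blast
qed

text \<open>
  A truncation level \<open>B\<close> for \<open>g\<close> that truncates little (it is at least \<open>T\<close> or bounds \<open>|g|\<close>), and
  for which functions bounded by \<open>B\<close> satisfy the inequality defining \<open>\<parallel>f\<parallel> \<le> c + e\<close> on all sets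
  of small measure.

  If \<open>|g| > B\<close> on a set of measure \<open>a > 0\<close>, the bound for \<open>g\<close> on this set gives \<open>B a \<le> c \<rho>(a)\<close>, hence
  \<open>B t \<le> c \<rho>(t)\<close> for \<open>t \<le> a\<close> by concavity, and \<open>(B + e) t \<le> (c + e) \<rho>(t)\<close> since \<open>t \<le> \<rho>(t)\<close>. So
  an admissible level that does not yet bound \<open>|g|\<close> can be raised by \<open>e\<close>; the level \<open>e\<close> is
  admissible because \<open>t \<le> \<rho>(t)\<close>.
\<close>

lemma majorant_level:
  assumes Q: "prob_space Q" and \<rho>: "\<rho> \<in> majorants" and g: "rho_bounded Q \<rho> c g" and e: "e > 0"
  shows "\<exists>B>0. (T \<le> B \<or> (AE x in Q. norm (g x) \<le> B)) \<and>
    (\<exists>a>0. \<forall>t. 0 \<le> t \<and> t \<le> a \<and> t \<le> 1 \<longrightarrow> B * t \<le> (c + e) * \<rho> t)"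
proof -
  interpret prob_space Q by fact
  have gi: "integrable Q g" using g by (rule rho_bounded_integrable)
  then have [measurable]: "g \<in> borel_measurable Q" by auto
  have c: "0 \<le> c" by (rule rho_bounded_integral(2)[OF Q \<rho> g])
  define P where "P = (\<lambda>r B. B > 0 \<and> (r \<le> B \<or> (AE x in Q. norm (g x) \<le> B)) \<and>
    (\<exists>a>0. \<forall>t. 0 \<le> t \<and> t \<le> a \<and> t \<le> 1 \<longrightarrow> B * t \<le> (c + e) * \<rho> t))"
  have "\<exists>B. P (real k * e) B" for k
  proof (induction k)
    case 0
    have "e * t \<le> (c + e) * \<rho> t" if "0 \<le> t" "t \<le> 1" for t
      by (rule mult_mono) (use c e that majorant_ge[OF \<rho>, of t] in auto)
    then have "P (real 0 * e) e" unfolding P_def using e by (auto intro!: exI[of _ 1])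
    then show ?case by blast
  next
    case (Suc k)
    then obtain B where B: "P (real k * e) B" by blast
    show ?case
    proof (cases "AE x in Q. norm (g x) \<le> B")
      case True
      then show ?thesis using B unfolding P_def by blast
    next
      case False
      define A where "A = {x\<in>space Q. norm (g x) > B}"
      define a where "a = measure Q A"
      have B0: "B > 0" and kB: "real k * e \<le> B" using B False unfolding P_def by auto
      have Am [measurable]: "A \<in> sets Q" unfolding A_def by measurable
      have "a \<noteq> 0"
      proof
        assume "a = 0"
        then have "A \<in> null_sets Q" using Am by (simp add: a_def null_sets_def emeasure_eq_measure)
        then have "AE x in Q. x \<notin> A" by (rule AE_not_in)
        then have "AE x in Q. norm (g x) \<le> B"
          using AE_space by eventually_elim (simp add: A_def not_less)
        with False show False by blast
      qed
      then have a: "0 < a" "a \<le> 1" by (auto simp: a_def zero_less_measure_iff)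
      have "B * a = (\<integral>x. indicator A x *\<^sub>R B \<partial>Q)" using Am by (simp add: a_def emeasure_eq_measure)
      also have "\<dots> \<le> (\<integral>x. indicator A x *\<^sub>R norm (g x) \<partial>Q)"
      proof (rule integral_mono)
        show "integrable Q (\<lambda>x. indicator A x *\<^sub>R B)"
          by (intro integrable_mult_indicator Am) simp
        show "integrable Q (\<lambda>x. indicator A x *\<^sub>R norm (g x))"
          by (intro integrable_mult_indicator Am integrable_norm gi)
      qed (auto simp: indicator_def A_def)
      also have "\<dots> \<le> c * \<rho> a"
        using g Am unfolding rho_bounded_def a_def set_lebesgue_integral_def by blast
      finally have Ba: "B * a \<le> c * \<rho> a" .
      have "(B + e) * t \<le> (c + e) * \<rho> t" if t: "0 \<le> t" "t \<le> a" for t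
      proof -
        have "B * t * a \<le> c * \<rho> a * t" using mult_right_mono[OF Ba t(1)] by (simp add: mult.commute mult.left_commute)
        also have "\<dots> \<le> c * \<rho> t * a"
          using mult_left_mono[OF majorant_ratio[OF \<rho> t a(2)] c] by (simp add: mult.assoc)
        finally have "B * t \<le> c * \<rho> t" using a(1) by simp
        moreover have "e * t \<le> e * \<rho> t" using majorant_ge[OF \<rho>, of t] t a e by simp
        ultimately show ?thesis by (simp add: algebra_simps)
      qed
      then have "P (real (Suc k) * e) (B + e)"
        unfolding P_def using B0 e kB a(1) by (auto simp: algebra_simps)
      then show ?thesis by blast
    qed
  qed
  moreover obtain k :: nat where "T / e < real k" using reals_Archimedean2 by blast
  then have T: "T \<le> real k * e" using e by (simp add: field_simps)
  ultimately obtain B where "P (real k * e) B" by blast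
  then have B: "B > 0" "real k * e \<le> B \<or> (AE x in Q. norm (g x) \<le> B)"
    "\<exists>a>0. \<forall>t. 0 \<le> t \<and> t \<le> a \<and> t \<le> 1 \<longrightarrow> B * t \<le> (c + e) * \<rho> t"
    by (simp_all add: P_def)
  from B(2) T have "T \<le> B \<or> (AE x in Q. norm (g x) \<le> B)" by fastforce
  with B(1,3) show ?thesis by blast
qed

context prob_ultraproduct
begin

text \<open>
  A family of measurable functions bounded by \<open>B\<close>, together with a measurable ultralimit \<open>gh\<close>. The
  bound is required outside \<open>space (M i)\<close> as well, which saves a side condition below.
\<close>

definition bounded_ulim :: "real \<Rightarrow> ('i \<Rightarrow> 'a \<Rightarrow> complex) \<Rightarrow> (('i \<Rightarrow> 'a) set \<Rightarrow> complex) \<Rightarrow> bool" where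
  "bounded_ulim B h gh \<longleftrightarrow> B > 0 \<and> (\<forall>i. h i \<in> borel_measurable (M i) \<and> (\<forall>x. norm (h i x) \<le> B)) \<and>
    gh \<in> borel_measurable N \<and> ulim_AE h gh"

lemma bounded_unif_integrable:
  assumes "bounded_ulim B h gh" shows "unif_integrable h"
  unfolding unif_integrable_def
proof (intro conjI allI impI)
  have B: "B > 0" and hm: "h i \<in> borel_measurable (M i)" and le: "norm (h i x) \<le> B" for i x
    using assms by (auto simp: bounded_ulim_def)
  show "integrable (M i) (h i)" for i by (rule integrable_bounded[where T = B]) (use hm le in auto)
  fix e :: real assume "e > 0"
  then show "\<exists>B>0. eventually (\<lambda>i. (\<integral>x. norm (h i x - trunc B (h i x)) \<partial>M i) \<le> e) U"
    using B by (intro exI[of _ B]) (simp add: trunc_eq le)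
qed

lemma bounded_ulim_integrable:
  assumes "bounded_ulim B h gh"
  shows "integrable (M i) (h i)" "integrable N gh"
  using bounded_unif_integrable[OF assms] ulim_integral(1)[OF bounded_unif_integrable[OF assms]] assms
  by (auto simp: bounded_ulim_def unif_integrable_def)

text \<open>
  Ultralimits of bounded families are dense in \<open>L\<^sup>1\<close> of the ultraproduct.
\<close>

lemma bounded_ulim_dense:
  assumes "integrable N g" "e > 0"
  shows "\<exists>B h gh. bounded_ulim B h gh \<and> (\<integral>\<xi>. norm (g \<xi> - gh \<xi>) \<partial>N) < e"
  using assms
proof (induction arbitrary: e rule: integrable_induct)
  case (base A c)
  interpret prob_space N by simp
  define d where "d = norm c + 1"
  have d: "d > 0" "norm c \<le> d" by (auto simp: d_def add_nonneg_pos)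
  obtain B where B: "B \<in> internal" "measure N (sym_diff A (ulim_set U M B)) < e / d"
    using internal_approx[OF base(1), of "e / d"] base(3) d(1) by auto
  note [measurable] = internal_sets[OF B(1)] base(1)
  have Bm [measurable]: "B i \<in> sets (M i)" for i using B(1) by (simp add: internal_def)
  let ?h = "\<lambda>i x. indicator (B i) x * c" and ?g = "\<lambda>\<xi>. indicator (ulim_set U M B) \<xi> * c"
  have "bounded_ulim d ?h ?g"
    unfolding bounded_ulim_def
    by (intro conjI allI d ulim_AE_mult ulim_AE_indicator ulim_AE_const; (measurable)?)
      (use d in \<open>auto simp: norm_mult indicator_def\<close>)
  moreover have "(\<integral>\<xi>. norm (indicator A \<xi> *\<^sub>R c - ?g \<xi>) \<partial>N) < e"
  proof -
    have "(\<integral>\<xi>. norm (indicator A \<xi> *\<^sub>R c - ?g \<xi>) \<partial>N)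
        = (\<integral>\<xi>. indicator (sym_diff A (ulim_set U M B)) \<xi> * norm c \<partial>N)"
      by (rule Bochner_Integration.integral_cong) (auto simp: indicator_def)
    also have "\<dots> = measure N (sym_diff A (ulim_set U M B)) * norm c"
      by (simp add: emeasure_eq_measure)
    also have "\<dots> \<le> measure N (sym_diff A (ulim_set U M B)) * d"
      by (rule mult_left_mono[OF d(2)]) simp
    also have "\<dots> < e" using B(2) d(1) by (simp add: pos_less_divide_eq)
    finally show ?thesis .
  qed
  ultimately show ?case by blast
next
  case (add f f')
  have e: "e / 2 > 0" using add.prems by simp
  obtain B h gh where 1: "bounded_ulim B h gh" "(\<integral>\<xi>. norm (f \<xi> - gh \<xi>) \<partial>N) < e / 2"
    using add.IH(1)[OF e] by blast
  obtain B' h' gh' where 2: "bounded_ulim B' h' gh'" "(\<integral>\<xi>. norm (f' \<xi> - gh' \<xi>) \<partial>N) < e / 2"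
    using add.IH(2)[OF e] by blast
  note [simp] = add.hyps bounded_ulim_integrable(2)[OF 1(1)] bounded_ulim_integrable(2)[OF 2(1)]
  have "bounded_ulim (B + B') (\<lambda>i x. h i x + h' i x) (\<lambda>\<xi>. gh \<xi> + gh' \<xi>)"
    using 1(1) 2(1) unfolding bounded_ulim_def
    by (auto intro!: ulim_AE_add norm_triangle_mono borel_measurable_add)
  moreover have "(\<integral>\<xi>. norm ((f \<xi> + f' \<xi>) - (gh \<xi> + gh' \<xi>)) \<partial>N)
      \<le> (\<integral>\<xi>. norm (f \<xi> - gh \<xi>) + norm (f' \<xi> - gh' \<xi>) \<partial>N)"
    by (rule integral_mono) (auto simp: add_diff_add intro!: norm_triangle_ineq)
  then have "(\<integral>\<xi>. norm ((f \<xi> + f' \<xi>) - (gh \<xi> + gh' \<xi>)) \<partial>N) < e"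
    using 1(2) 2(2) by simp
  ultimately show ?case by blast
next
  case (lim f s)
  have e: "e / 2 > 0" using lim.prems by simp
  have [measurable]: "f \<in> borel_measurable N" "s n \<in> borel_measurable N" for n
    using lim.hyps by auto
  have "(\<lambda>n. \<integral>\<xi>. norm (f \<xi> - s n \<xi>) \<partial>N) \<longlonglongrightarrow> (\<integral>\<xi>. 0 \<partial>N)"
  proof (rule integral_dominated_convergence[where w = "\<lambda>\<xi>. 3 * norm (f \<xi>)"])
    show "integrable N (\<lambda>\<xi>. 3 * norm (f \<xi>))" using lim.hyps by simp
    show "AE \<xi> in N. (\<lambda>n. norm (f \<xi> - s n \<xi>)) \<longlonglongrightarrow> 0"
    proof (rule AE_I2)
      fix \<xi> assume "\<xi> \<in> space N"
      then have "(\<lambda>n. norm (f \<xi> - s n \<xi>)) \<longlonglongrightarrow> norm (f \<xi> - f \<xi>)"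
        by (intro tendsto_intros lim.hyps)
      then show "(\<lambda>n. norm (f \<xi> - s n \<xi>)) \<longlonglongrightarrow> 0" by simp
    qed
    show "AE \<xi> in N. norm (norm (f \<xi> - s n \<xi>)) \<le> 3 * norm (f \<xi>)" for n
    proof (rule AE_I2)
      fix \<xi> assume "\<xi> \<in> space N"
      then have "norm (s n \<xi>) \<le> 2 * norm (f \<xi>)" by (rule lim.hyps)
      then show "norm (norm (f \<xi> - s n \<xi>)) \<le> 3 * norm (f \<xi>)"
        using norm_triangle_ineq4[of "f \<xi>" "s n \<xi>"] by simp
    qed
  qed measurable
  from order_tendstoD(2)[OF this, of "e / 2"]
  have "eventually (\<lambda>n. (\<integral>\<xi>. norm (f \<xi> - s n \<xi>) \<partial>N) < e / 2) sequentially"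
    using e by simp
  then obtain n where n: "(\<integral>\<xi>. norm (f \<xi> - s n \<xi>) \<partial>N) < e / 2"
    by (auto simp: eventually_sequentially)
  obtain B h gh where 1: "bounded_ulim B h gh" "(\<integral>\<xi>. norm (s n \<xi> - gh \<xi>) \<partial>N) < e / 2"
    using lim.IH[OF e] by blast
  note [simp] = lim.hyps(1,4) bounded_ulim_integrable(2)[OF 1(1)]
  have "(\<integral>\<xi>. norm (f \<xi> - gh \<xi>) \<partial>N) \<le> (\<integral>\<xi>. norm (f \<xi> - s n \<xi>) \<partial>N) + (\<integral>\<xi>. norm (gh \<xi> - s n \<xi>) \<partial>N)"
    by (rule L1_triangle) simp_all
  also have "\<dots> < e" using n 1(2) by (simp add: norm_minus_commute)
  finally show ?case using 1(1) by blast
qed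

text \<open>
  Transfer of a norm bound from the ultraproduct to almost all factors, with a loss \<open>d - c\<close> that also
  absorbs the error \<open>\<eta>\<close>. If the bound \<open>d\<close> failed for almost all \<open>i\<close>, choose witnesses \<open>A i\<close>; the bound
  \<open>B t \<le> d \<rho>(t)\<close> for small \<open>t\<close> forces their measures above \<open>a\<close>, so that the internal set which they form contradicts the
  bound for \<open>gh\<close>.
\<close>

lemma eventually_rho_bounded:
  assumes \<rho>: "\<rho> \<in> majorants" and h: "bounded_ulim B h gh"
    and a: "a > 0" "a \<le> 1" "\<And>t. 0 \<le> t \<Longrightarrow> t \<le> a \<Longrightarrow> B * t \<le> d * \<rho> t"
    and cd: "c < d" and gh: "\<And>A. A \<in> sets N \<Longrightarrow> (LINT \<xi>:A|N. norm (gh \<xi>)) \<le> c * \<rho> (measure N A) + \<eta>"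
    and \<eta>: "\<eta> < (d - c) * a"
  shows "eventually (\<lambda>i. rho_bounded (M i) \<rho> d (h i)) U"
proof (rule ccontr)
  assume "\<not> ?thesis"
  then have ev: "eventually (\<lambda>i. \<not> rho_bounded (M i) \<rho> d (h i)) U" by (simp add: not_eventually_iff)
  have B: "B > 0" and hm [measurable]: "\<And>i. h i \<in> borel_measurable (M i)" and le: "\<And>i x. norm (h i x) \<le> B"
    and ghm: "gh \<in> borel_measurable N" and lim: "ulim_AE h gh"
    using h by (auto simp: bounded_ulim_def)
  note hi = bounded_ulim_integrable(1)[OF h]
  define A where "A = (\<lambda>i. if rho_bounded (M i) \<rho> d (h i) then {} else
    SOME A. A \<in> sets (M i) \<and> (LINT x:A|M i. norm (h i x)) > d * \<rho> (measure (M i) A))"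
  have A: "A i \<in> sets (M i)" "(LINT x:A i|M i. norm (h i x)) > d * \<rho> (measure (M i) (A i))"
    if "\<not> rho_bounded (M i) \<rho> d (h i)" for i
  proof -
    have "\<exists>A. A \<in> sets (M i) \<and> (LINT x:A|M i. norm (h i x)) > d * \<rho> (measure (M i) A)"
      using that hi[of i] by (auto simp: rho_bounded_def not_le)
    from someI_ex[OF this] that
    show "A i \<in> sets (M i)" "(LINT x:A i|M i. norm (h i x)) > d * \<rho> (measure (M i) (A i))"
      by (simp_all add: A_def)
  qed
  have Ai: "A \<in> internal"
  proof (rule internalI)
    show "A i \<in> sets (M i)" for i
      using A(1)[of i] by (cases "rho_bounded (M i) \<rho> d (h i)") (simp_all add: A_def)
  qed
  let ?A = "ulim_set U M A"
  have large: "measure (M i) (A i) \<ge> a" if bad: "\<not> rho_bounded (M i) \<rho> d (h i)" for i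
  proof (rule ccontr)
    assume "\<not> a \<le> measure (M i) (A i)"
    then have small: "measure (M i) (A i) \<le> a" by simp
    interpret prob_space "M i" by simp
    note [measurable] = A(1)[OF bad]
    have "(LINT x:A i|M i. norm (h i x)) \<le> (\<integral>x. indicator (A i) x *\<^sub>R B \<partial>M i)"
      unfolding set_lebesgue_integral_def
    proof (rule integral_mono)
      show "integrable (M i) (\<lambda>x. indicator (A i) x *\<^sub>R norm (h i x))"
        by (intro integrable_mult_indicator integrable_norm hi A(1) bad)
      show "integrable (M i) (\<lambda>x. indicator (A i) x *\<^sub>R B)"
        by (intro integrable_mult_indicator A(1) bad) simp
    qed (simp add: mult_left_mono le)
    also have "\<dots> = B * measure (M i) (A i)" using A(1)[OF bad] by (simp add: emeasure_eq_measure)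
    also have "\<dots> \<le> d * \<rho> (measure (M i) (A i))" by (rule a(3)[OF _ small]) simp
    finally show False using A(2)[OF bad] by simp
  qed
  have "measure N ?A \<ge> a"
    by (rule tendsto_lowerbound[OF measure_tendsto[OF Ai]]) (use ev large in \<open>auto elim: eventually_mono\<close>)
  moreover have le1: "measure N ?A \<le> 1" by (rule prob_space.prob_le_1) simp
  ultimately have "a \<le> \<rho> (measure N ?A)" using majorant_ge[OF \<rho>, of "measure N ?A"] by simp
  moreover have "d * \<rho> (measure N ?A) \<le> (LINT \<xi>:?A|N. norm (gh \<xi>))"
  proof (rule tendsto_le[OF U_nonbot])
    show "((\<lambda>i. LINT x:A i|M i. norm (h i x)) \<longlongrightarrow> (LINT \<xi>:?A|N. norm (gh \<xi>))) U"
      by (rule ulim_set_integral_norm[OF bounded_unif_integrable[OF h] lim ghm Ai])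
    have "((\<lambda>i. \<rho> (measure (M i) (A i))) \<longlongrightarrow> \<rho> (measure N ?A)) U"
      by (rule continuous_on_tendsto_compose[OF majorant_continuous[OF \<rho>] measure_tendsto[OF Ai]])
        (simp_all add: prob_space.prob_le_1)
    then show "((\<lambda>i. d * \<rho> (measure (M i) (A i))) \<longlongrightarrow> d * \<rho> (measure N ?A)) U"
      by (rule tendsto_mult_left)
    show "eventually (\<lambda>i. d * \<rho> (measure (M i) (A i)) \<le> (LINT x:A i|M i. norm (h i x))) U"
      using ev by eventually_elim (use A(2) less_imp_le in blast)
  qed
  then have "d * \<rho> (measure N ?A) \<le> c * \<rho> (measure N ?A) + \<eta>"
    using gh[OF internal_sets[OF Ai]] by simp
  then have "(d - c) * \<rho> (measure N ?A) < (d - c) * a" using \<eta> by (simp add: left_diff_distrib)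
  ultimately show False using cd by simp
qed

text \<open>
  In \<open>L\<^sup>1\<close>, every \<open>g\<close> with \<open>\<parallel>g\<parallel> \<le> c\<close> is approximated by ultralimits of bounded families whose
  members have norm at most \<open>c + e\<close> for almost all \<open>i\<close>. Any approximation in \<open>L\<^sup>1\<close> of the truncation
  of \<open>g\<close> at a suitable level, truncated at the same level, will do if it is close enough.
\<close>

lemma rho_bounded_approx:
  assumes \<rho>: "\<rho> \<in> majorants" and g: "rho_bounded N \<rho> c g" and e: "e > 0" and \<delta>: "\<delta> > 0"
  shows "\<exists>B h gh. bounded_ulim B h gh \<and> (\<integral>\<xi>. norm (g \<xi> - gh \<xi>) \<partial>N) < \<delta> \<and>
    eventually (\<lambda>i. rho_bounded (M i) \<rho> (c + e) (h i)) U"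
proof -
  interpret prob_space N by simp
  have gi: "integrable N g" using g by (rule rho_bounded_integrable)
  then have gm [measurable]: "g \<in> borel_measurable N" by auto
  have c: "0 \<le> c" by (rule rho_bounded_integral(2)[OF _ \<rho> g]) simp
  have tail: "eventually (\<lambda>n. (\<integral>\<xi>. norm (g \<xi> - trunc (real (Suc n)) (g \<xi>)) \<partial>N) < \<delta> / 2) sequentially"
  proof -
    have "(\<lambda>n. \<integral>\<xi>. norm (g \<xi> - trunc (real (Suc n)) (g \<xi>)) \<partial>N) \<longlonglongrightarrow> (\<integral>\<xi>. 0 \<partial>N)"
    proof (rule integral_dominated_convergence[where w = "\<lambda>\<xi>. norm (g \<xi>)"])
      show "integrable N (\<lambda>\<xi>. norm (g \<xi>))" using gi by simp
      show "AE \<xi> in N. (\<lambda>n. norm (g \<xi> - trunc (real (Suc n)) (g \<xi>))) \<longlonglongrightarrow> 0"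
      proof (rule AE_I2)
        fix \<xi>
        obtain k0 :: nat where k0: "norm (g \<xi>) \<le> real k0" using real_arch_simple by blast
        have "norm (g \<xi> - trunc (real (Suc n)) (g \<xi>)) = 0" if "k0 \<le> n" for n
        proof -
          have "norm (g \<xi>) \<le> real (Suc n)" using that k0 by simp
          then show ?thesis by (simp add: trunc_eq)
        qed
        then show "(\<lambda>n. norm (g \<xi> - trunc (real (Suc n)) (g \<xi>))) \<longlonglongrightarrow> 0"
          by (intro tendsto_eventually eventually_sequentiallyI)
      qed
      show "AE \<xi> in N. norm (norm (g \<xi> - trunc (real (Suc n)) (g \<xi>))) \<le> norm (g \<xi>)" for n
        unfolding real_norm_def abs_norm_cancel norm_diff_trunc[OF of_nat_0_less_iff[THEN iffD2, OF zero_less_Suc]]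
        by (rule AE_I2) simp
      have tm: "(\<lambda>\<xi>. trunc B (g \<xi>)) \<in> borel_measurable N" for B
        by (rule measurable_compose[OF gm trunc_measurable])
      show "(\<lambda>\<xi>. norm (g \<xi> - trunc (real (Suc n)) (g \<xi>))) \<in> borel_measurable N" for n
        by (intro measurable_compose[OF _ borel_measurable_norm] borel_measurable_diff gm tm)
    qed simp
    then have "(\<lambda>n. \<integral>\<xi>. norm (g \<xi> - trunc (real (Suc n)) (g \<xi>)) \<partial>N) \<longlonglongrightarrow> 0" by (simp only: integral_zero)
    then show ?thesis by (rule order_tendstoD(2)) (use \<delta> in simp)
  qed
  from eventually_happens'[OF sequentially_bot this]
  obtain n where n: "(\<integral>\<xi>. norm (g \<xi> - trunc (real (Suc n)) (g \<xi>)) \<partial>N) < \<delta> / 2"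
    by blast
  obtain B a0 where B: "B > 0" "real (Suc n) \<le> B \<or> (AE \<xi> in N. norm (g \<xi>) \<le> B)"
    and a0: "a0 > 0" "\<And>t. 0 \<le> t \<Longrightarrow> t \<le> a0 \<Longrightarrow> t \<le> 1 \<Longrightarrow> B * t \<le> (c + e) * \<rho> t"
    using majorant_level[OF _ \<rho> g e, of "real (Suc n)"] by auto
  have tB: "(\<integral>\<xi>. norm (g \<xi> - trunc B (g \<xi>)) \<partial>N) < \<delta> / 2"
  proof -
    have "(\<integral>\<xi>. norm (g \<xi> - trunc B (g \<xi>)) \<partial>N) \<le> (\<integral>\<xi>. norm (g \<xi> - trunc (real (Suc n)) (g \<xi>)) \<partial>N)"
    proof (rule integral_mono_AE)
      show "AE \<xi> in N. norm (g \<xi> - trunc B (g \<xi>)) \<le> norm (g \<xi> - trunc (real (Suc n)) (g \<xi>))"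
        using B(2)
      proof
        assume "real (Suc n) \<le> B"
        then show ?thesis by (intro AE_I2) (simp add: norm_diff_trunc B(1))
      next
        assume "AE \<xi> in N. norm (g \<xi>) \<le> B"
        then show ?thesis by eventually_elim (simp add: norm_diff_trunc B(1))
      qed
      show "integrable N (\<lambda>\<xi>. norm (g \<xi> - trunc B (g \<xi>)))"
        "integrable N (\<lambda>\<xi>. norm (g \<xi> - trunc (real (Suc n)) (g \<xi>)))"
        by (intro integrable_norm Bochner_Integration.integrable_diff integrable_trunc gi B(1); simp)+
    qed
    with n show ?thesis by simp
  qed
  define a where "a = min a0 1"
  have a: "a > 0" "a \<le> 1" "\<And>t. 0 \<le> t \<Longrightarrow> t \<le> a \<Longrightarrow> B * t \<le> (c + e) * \<rho> t"
    using a0 by (auto simp: a_def)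
  \<comment> \<open>Truncation at \<open>B\<close> at most doubles the error \<open>\<eta>\<close>; \<open>2 \<eta>\<close> must be at most \<open>\<delta> / 2\<close> and less than \<open>e a\<close>.\<close>
  define \<eta> where "\<eta> = min (\<delta> / 4) (e * a / 4)"
  have \<eta>: "\<eta> > 0" using \<delta> e a by (simp add: \<eta>_def)
  have gBi: "integrable N (\<lambda>\<xi>. trunc B (g \<xi>))" by (rule integrable_trunc[OF gi B(1)])
  obtain B' h' gh' where h': "bounded_ulim B' h' gh'"
    "(\<integral>\<xi>. norm (trunc B (g \<xi>) - gh' \<xi>) \<partial>N) < \<eta>"
    using bounded_ulim_dense[OF gBi \<eta>] by blast
  have gh'i: "integrable N gh'" by (rule bounded_ulim_integrable(2)[OF h'(1)])
  define h where "h = (\<lambda>i x. trunc B (h' i x))"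
  define gh where "gh = (\<lambda>\<xi>. trunc B (gh' \<xi>))"
  have hb: "bounded_ulim B h gh"
    unfolding bounded_ulim_def
  proof (intro conjI allI B(1))
    fix i x
    have "h' i \<in> borel_measurable (M i)" using h'(1) by (simp add: bounded_ulim_def)
    from measurable_compose[OF this trunc_measurable]
    show "h i \<in> borel_measurable (M i)" by (simp add: h_def)
    show "norm (h i x) \<le> B" by (simp add: h_def norm_trunc[OF B(1)])
  next
    have "gh' \<in> borel_measurable N" "ulim_AE h' gh'" using h'(1) by (simp_all add: bounded_ulim_def)
    from measurable_compose[OF this(1) trunc_measurable] ulim_AE_continuous[OF this(2) continuous_trunc[OF B(1)]]
    show "gh \<in> borel_measurable N" "ulim_AE h gh" by (simp_all add: h_def gh_def)
  qed
  have ghi: "integrable N gh" by (rule bounded_ulim_integrable(2)[OF hb])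
  have close: "(\<integral>\<xi>. norm (trunc B (g \<xi>) - gh \<xi>) \<partial>N) \<le> 2 * \<eta>"
  proof -
    have "(\<integral>\<xi>. norm (trunc B (g \<xi>) - gh \<xi>) \<partial>N) \<le> (\<integral>\<xi>. 2 * norm (trunc B (g \<xi>) - gh' \<xi>) \<partial>N)"
    proof (rule integral_mono)
      fix \<xi>
      let ?u = "trunc B (g \<xi>)" and ?v = "gh' \<xi>"
      have "norm ?u \<le> B" using norm_trunc[OF B(1), of "g \<xi>"] by simp
      then have "norm (?v - trunc B ?v) \<le> norm (?u - ?v)"
        using norm_triangle_ineq2[of ?v ?u] by (simp add: norm_diff_trunc[OF B(1)] norm_minus_commute)
      then show "norm (?u - gh \<xi>) \<le> 2 * norm (?u - ?v)"
        using norm_triangle_ineq[of "?u - ?v" "?v - trunc B ?v"] by (simp add: gh_def)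
    qed (use gBi ghi gh'i in auto)
    then show ?thesis using h'(2) by simp
  qed
  have "(\<integral>\<xi>. norm (g \<xi> - gh \<xi>) \<partial>N) \<le>
      (\<integral>\<xi>. norm (g \<xi> - trunc B (g \<xi>)) \<partial>N) + (\<integral>\<xi>. norm (trunc B (g \<xi>) - gh \<xi>) \<partial>N)"
    using L1_triangle[OF gi gBi ghi] by (simp add: norm_minus_commute)
  also have "\<dots> < \<delta> / 2 + \<delta> / 2"
  proof -
    have "2 * \<eta> \<le> \<delta> / 2" by (simp add: \<eta>_def)
    then show ?thesis using tB close by linarith
  qed
  finally have L1: "(\<integral>\<xi>. norm (g \<xi> - gh \<xi>) \<partial>N) < \<delta>" by simp
  have "eventually (\<lambda>i. rho_bounded (M i) \<rho> (c + e) (h i)) U"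
  proof (rule eventually_rho_bounded[OF \<rho> hb a, where c = c and \<eta> = "2 * \<eta>"])
    show "c < c + e" using e by simp
    have "2 * \<eta> \<le> e * a / 2" by (simp add: \<eta>_def)
    also have "\<dots> < e * a" using e a by simp
    finally show "2 * \<eta> < (c + e - c) * a" by simp
    fix A assume A: "A \<in> sets N"
    have i: "integrable N (\<lambda>\<xi>. indicator A \<xi> *\<^sub>R norm (g \<xi>))"
      by (intro integrable_mult_indicator integrable_norm gi A)
    have "(LINT \<xi>:A|N. norm (gh \<xi>)) \<le> (\<integral>\<xi>. indicator A \<xi> *\<^sub>R norm (g \<xi>) + norm (trunc B (g \<xi>) - gh \<xi>) \<partial>N)"
      unfolding set_lebesgue_integral_def
    proof (rule integral_mono)
      show "integrable N (\<lambda>\<xi>. indicator A \<xi> *\<^sub>R norm (gh \<xi>))"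
        by (intro integrable_mult_indicator integrable_norm ghi A)
      show "integrable N (\<lambda>\<xi>. indicator A \<xi> *\<^sub>R norm (g \<xi>) + norm (trunc B (g \<xi>) - gh \<xi>))"
        using i gBi ghi by simp
      fix \<xi>
      have "norm (gh \<xi>) \<le> norm (trunc B (g \<xi>)) + norm (trunc B (g \<xi>) - gh \<xi>)"
        by (rule norm_triangle_sub[of "gh \<xi>" "trunc B (g \<xi>)", unfolded norm_minus_commute[of "gh \<xi>"]])
      then show "indicator A \<xi> *\<^sub>R norm (gh \<xi>) \<le> indicator A \<xi> *\<^sub>R norm (g \<xi>) + norm (trunc B (g \<xi>) - gh \<xi>)"
        using norm_trunc_le[OF B(1), of "g \<xi>"] by (simp add: indicator_def)
    qed
    also have "\<dots> = (LINT \<xi>:A|N. norm (g \<xi>)) + (\<integral>\<xi>. norm (trunc B (g \<xi>) - gh \<xi>) \<partial>N)"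
      using i gBi ghi by (simp add: set_lebesgue_integral_def)
    also have "\<dots> \<le> c * \<rho> (measure N A) + 2 * \<eta>"
      using g A close by (intro add_mono) (simp_all add: rho_bounded_def)
    finally show "(LINT \<xi>:A|N. norm (gh \<xi>)) \<le> c * \<rho> (measure N A) + 2 * \<eta>" .
  qed
  then show ?thesis using hb L1 by blast
qed

text \<open>
  Every \<open>g\<close> with \<open>\<parallel>g\<parallel> \<le> c\<close> is the ultralimit of a family of norm at most \<open>c + e\<close>. The set \<open>S n i\<close>
  consists of the functions of norm at most \<open>c + e\<close> within \<open>L\<^sup>1\<close>-distance \<open>1 / 2 ^ k\<close> of the
  approximation \<open>h k i\<close>, for all \<open>k \<le> n\<close>.
\<close>

lemma rho_bounded_lift:
  assumes \<rho>: "\<rho> \<in> majorants" and g: "rho_bounded N \<rho> c g" and e: "e > 0"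
  shows "\<exists>f. (\<forall>i. rho_bounded (M i) \<rho> (c + e) (f i)) \<and> ulim_AE f g"
proof -
  have gi: "integrable N g" using g by (rule rho_bounded_integrable)
  then have gm [measurable]: "g \<in> borel_measurable N" by auto
  have c: "0 \<le> c" by (rule rho_bounded_integral(2)[OF _ \<rho> g]) simp
  define \<epsilon> where "\<epsilon> = (\<lambda>n::nat. (1/2::real)^n)"
  have \<epsilon>: "\<epsilon> n > 0" "\<epsilon> n / 2 > 0" for n by (simp_all add: \<epsilon>_def)
  have \<epsilon>0: "\<epsilon> \<longlonglongrightarrow> 0" unfolding \<epsilon>_def by (rule LIMSEQ_power_zero) simp
  have "\<forall>n. \<exists>b h gh. bounded_ulim b h gh \<and> (\<integral>\<xi>. norm (g \<xi> - gh \<xi>) \<partial>N) < \<epsilon> n / 2 \<and>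
    eventually (\<lambda>i. rho_bounded (M i) \<rho> (c + e) (h i)) U"
    by (rule allI, rule rho_bounded_approx[OF \<rho> g e \<epsilon>(2)])
  from choice[OF this] obtain b where "\<forall>n. \<exists>h gh. bounded_ulim (b n) h gh \<and>
    (\<integral>\<xi>. norm (g \<xi> - gh \<xi>) \<partial>N) < \<epsilon> n / 2 \<and> eventually (\<lambda>i. rho_bounded (M i) \<rho> (c + e) (h i)) U" ..
  from choice[OF this] obtain h where "\<forall>n. \<exists>gh. bounded_ulim (b n) (h n) gh \<and>
    (\<integral>\<xi>. norm (g \<xi> - gh \<xi>) \<partial>N) < \<epsilon> n / 2 \<and> eventually (\<lambda>i. rho_bounded (M i) \<rho> (c + e) (h n i)) U" ..
  from choice[OF this] obtain gh where "\<forall>n. bounded_ulim (b n) (h n) (gh n) \<and>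
    (\<integral>\<xi>. norm (g \<xi> - gh n \<xi>) \<partial>N) < \<epsilon> n / 2 \<and> eventually (\<lambda>i. rho_bounded (M i) \<rho> (c + e) (h n i)) U" ..
  then have h: "bounded_ulim (b n) (h n) (gh n)" "(\<integral>\<xi>. norm (g \<xi> - gh n \<xi>) \<partial>N) < \<epsilon> n / 2"
    "eventually (\<lambda>i. rho_bounded (M i) \<rho> (c + e) (h n i)) U" for n by simp_all
  note hi [simp] = bounded_ulim_integrable(1)[OF h(1)] and ghi [simp] = bounded_ulim_integrable(2)[OF h(1)]
  have hlim: "ulim_AE (h n) (gh n)" for n using h(1)[of n] by (simp add: bounded_ulim_def)
  have [measurable]: "h n i \<in> borel_measurable (M i)" "gh n \<in> borel_measurable N" for n i
    using h(1)[of n] by (simp_all add: bounded_ulim_def)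
  define S where "S = (\<lambda>n i. {f. rho_bounded (M i) \<rho> (c + e) f \<and>
    (\<forall>k\<le>n. (\<integral>x. norm (f x - h k i x) \<partial>M i) \<le> \<epsilon> k)})"
  have close: "eventually (\<lambda>i. (\<integral>x. norm (h n i x - h k i x) \<partial>M i) \<le> \<epsilon> k) U" if "k \<le> n" for n k
  proof -
    let ?h = "\<lambda>i x. complex_of_real (norm (h n i x - h k i x))"
    let ?g = "\<lambda>\<xi>. complex_of_real (norm (gh n \<xi> - gh k \<xi>))"
    have b: "bounded_ulim (b n + b k) ?h ?g"
      unfolding bounded_ulim_def
    proof (intro conjI allI)
      have b0: "b n > 0" "b k > 0" and hb: "norm (h n i x) \<le> b n" "norm (h k i x) \<le> b k" for i x
        using h(1)[of n] h(1)[of k] by (simp_all add: bounded_ulim_def)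
      show "b n + b k > 0" using b0 by simp
      show "norm (?h i x) \<le> b n + b k" for i x
        using norm_triangle_ineq4[of "h n i x" "h k i x"] hb[of i x] by simp
      have "continuous_on UNIV (\<lambda>z. complex_of_real (norm z))" by (intro continuous_intros)
      from ulim_AE_continuous[OF ulim_AE_diff[OF hlim hlim] this] show "ulim_AE ?h ?g" .
    qed measurable
    have "?g \<in> borel_measurable N" "ulim_AE ?h ?g" using b by (simp_all add: bounded_ulim_def)
    then have "((\<lambda>i. integral\<^sup>L (M i) (?h i)) \<longlongrightarrow> integral\<^sup>L N ?g) U"
      by (intro ulim_integral(2)[OF bounded_unif_integrable[OF b]])
    then have lim: "((\<lambda>i. \<integral>x. norm (h n i x - h k i x) \<partial>M i) \<longlongrightarrow> (\<integral>\<xi>. norm (gh n \<xi> - gh k \<xi>) \<partial>N)) U"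
      unfolding integral_complex_of_real tendsto_of_real_iff .
    have "(\<integral>\<xi>. norm (gh n \<xi> - gh k \<xi>) \<partial>N) \<le> (\<integral>\<xi>. norm (g \<xi> - gh n \<xi>) \<partial>N) + (\<integral>\<xi>. norm (g \<xi> - gh k \<xi>) \<partial>N)"
      using L1_triangle[OF ghi gi ghi, of n k] by (simp add: norm_minus_commute)
    also have "\<dots> < \<epsilon> n / 2 + \<epsilon> k / 2" by (intro add_strict_mono h(2))
    also have "\<epsilon> n / 2 + \<epsilon> k / 2 \<le> \<epsilon> k"
    proof -
      have "\<epsilon> n \<le> \<epsilon> k" using that unfolding \<epsilon>_def by (intro power_decreasing) simp_all
      then show ?thesis by linarith
    qed
    finally have "(\<integral>\<xi>. norm (gh n \<xi> - gh k \<xi>) \<partial>N) < \<epsilon> k" .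
    from order_tendstoD(2)[OF lim this] show ?thesis by eventually_elim simp
  qed
  have "\<exists>f. \<forall>n i. S n i \<noteq> {} \<longrightarrow> f i \<in> S n i"
  proof (rule diagonal_choice)
    show "S (Suc n) i \<subseteq> S n i" for n i by (auto simp: S_def)
    fix i assume ne: "\<And>n. S n i \<noteq> {}"
    then have "\<forall>n. \<exists>f. f \<in> S n i" by blast
    then obtain s where s: "\<And>n. s n \<in> S n i" by metis
    have srb: "rho_bounded (M i) \<rho> (c + e) (s n)" for n using s[of n] by (simp add: S_def)
    have si [simp]: "integrable (M i) (s n)" for n using srb by (rule rho_bounded_integrable)
    have sc: "(\<integral>x. norm (s n x - h k i x) \<partial>M i) \<le> \<epsilon> k" if "k \<le> n" for n k
      using s[of n] that by (simp add: S_def)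
    have "\<exists>n0. \<forall>j\<ge>n0. \<forall>l\<ge>n0. (\<integral>x. norm (s j x - s l x) \<partial>M i) < d" if d: "d > 0" for d
    proof -
      have "eventually (\<lambda>n. \<epsilon> n < d / 2) sequentially" using order_tendstoD(2)[OF \<epsilon>0, of "d/2"] d by simp
      then obtain n where n: "\<epsilon> n < d / 2" by (auto simp: eventually_sequentially)
      have "(\<integral>x. norm (s j x - s l x) \<partial>M i) < d" if "n \<le> j" "n \<le> l" for j l
      proof -
        have "(\<integral>x. norm (s j x - s l x) \<partial>M i) \<le> (\<integral>x. norm (s j x - h n i x) \<partial>M i) + (\<integral>x. norm (s l x - h n i x) \<partial>M i)"
          by (rule L1_triangle) simp_all
        also have "\<dots> \<le> \<epsilon> n + \<epsilon> n" by (intro add_mono sc that)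
        finally show ?thesis using n by simp
      qed
      then show ?thesis by blast
    qed
    then obtain r f where r: "strict_mono r" and fm [measurable]: "f \<in> borel_measurable (M i)"
      and lim: "AE x in M i. (\<lambda>n. s (r n) x) \<longlonglongrightarrow> f x"
      using integrable_L1_complete[of "M i" s, OF si] by blast
    have set: "integrable (M i) (\<lambda>x. indicator A x *\<^sub>R norm (f x))"
      "(LINT x:A|M i. norm (f x)) \<le> (c + e) * \<rho> (measure (M i) A)" if A [measurable]: "A \<in> sets (M i)" for A
    proof -
      let ?u = "\<lambda>n x. indicator A x *\<^sub>R norm (s (r n) x)"
      have 1: "integrable (M i) (?u n)" for n by (intro integrable_mult_indicator integrable_norm si A)
      have 2: "AE x in M i. (\<lambda>n. ?u n x) \<longlonglongrightarrow> indicator A x *\<^sub>R norm (f x)"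
        using lim by eventually_elim (intro tendsto_intros)
      have 3: "integral\<^sup>L (M i) (?u n) \<le> (c + e) * \<rho> (measure (M i) A)" for n
        using srb[of "r n"] A unfolding rho_bounded_def set_lebesgue_integral_def by blast
      note * = Fatou_integral_le[OF 1 _ 2 _ 3]
      show "integrable (M i) (\<lambda>x. indicator A x *\<^sub>R norm (f x))" by (rule *(1)) auto
      show "(LINT x:A|M i. norm (f x)) \<le> (c + e) * \<rho> (measure (M i) A)"
        unfolding set_lebesgue_integral_def by (rule *(2)) auto
    qed
    have "integrable (M i) (\<lambda>x. indicator (space (M i)) x *\<^sub>R norm (f x)) \<longleftrightarrow> integrable (M i) (\<lambda>x. norm (f x))"
      by (rule Bochner_Integration.integrable_cong) auto
    then have "integrable (M i) f" using set(1)[OF sets.top] by (simp add: integrable_norm_iff)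
    then have frb: "rho_bounded (M i) \<rho> (c + e) f" using set(2) by (simp add: rho_bounded_def)
    have "(\<integral>x. norm (f x - h k i x) \<partial>M i) \<le> \<epsilon> k" for k
    proof -
      let ?u = "\<lambda>n x. norm (s (r (n + k)) x - h k i x)"
      have 1: "integrable (M i) (?u n)" for n by simp
      have 2: "AE x in M i. (\<lambda>n. ?u n x) \<longlonglongrightarrow> norm (f x - h k i x)"
        using lim
      proof eventually_elim
        case (elim x)
        have "(\<lambda>n. s (r (n + k)) x) \<longlonglongrightarrow> f x" by (rule LIMSEQ_ignore_initial_segment[OF elim])
        then show ?case by (intro tendsto_intros)
      qed
      have 3: "integral\<^sup>L (M i) (?u n) \<le> \<epsilon> k" for n
        using seq_suble[OF r, of "n + k"] by (intro sc) simp
      show ?thesis by (rule Fatou_integral_le(2)[OF 1 _ 2 _ 3]) auto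
    qed
    with frb have "f \<in> (\<Inter>n. S n i)" by (auto simp: S_def)
    then show "(\<Inter>n. S n i) \<noteq> {}" by blast
  qed
  then obtain f0 where f0: "\<And>n i. S n i \<noteq> {} \<Longrightarrow> f0 i \<in> S n i" by blast
  \<comment> \<open>Nothing is known about \<open>f0 i\<close> at indices with \<open>S 0 i\<close> empty; such \<open>i\<close> form a negligible set.\<close>
  define f where "f = (\<lambda>i. if S 0 i \<noteq> {} then f0 i else (\<lambda>x. 0))"
  have zero: "rho_bounded (M i) \<rho> (c + e) (\<lambda>x. 0)" for i
    using c e majorant_nonneg[OF \<rho>] prob_space.prob_le_1[OF prob]
    by (simp add: rho_bounded_def set_lebesgue_integral_def)
  have frb: "rho_bounded (M i) \<rho> (c + e) (f i)" for i
    using f0[of 0 i] zero by (auto simp: f_def S_def)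
  have fi [simp]: "integrable (M i) (f i)" for i using frb by (rule rho_bounded_integrable)
  have near: "eventually (\<lambda>i. (\<integral>x. norm (f i x - h k i x) \<partial>M i) \<le> \<epsilon> k) U" for k
  proof -
    have "eventually (\<lambda>i. \<forall>j\<in>{..k}. (\<integral>x. norm (h k i x - h j i x) \<partial>M i) \<le> \<epsilon> j) U"
      by (subst eventually_ball_finite_distrib) (use close in auto)
    then show ?thesis using h(3)[of k]
    proof eventually_elim
      case (elim i)
      then have "h k i \<in> S k i" by (simp add: S_def)
      then have *: "S k i \<noteq> {}" by blast
      then have "f0 i \<in> S k i" by (rule f0)
      moreover from this have "S 0 i \<noteq> {}" by (auto simp: S_def)
      ultimately show ?case by (auto simp: f_def S_def)
    qed
  qed
  have Kint: "(\<integral>x. norm (f i x) \<partial>M i) \<le> c + e" for i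
    by (rule rho_bounded_integral(1)[OF _ \<rho> frb]) simp
  obtain g' where g' [measurable]: "g' \<in> borel_measurable N" and fg': "ulim_AE f g'"
    using ulim_AE_exists[OF fi always_eventually[OF allI[OF Kint]]] by blast
  have g'i: "integrable N g'" by (rule ulim_integral(1)[OF unif_integrable_rho[OF \<rho> frb] fg' g'])
  have le: "(\<integral>\<xi>. norm (g' \<xi> - g \<xi>) \<partial>N) \<le> \<epsilon> k + \<epsilon> k / 2" for k
  proof -
    have "(\<integral>\<xi>. norm (g' \<xi> - gh k \<xi>) \<partial>N) \<le> \<epsilon> k"
      by (rule ulim_Fatou(2)[OF _ near ulim_AE_diff[OF fg' hlim]]) auto
    with L1_triangle[OF g'i ghi gi, of k] show ?thesis using h(2)[of k] by linarith
  qed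
  have "(\<integral>\<xi>. norm (g' \<xi> - g \<xi>) \<partial>N) \<le> 0 + 0 / 2"
    by (rule LIMSEQ_le_const[OF tendsto_add[OF \<epsilon>0 tendsto_divide[OF \<epsilon>0 tendsto_const]]])
      (use le in auto)
  then have "(\<integral>\<xi>. norm (g' \<xi> - g \<xi>) \<partial>N) = 0"
    by (simp add: antisym)
  then have "AE \<xi> in N. norm (g' \<xi> - g \<xi>) = 0"
    using gi g'i by (subst (asm) integral_nonneg_eq_0_iff_AE) auto
  then have "ulim_AE f g" using fg' unfolding ulim_AE_def by eventually_elim simp
  then show ?thesis using frb by blast
qed

end

section \<open>Vector spaces with explicit carriers\<close>

text \<open>
  Complex vector spaces, and spaces with a seminorm, in the record representation. There is no
  operation for the negative of \<open>v\<close>; it is \<open>vscale E (-1) v\<close>.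
\<close>

locale vspace =
  fixes E :: "'v nspace"
  assumes add_closed: "v \<in> carrier E \<Longrightarrow> w \<in> carrier E \<Longrightarrow> vadd E v w \<in> carrier E"
    and scale_closed: "v \<in> carrier E \<Longrightarrow> vscale E c v \<in> carrier E"
    and zero_closed: "vzero E \<in> carrier E"
    and add_assoc: "u \<in> carrier E \<Longrightarrow> v \<in> carrier E \<Longrightarrow> w \<in> carrier E \<Longrightarrow>
      vadd E (vadd E u v) w = vadd E u (vadd E v w)"
    and add_commute: "v \<in> carrier E \<Longrightarrow> w \<in> carrier E \<Longrightarrow> vadd E v w = vadd E w v"
    and add_zero: "v \<in> carrier E \<Longrightarrow> vadd E v (vzero E) = v"
    and scale_add: "v \<in> carrier E \<Longrightarrow> w \<in> carrier E \<Longrightarrow>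
      vscale E c (vadd E v w) = vadd E (vscale E c v) (vscale E c w)"
    and add_scale: "v \<in> carrier E \<Longrightarrow> vscale E (c + d) v = vadd E (vscale E c v) (vscale E d v)"
    and scale_scale: "v \<in> carrier E \<Longrightarrow> vscale E c (vscale E d v) = vscale E (c * d) v"
    and scale_one: "v \<in> carrier E \<Longrightarrow> vscale E 1 v = v"
    and scale_0: "v \<in> carrier E \<Longrightarrow> vscale E 0 v = vzero E"

locale seminormed_vspace = vspace E for E :: "'v nspace" +
  assumes norm_nonneg: "v \<in> carrier E \<Longrightarrow> 0 \<le> vnorm E v"
    and norm_triangle: "v \<in> carrier E \<Longrightarrow> w \<in> carrier E \<Longrightarrow> vnorm E (vadd E v w) \<le> vnorm E v + vnorm E w"
    and norm_scale: "v \<in> carrier E \<Longrightarrow> vnorm E (vscale E c v) = norm c * vnorm E v"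

text \<open>
  Linear subspaces, given by their set of vectors.
\<close>

definition vsubspace :: "'v nspace \<Rightarrow> 'v set \<Rightarrow> bool" where
  "vsubspace E N \<longleftrightarrow> N \<subseteq> carrier E \<and> vzero E \<in> N \<and> (\<forall>v\<in>N. \<forall>w\<in>N. vadd E v w \<in> N) \<and>
    (\<forall>c. \<forall>v\<in>N. vscale E c v \<in> N)"

context vspace
begin

lemma zero_scale: "vscale E c (vzero E) = vzero E"
  using scale_scale[OF zero_closed, of c 0] scale_0[OF zero_closed] by simp

lemma add_neg: "v \<in> carrier E \<Longrightarrow> vadd E v (vscale E (-1) v) = vzero E"
  using add_scale[of v 1 "-1"] by (simp add: scale_one scale_0)

lemma add_neg_cancel:
  assumes "v \<in> carrier E" "w \<in> carrier E"
  shows "vadd E v (vadd E w (vscale E (-1) v)) = w"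
proof -
  have "vadd E v (vadd E w (vscale E (-1) v)) = vadd E (vadd E w v) (vscale E (-1) v)"
    using assms add_commute[of v "vadd E w (vscale E (-1) v)"] add_commute[of v "vscale E (-1) v"]
    by (simp add: add_assoc add_closed scale_closed)
  also have "\<dots> = vadd E w (vadd E v (vscale E (-1) v))"
    using assms by (intro add_assoc scale_closed)
  finally show ?thesis using assms by (simp add: add_neg add_zero)
qed

lemma add_swap:
  assumes "a \<in> carrier E" "b \<in> carrier E" "c \<in> carrier E" "d \<in> carrier E"
  shows "vadd E (vadd E a b) (vadd E c d) = vadd E (vadd E a c) (vadd E b d)"
proof -
  have "vadd E b (vadd E c d) = vadd E c (vadd E b d)"
    using assms by (simp add: add_assoc[symmetric] add_commute[of b c])
  then show ?thesis using assms by (simp add: add_assoc add_closed)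
qed

context
  fixes N assumes N: "vsubspace E N"
begin

lemma N_sub: "n \<in> N \<Longrightarrow> n \<in> carrier E" and N_zero: "vzero E \<in> N"
  and N_add: "m \<in> N \<Longrightarrow> n \<in> N \<Longrightarrow> vadd E m n \<in> N" and N_scale: "n \<in> N \<Longrightarrow> vscale E c n \<in> N"
  using N by (auto simp: vsubspace_def)

lemma coset_refl: "v \<in> carrier E \<Longrightarrow> v \<in> coset E N v"
  unfolding coset_def using N_zero add_zero by force

lemma coset_subset: "v \<in> carrier E \<Longrightarrow> coset E N v \<subseteq> carrier E"
  unfolding coset_def using N_sub add_closed by blast

lemma coset_memI: "n \<in> N \<Longrightarrow> vadd E v n \<in> coset E N v"
  by (auto simp: coset_def)

lemma coset_memE:
  assumes "w \<in> coset E N v" obtains n where "n \<in> N" "w = vadd E v n"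
  using assms by (auto simp: coset_def)

lemma coset_eqI:
  assumes v: "v \<in> carrier E" and w: "w \<in> coset E N v"
  shows "coset E N w = coset E N v"
proof -
  obtain n where n: "n \<in> N" "w = vadd E v n" using w by (rule coset_memE)
  show ?thesis
  proof (intro subset_antisym subsetI)
    fix x assume "x \<in> coset E N w"
    then obtain m where m: "m \<in> N" "x = vadd E w m" by (rule coset_memE)
    have "x = vadd E v (vadd E n m)" using n m v N_sub by (simp add: add_assoc)
    then show "x \<in> coset E N v" using coset_memI[OF N_add[OF n(1) m(1)]] by simp
  next
    fix x assume "x \<in> coset E N v"
    then obtain m where m: "m \<in> N" "x = vadd E v m" by (rule coset_memE)
    have c: "n \<in> carrier E" "m \<in> carrier E" using n m N_sub by auto
    have "vadd E w (vadd E m (vscale E (-1) n)) = vadd E v (vadd E n (vadd E m (vscale E (-1) n)))"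
      unfolding n(2) by (intro add_assoc v c add_closed scale_closed)
    then have "x = vadd E w (vadd E m (vscale E (-1) n))" using add_neg_cancel[OF c] m(2) by simp
    then show "x \<in> coset E N w" using coset_memI[OF N_add[OF m(1) N_scale[OF n(1)]]] by simp
  qed
qed

lemma coset_eq_iff:
  assumes "v \<in> carrier E" "w \<in> carrier E"
  shows "coset E N v = coset E N w \<longleftrightarrow> (\<exists>n\<in>N. w = vadd E v n)"
proof
  assume "coset E N v = coset E N w"
  then have "w \<in> coset E N v" using coset_refl[OF assms(2)] by simp
  then show "\<exists>n\<in>N. w = vadd E v n" by (auto simp: coset_def)
next
  assume "\<exists>n\<in>N. w = vadd E v n"
  then have "w \<in> coset E N v" by (auto simp: coset_def)
  then show "coset E N v = coset E N w" using coset_eqI[OF assms(1)] by simp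
qed

lemma coset_zero: "coset E N (vzero E) = N"
proof -
  have eq: "vadd E (vzero E) n = n" if "n \<in> N" for n
    using add_commute[OF zero_closed N_sub[OF that]] add_zero[OF N_sub[OF that]] by simp
  show ?thesis
  proof (intro subset_antisym subsetI)
    show "x \<in> N" if "x \<in> coset E N (vzero E)" for x
      using that eq by (auto elim: coset_memE)
    show "x \<in> coset E N (vzero E)" if "x \<in> N" for x
      using coset_memI[OF that, of "vzero E"] eq[OF that] by simp
  qed
qed

lemma quotient_carrier: "carrier (quotient_space E N) = coset E N ` carrier E"
  by (simp add: quotient_space_def)

lemma quotient_zero: "vzero (quotient_space E N) = coset E N (vzero E)"
  unfolding coset_zero by (simp add: quotient_space_def)

lemma quotient_add:
  assumes v: "v \<in> carrier E" and w: "w \<in> carrier E"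
  shows "vadd (quotient_space E N) (coset E N v) (coset E N w) = coset E N (vadd E v w)"
proof -
  have eq: "vadd E (vadd E v m) (vadd E w n) = vadd E (vadd E v w) (vadd E m n)" if "m \<in> N" "n \<in> N" for m n
    using add_swap v w N_sub that by blast
  have "{vadd E p q |p q. p \<in> coset E N v \<and> q \<in> coset E N w} = coset E N (vadd E v w)"
  proof (intro subset_antisym subsetI)
    fix x assume "x \<in> {vadd E p q |p q. p \<in> coset E N v \<and> q \<in> coset E N w}"
    then obtain m n where mn: "m \<in> N" "n \<in> N" "x = vadd E (vadd E v m) (vadd E w n)"
      by (auto simp: coset_def)
    then show "x \<in> coset E N (vadd E v w)"
      using eq[OF mn(1,2)] coset_memI[OF N_add[OF mn(1,2)]] by simp
  next
    fix x assume "x \<in> coset E N (vadd E v w)"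
    then obtain n where n: "n \<in> N" "x = vadd E (vadd E v w) n" by (auto simp: coset_def)
    have "x = vadd E v (vadd E w n)" using n v w N_sub by (simp add: add_assoc)
    moreover have "vadd E w n \<in> coset E N w" using n by (auto simp: coset_def)
    ultimately show "x \<in> {vadd E p q |p q. p \<in> coset E N v \<and> q \<in> coset E N w}"
      using coset_refl[OF v] by blast
  qed
  then show ?thesis by (simp add: quotient_space_def)
qed

lemma quotient_scale:
  assumes v: "v \<in> carrier E"
  shows "vscale (quotient_space E N) c (coset E N v) = coset E N (vscale E c v)"
proof -
  have eq: "vadd E (vscale E c (vadd E v m)) n = vadd E (vscale E c v) (vadd E (vscale E c m) n)"
    if "m \<in> N" "n \<in> N" for m n
    using v that N_sub by (simp add: scale_add add_assoc scale_closed)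
  have "{vadd E (vscale E c p) n |p n. p \<in> coset E N v \<and> n \<in> N} = coset E N (vscale E c v)"
  proof (intro subset_antisym subsetI)
    fix x assume "x \<in> {vadd E (vscale E c p) n |p n. p \<in> coset E N v \<and> n \<in> N}"
    then obtain m n where mn: "m \<in> N" "n \<in> N" "x = vadd E (vscale E c (vadd E v m)) n"
      by (auto simp: coset_def)
    then show "x \<in> coset E N (vscale E c v)"
      using eq[OF mn(1,2)] coset_memI[OF N_add[OF N_scale[OF mn(1)] mn(2)]] by simp
  next
    fix x assume "x \<in> coset E N (vscale E c v)"
    then obtain n where "n \<in> N" "x = vadd E (vscale E c v) n" by (rule coset_memE)
    then show "x \<in> {vadd E (vscale E c p) n |p n. p \<in> coset E N v \<and> n \<in> N}"
      using coset_refl[OF v] by blast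
  qed
  then show ?thesis by (simp add: quotient_space_def)
qed

lemma quotient_vspace: "vspace (quotient_space E N)"
proof
  fix P Q R c d
  let ?E = "quotient_space E N"
  note q = quotient_add quotient_scale add_closed scale_closed zero_closed
  show "vzero ?E \<in> carrier ?E" using zero_closed by (simp add: quotient_carrier quotient_zero)
  assume "P \<in> carrier ?E"
  then obtain u where u: "u \<in> carrier E" "P = coset E N u" by (auto simp: quotient_carrier)
  show "vscale ?E c P \<in> carrier ?E" using u by (simp add: q quotient_carrier)
  show "vadd ?E P (vzero ?E) = P" using u by (simp add: q quotient_zero add_zero)
  show "vscale ?E (c + d) P = vadd ?E (vscale ?E c P) (vscale ?E d P)" using u by (simp add: q add_scale)
  show "vscale ?E c (vscale ?E d P) = vscale ?E (c * d) P" using u by (simp add: q scale_scale)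
  show "vscale ?E 1 P = P" using u by (simp add: q scale_one)
  show "vscale ?E 0 P = vzero ?E" using u by (simp add: q quotient_zero scale_0)
  assume "Q \<in> carrier ?E"
  then obtain v where v: "v \<in> carrier E" "Q = coset E N v" by (auto simp: quotient_carrier)
  show "vadd ?E P Q \<in> carrier ?E" using u v by (simp add: q quotient_carrier)
  show "vadd ?E P Q = vadd ?E Q P" using u v by (simp add: q add_commute)
  show "vscale ?E c (vadd ?E P Q) = vadd ?E (vscale ?E c P) (vscale ?E c Q)"
    using u v by (simp add: q scale_add)
  assume "R \<in> carrier ?E"
  then obtain w where w: "w \<in> carrier E" "R = coset E N w" by (auto simp: quotient_carrier)
  show "vadd ?E (vadd ?E P Q) R = vadd ?E P (vadd ?E Q R)" using u v w by (simp add: q add_assoc)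
qed

end

end

context seminormed_vspace
begin

lemma norm_zero: "vnorm E (vzero E) = 0"
  using norm_scale[OF zero_closed, of 0] scale_0[OF zero_closed] by simp

lemma quotient_norm_null:
  assumes N: "vsubspace E N" and null: "\<And>n. n \<in> N \<Longrightarrow> vnorm E n = 0" and v: "v \<in> carrier E"
  shows "vnorm (quotient_space E N) (coset E N v) = vnorm E v"
proof -
  have "vnorm E p = vnorm E v" if p: "p \<in> coset E N v" for p
  proof -
    obtain n where n: "n \<in> N" "p = vadd E v n" using p by (auto simp: coset_def)
    have nE: "n \<in> carrier E" by (rule N_sub[OF N n(1)])
    have nE': "vscale E (-1) n \<in> carrier E" by (rule scale_closed[OF nE])
    have pE: "p \<in> carrier E" unfolding n(2) by (rule add_closed[OF v nE])
    have "vadd E p (vscale E (-1) n) = vadd E v (vadd E n (vscale E (-1) n))"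
      unfolding n(2) by (rule add_assoc[OF v nE nE'])
    also have "\<dots> = v" by (simp only: add_neg[OF nE] add_zero[OF v])
    finally have "vnorm E v \<le> vnorm E p + vnorm E (vscale E (-1) n)"
      using norm_triangle[OF pE nE'] by simp
    moreover have "vnorm E (vscale E (-1) n) = 0" using norm_scale[OF nE, of "-1"] null[OF n(1)] by simp
    moreover have "vnorm E p \<le> vnorm E v + vnorm E n" unfolding n(2) by (rule norm_triangle[OF v nE])
    ultimately show ?thesis using null[OF n(1)] by linarith
  qed
  then have "vnorm E ` coset E N v = {vnorm E v}" using coset_refl[OF N v] by blast
  then show ?thesis by (simp add: quotient_space_def)
qed

lemma quotient_seminormed:
  assumes N: "vsubspace E N" and null: "\<And>n. n \<in> N \<Longrightarrow> vnorm E n = 0"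
  shows "seminormed_vspace (quotient_space E N)"
proof -
  let ?E = "quotient_space E N"
  interpret q: vspace ?E by (rule quotient_vspace[OF N])
  note n = quotient_norm_null[OF N null] quotient_add[OF N] quotient_scale[OF N] add_closed scale_closed
  show ?thesis
  proof
    fix P Q c assume "P \<in> carrier ?E"
    then obtain v where v: "v \<in> carrier E" "P = coset E N v" by (auto simp: quotient_carrier[OF N])
    show "0 \<le> vnorm ?E P" using v by (simp add: n norm_nonneg)
    show "vnorm ?E (vscale ?E c P) = norm c * vnorm ?E P" using v by (simp add: n norm_scale)
    assume "Q \<in> carrier ?E"
    then obtain w where w: "w \<in> carrier E" "Q = coset E N w" by (auto simp: quotient_carrier[OF N])
    show "vnorm ?E (vadd ?E P Q) \<le> vnorm ?E P + vnorm ?E Q" using v w by (simp add: n norm_triangle)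
  qed
qed

end

lemma linf_vspace:
  assumes "\<And>i. seminormed_vspace (B i)"
  shows "vspace (linf_space B)"
proof -
  interpret B: seminormed_vspace "B i" for i by (rule assms)
  have carrierI: "v \<in> carrier (linf_space B)"
    if "\<And>i. v i \<in> carrier (B i)" "\<And>i. vnorm (B i) (v i) \<le> K" for v K
    using that by (auto simp: linf_space_def intro!: bdd_aboveI[of _ K])
  have carrierD: "\<exists>K. (\<forall>i. v i \<in> carrier (B i) \<and> vnorm (B i) (v i) \<le> K)" if "v \<in> carrier (linf_space B)" for v
    using that by (auto simp: linf_space_def bdd_above_def)
  show ?thesis
  proof
    fix u v w c d
    let ?L = "linf_space B"
    have ops: "vadd ?L x y = (\<lambda>i. vadd (B i) (x i) (y i))" "vscale ?L a x = (\<lambda>i. vscale (B i) a (x i))"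
      "vzero ?L = (\<lambda>i. vzero (B i))" for x y a by (simp_all add: linf_space_def)
    show "vzero ?L \<in> carrier ?L" unfolding ops
      by (rule carrierI[of _ 0]) (simp_all add: B.zero_closed B.norm_zero)
    assume "v \<in> carrier ?L"
    then obtain K where v: "\<And>i. v i \<in> carrier (B i)" "\<And>i. vnorm (B i) (v i) \<le> K" using carrierD by blast
    show "vscale ?L c v \<in> carrier ?L" unfolding ops
      by (rule carrierI[of _ "norm c * K"]) (simp_all add: v B.scale_closed B.norm_scale mult_left_mono)
    show "vadd ?L v (vzero ?L) = v" "vscale ?L (c + d) v = vadd ?L (vscale ?L c v) (vscale ?L d v)"
      "vscale ?L c (vscale ?L d v) = vscale ?L (c * d) v" "vscale ?L 1 v = v" "vscale ?L 0 v = vzero ?L"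
      unfolding ops using v(1)
      by (simp_all add: B.add_zero B.add_scale B.scale_scale B.scale_one B.scale_0)
    assume "w \<in> carrier ?L"
    then obtain K' where w: "\<And>i. w i \<in> carrier (B i)" "\<And>i. vnorm (B i) (w i) \<le> K'" using carrierD by blast
    show "vadd ?L v w \<in> carrier ?L" unfolding ops
    proof (rule carrierI[of _ "K + K'"])
      fix i
      show "vadd (B i) (v i) (w i) \<in> carrier (B i)" by (rule B.add_closed[OF v(1) w(1)])
      show "vnorm (B i) (vadd (B i) (v i) (w i)) \<le> K + K'"
        using B.norm_triangle[OF v(1) w(1), of i] v(2)[of i] w(2)[of i] by linarith
    qed
    show "vadd ?L v w = vadd ?L w v" unfolding ops using v(1) w(1) B.add_commute by blast
    show "vscale ?L c (vadd ?L v w) = vadd ?L (vscale ?L c v) (vscale ?L c w)"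
      unfolding ops using v(1) w(1) by (simp add: B.scale_add)
    assume "u \<in> carrier ?L"
    then have u: "u i \<in> carrier (B i)" for i using carrierD by blast
    show "vadd ?L (vadd ?L u v) w = vadd ?L u (vadd ?L v w)"
      unfolding ops using u v(1) w(1) by (simp add: B.add_assoc)
  qed
qed

lemma null_families_subspace:
  assumes "\<And>i. seminormed_vspace (B i)"
  shows "vsubspace (linf_space B) (null_families U B)"
proof -
  interpret B: seminormed_vspace "B i" for i by (rule assms)
  interpret L: vspace "linf_space B" by (rule linf_vspace[OF assms])
  have car: "v i \<in> carrier (B i)" if "v \<in> carrier (linf_space B)" for v i
    using that by (simp add: linf_space_def)
  have ops: "vadd (linf_space B) x y i = vadd (B i) (x i) (y i)"
    "vscale (linf_space B) a x i = vscale (B i) a (x i)" "vzero (linf_space B) i = vzero (B i)" for x y a i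
    by (simp_all add: linf_space_def)
  show ?thesis
    unfolding vsubspace_def
  proof (intro conjI ballI allI)
    show "null_families U B \<subseteq> carrier (linf_space B)" by (auto simp: null_families_def)
    show "vzero (linf_space B) \<in> null_families U B"
      by (simp add: null_families_def L.zero_closed ops B.norm_zero)
    fix v assume v: "v \<in> null_families U B"
    then have v': "v \<in> carrier (linf_space B)" "((\<lambda>i. vnorm (B i) (v i)) \<longlongrightarrow> 0) U"
      by (simp_all add: null_families_def)
    have "((\<lambda>i. norm c * vnorm (B i) (v i)) \<longlongrightarrow> norm c * 0) U" for c :: complex
      by (intro tendsto_intros v')
    then show "vscale (linf_space B) c v \<in> null_families U B" for c
      using v'(1) by (simp add: null_families_def L.scale_closed ops B.norm_scale car)
    fix w assume "w \<in> null_families U B"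
    then have w': "w \<in> carrier (linf_space B)" "((\<lambda>i. vnorm (B i) (w i)) \<longlongrightarrow> 0) U"
      by (simp_all add: null_families_def)
    have "((\<lambda>i. vnorm (B i) (v i) + vnorm (B i) (w i)) \<longlongrightarrow> 0 + 0) U" by (intro tendsto_intros v' w')
    then have lim: "((\<lambda>i. vnorm (B i) (v i) + vnorm (B i) (w i)) \<longlongrightarrow> 0) U" by simp
    have "((\<lambda>i. vnorm (B i) (vadd (B i) (v i) (w i))) \<longlongrightarrow> 0) U"
    proof (rule tendsto_sandwich[OF _ _ tendsto_const lim]; rule always_eventually, rule allI)
      fix i
      show "0 \<le> vnorm (B i) (vadd (B i) (v i) (w i))"
        by (intro B.norm_nonneg B.add_closed car v'(1) w'(1))
      show "vnorm (B i) (vadd (B i) (v i) (w i)) \<le> vnorm (B i) (v i) + vnorm (B i) (w i)"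
        by (intro B.norm_triangle car v'(1) w'(1))
    qed
    then show "vadd (linf_space B) v w \<in> null_families U B"
      using v'(1) w'(1) by (simp add: null_families_def L.add_closed ops)
  qed
qed

lemma linear_map_zero:
  assumes "vspace E" "vspace F" "linear_map E F T"
  shows "T (vzero E) = vzero F"
proof -
  interpret E: vspace E by fact
  interpret F: vspace F by fact
  have "T (vscale E 0 (vzero E)) = vscale F 0 (T (vzero E))" "T (vzero E) \<in> carrier F"
    using assms(3) E.zero_closed by (auto simp: linear_map_def)
  then show ?thesis using E.scale_0[OF E.zero_closed] F.scale_0 by simp
qed

text \<open>
  A linear contraction under which every vector \<open>w\<close> has, for every \<open>e > 0\<close>, a preimage of norm at most
  \<open>\<parallel>w\<parallel> + e\<close> induces an isometric isomorphism on the quotient by its kernel.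
\<close>

lemma isometric_isomorphism_quotient:
  assumes E: "vspace E" and F: "vspace F" and T: "linear_map E F T"
    and contr: "\<And>v. v \<in> carrier E \<Longrightarrow> vnorm F (T v) \<le> vnorm E v"
    and lift: "\<And>w e. w \<in> carrier F \<Longrightarrow> e > 0 \<Longrightarrow> \<exists>v\<in>carrier E. T v = w \<and> vnorm E v \<le> vnorm F w + e"
  shows "isometric_isomorphism (quotient_space E (ker E F T)) F (induced_map T)"
proof -
  interpret E: vspace E by fact
  interpret F: vspace F by fact
  let ?K = "ker E F T"
  let ?Q = "quotient_space E ?K"
  have Tc: "T v \<in> carrier F" and Ta: "w \<in> carrier E \<Longrightarrow> T (vadd E v w) = vadd F (T v) (T w)"
    and Ts: "T (vscale E c v) = vscale F c (T v)" if "v \<in> carrier E" for v w c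
    using T that by (auto simp: linear_map_def)
  have K: "vsubspace E ?K"
    unfolding vsubspace_def ker_def
    using E.zero_closed linear_map_zero[OF E F T] F.zero_closed
    by (auto simp: Ta Ts E.add_closed E.scale_closed F.add_zero F.zero_scale)
  note q = E.quotient_add[OF K] E.quotient_scale[OF K] E.quotient_carrier[OF K]
  have TK: "T p = T v" if "v \<in> carrier E" "p \<in> coset E ?K v" for v p
    using that by (auto simp: coset_def ker_def Ta Tc F.add_zero)
  have ind: "induced_map T (coset E ?K v) = T v" if v: "v \<in> carrier E" for v
  proof -
    have "T ` coset E ?K v = {T v}" using TK[OF v] E.coset_refl[OF K v] by blast
    then show ?thesis by (simp add: induced_map_def)
  qed
  have lin: "linear_map ?Q F (induced_map T)"
    unfolding linear_map_def q(3)
    by (auto simp: q ind Tc Ta Ts E.add_closed E.scale_closed)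
  have inj: "coset E ?K v = coset E ?K w" if v: "v \<in> carrier E" and w: "w \<in> carrier E" and eq: "T v = T w" for v w
  proof -
    let ?n = "vadd E w (vscale E (-1) v)"
    have "T ?n = vzero F"
      using v w eq by (simp add: Ta Ts E.scale_closed F.add_neg Tc)
    then have "?n \<in> ?K" using v w by (simp add: ker_def E.add_closed E.scale_closed)
    then show ?thesis
      unfolding E.coset_eq_iff[OF K v w] using E.add_neg_cancel[OF v w, symmetric] by (rule bexI[rotated])
  qed
  have bij: "bij_betw (induced_map T) (carrier ?Q) (carrier F)"
    unfolding bij_betw_def
  proof
    show "inj_on (induced_map T) (carrier ?Q)"
    proof (rule inj_onI)
      fix P R assume "P \<in> carrier ?Q" "R \<in> carrier ?Q" and eq: "induced_map T P = induced_map T R"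
      then obtain v w where "v \<in> carrier E" "P = coset E ?K v" "w \<in> carrier E" "R = coset E ?K w"
        unfolding q(3) by blast
      then show "P = R" using eq inj[of v w] by (simp add: ind)
    qed
    have "w \<in> induced_map T ` carrier ?Q" if w: "w \<in> carrier F" for w
    proof -
      obtain v where "v \<in> carrier E" "T v = w" using lift[OF w, of 1] by auto
      then show ?thesis unfolding q(3) image_image using ind by force
    qed
    then show "induced_map T ` carrier ?Q = carrier F" using lin by (auto simp: linear_map_def)
  qed
  have norm: "vnorm F (T v) = vnorm ?Q (coset E ?K v)" if v: "v \<in> carrier E" for v
  proof (rule antisym)
    have vQ: "vnorm ?Q (coset E ?K v) = (INF p\<in>coset E ?K v. vnorm E p)" by (simp add: quotient_space_def)
    have lower: "vnorm F (T v) \<le> vnorm E p" if p: "p \<in> coset E ?K v" for p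
      using contr[of p] TK[OF v p] E.coset_subset[OF K v] p by auto
    show "vnorm F (T v) \<le> vnorm ?Q (coset E ?K v)"
      unfolding vQ by (rule cINF_greatest) (use E.coset_refl[OF K v] lower in auto)
    have bb: "bdd_below (vnorm E ` coset E ?K v)" using lower by (intro bdd_belowI2)
    show "vnorm ?Q (coset E ?K v) \<le> vnorm F (T v)"
    proof (rule field_le_epsilon)
      fix e :: real assume e: "e > 0"
      obtain w where w: "w \<in> carrier E" "T w = T v" "vnorm E w \<le> vnorm F (T v) + e"
        using lift[OF Tc[OF v] e] by blast
      have "w \<in> coset E ?K v" using inj[OF w(1) v w(2)] E.coset_refl[OF K w(1)] by simp
      then have "(INF p\<in>coset E ?K v. vnorm E p) \<le> vnorm E w" by (rule cINF_lower[OF bb])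
      then show "vnorm ?Q (coset E ?K v) \<le> vnorm F (T v) + e" unfolding vQ using w(3) by simp
    qed
  qed
  show ?thesis
    unfolding isometric_isomorphism_def
    by (intro conjI lin bij) (auto simp: q(3) ind norm)
qed

section \<open>The spaces of a majorant as normed spaces\<close>

lemma C_rho_fun_seminormed:
  assumes Q: "prob_space Q" and \<rho>: "\<rho> \<in> majorants"
  shows "seminormed_vspace (C_rho_fun Q \<rho>)"
proof -
  interpret prob_space Q by fact
  let ?C = "C_rho_fun Q \<rho>"
  have ops: "vadd ?C f g = (\<lambda>x. f x + g x)" "vscale ?C c f = (\<lambda>x. c * f x)" "vzero ?C = (\<lambda>x. 0)" for f g c
    by (simp_all add: C_rho_fun_def)
  note rb = C_rho_bounded[OF Q \<rho>]
  have \<rho>0: "0 \<le> \<rho> (measure Q A)" for A by (rule majorant_nonneg[OF \<rho>]) simp_all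
  have zero: "rho_bounded Q \<rho> 0 (\<lambda>x. 0)"
    by (simp add: rho_bounded_def set_lebesgue_integral_def)
  have add: "rho_bounded Q \<rho> (a + b) (\<lambda>x. f x + g x)"
    if f: "rho_bounded Q \<rho> a f" and g: "rho_bounded Q \<rho> b g" for a b f g
    unfolding rho_bounded_def
  proof (intro conjI ballI)
    have i: "integrable Q f" "integrable Q g" using f g by (auto simp: rho_bounded_def)
    then show "integrable Q (\<lambda>x. f x + g x)" by simp
    fix A assume A: "A \<in> sets Q"
    have iA: "integrable Q (\<lambda>x. indicator A x *\<^sub>R norm (f x))" "integrable Q (\<lambda>x. indicator A x *\<^sub>R norm (g x))"
      "integrable Q (\<lambda>x. indicator A x *\<^sub>R norm (f x + g x))"
      by (intro integrable_mult_indicator A integrable_norm Bochner_Integration.integrable_add i)+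
    have "(LINT x:A|Q. norm (f x + g x)) \<le>
        (\<integral>x. indicator A x *\<^sub>R norm (f x) + indicator A x *\<^sub>R norm (g x) \<partial>Q)"
      unfolding set_lebesgue_integral_def
    proof (rule integral_mono[OF iA(3) Bochner_Integration.integrable_add[OF iA(1,2)]])
      show "indicator A x *\<^sub>R norm (f x + g x) \<le> indicator A x *\<^sub>R norm (f x) + indicator A x *\<^sub>R norm (g x)" for x
        using norm_triangle_ineq[of "f x" "g x"] by (simp add: indicator_def)
    qed
    also have "\<dots> = (LINT x:A|Q. norm (f x)) + (LINT x:A|Q. norm (g x))"
      using iA by (simp add: set_lebesgue_integral_def)
    also have "\<dots> \<le> a * \<rho> (measure Q A) + b * \<rho> (measure Q A)"
      using f g A by (intro add_mono) (auto simp: rho_bounded_def)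
    finally show "(LINT x:A|Q. norm (f x + g x)) \<le> (a + b) * \<rho> (measure Q A)"
      by (simp add: distrib_right)
  qed
  have scale: "rho_bounded Q \<rho> (norm c * a) (\<lambda>x. c * f x)" if f: "rho_bounded Q \<rho> a f" for c a f
    unfolding rho_bounded_def
  proof (intro conjI ballI)
    show "integrable Q (\<lambda>x. c * f x)" using f by (simp add: rho_bounded_def)
    fix A assume A: "A \<in> sets Q"
    have "(LINT x:A|Q. norm (c * f x)) = norm c * (LINT x:A|Q. norm (f x))"
      by (simp add: norm_mult)
    also have "\<dots> \<le> norm c * (a * \<rho> (measure Q A))"
      using f A by (intro mult_left_mono) (auto simp: rho_bounded_def)
    finally show "(LINT x:A|Q. norm (c * f x)) \<le> norm c * a * \<rho> (measure Q A)" by (simp add: mult.assoc)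
  qed
  have self: "rho_bounded Q \<rho> (vnorm ?C f) f" if "f \<in> carrier ?C" for f using that rb by blast
  have nn: "0 \<le> vnorm ?C f" if "f \<in> carrier ?C" for f
    by (rule rho_bounded_integral(2)[OF Q \<rho> self[OF that]])
  have scale_le: "vnorm ?C (vscale ?C c f) \<le> norm c * vnorm ?C f" "vscale ?C c f \<in> carrier ?C"
    if "f \<in> carrier ?C" for c f
    using scale[OF self[OF that], of c] rb by (auto simp: ops)
  show ?thesis
  proof
    fix f g h c d
    show "vzero ?C \<in> carrier ?C" using zero rb by (auto simp: ops)
    show "vadd ?C (vadd ?C f g) h = vadd ?C f (vadd ?C g h)" "vadd ?C f g = vadd ?C g f"
      "vadd ?C f (vzero ?C) = f" "vscale ?C c (vadd ?C f g) = vadd ?C (vscale ?C c f) (vscale ?C c g)"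
      "vscale ?C (c + d) f = vadd ?C (vscale ?C c f) (vscale ?C d f)"
      "vscale ?C c (vscale ?C d f) = vscale ?C (c * d) f" "vscale ?C 1 f = f" "vscale ?C 0 f = vzero ?C"
      by (simp_all add: ops algebra_simps)
    assume f: "f \<in> carrier ?C"
    show "0 \<le> vnorm ?C f" by (rule nn[OF f])
    show "vscale ?C c f \<in> carrier ?C" by (rule scale_le(2)[OF f])
    show "vnorm ?C (vscale ?C c f) = norm c * vnorm ?C f"
    proof (cases "c = 0")
      case True
      have "vnorm ?C (vzero ?C) \<le> 0" "vzero ?C \<in> carrier ?C" using zero rb by (auto simp: ops)
      then show ?thesis using nn[of "vzero ?C"] True by (simp add: ops)
    next
      case False
      have "vscale ?C (inverse c) (vscale ?C c f) = f" using False by (simp add: ops field_simps)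
      then have "vnorm ?C f \<le> norm (inverse c) * vnorm ?C (vscale ?C c f)"
        using scale_le(1)[OF scale_le(2)[OF f, of c], of "inverse c"] by simp
      then have "norm c * vnorm ?C f \<le> norm c * (norm (inverse c) * vnorm ?C (vscale ?C c f))"
        by (rule mult_left_mono) simp
      also have "\<dots> = vnorm ?C (vscale ?C c f)"
        using False by (simp add: norm_inverse)
      finally have "norm c * vnorm ?C f \<le> vnorm ?C (vscale ?C c f)" .
      with scale_le(1)[OF f, of c] show ?thesis by simp
    qed
    assume g: "g \<in> carrier ?C"
    have "rho_bounded Q \<rho> (vnorm ?C f + vnorm ?C g) (vadd ?C f g)"
      unfolding ops by (rule add[OF self[OF f] self[OF g]])
    then show "vadd ?C f g \<in> carrier ?C" "vnorm ?C (vadd ?C f g) \<le> vnorm ?C f + vnorm ?C g"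
      using rb by blast+
  qed
qed

lemma ae_zero_null:
  assumes Q: "prob_space Q" and \<rho>: "\<rho> \<in> majorants" and n: "n \<in> ae_zero Q \<rho>"
  shows "vnorm (C_rho_fun Q \<rho>) n = 0"
proof -
  interpret seminormed_vspace "C_rho_fun Q \<rho>" by (rule C_rho_fun_seminormed[OF Q \<rho>])
  have n': "n \<in> carrier (C_rho_fun Q \<rho>)" "AE x in Q. n x = 0" using n by (auto simp: ae_zero_def)
  have "(LINT x:A|Q. norm (n x)) = 0" for A
    unfolding set_lebesgue_integral_def
    by (rule integral_eq_zero_AE) (use n'(2) in \<open>eventually_elim, simp\<close>)
  then have "rho_bounded Q \<rho> 0 n"
    using n'(1) by (simp add: rho_bounded_def C_rho_fun_def)
  then have "vnorm (C_rho_fun Q \<rho>) n \<le> 0" using C_rho_bounded[OF Q \<rho>] by blast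
  then show ?thesis using norm_nonneg[OF n'(1)] by simp
qed

lemma ae_zero_subspace:
  assumes Q: "prob_space Q" and \<rho>: "\<rho> \<in> majorants"
  shows "vsubspace (C_rho_fun Q \<rho>) (ae_zero Q \<rho>)"
proof -
  interpret seminormed_vspace "C_rho_fun Q \<rho>" by (rule C_rho_fun_seminormed[OF Q \<rho>])
  have ops: "vadd (C_rho_fun Q \<rho>) f g = (\<lambda>x. f x + g x)" "vscale (C_rho_fun Q \<rho>) c f = (\<lambda>x. c * f x)"
    "vzero (C_rho_fun Q \<rho>) = (\<lambda>x. 0)" for f g c
    by (simp_all add: C_rho_fun_def)
  show ?thesis
    unfolding vsubspace_def
  proof (intro conjI ballI allI)
    show "ae_zero Q \<rho> \<subseteq> carrier (C_rho_fun Q \<rho>)" by (auto simp: ae_zero_def)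
    show "vzero (C_rho_fun Q \<rho>) \<in> ae_zero Q \<rho>" using zero_closed by (simp add: ae_zero_def ops)
    fix f assume f: "f \<in> ae_zero Q \<rho>"
    then show "vscale (C_rho_fun Q \<rho>) c f \<in> ae_zero Q \<rho>" for c
      using scale_closed[of f c] by (auto simp: ae_zero_def ops)
    fix g assume g: "g \<in> ae_zero Q \<rho>"
    have "AE x in Q. f x = 0" "AE x in Q. g x = 0" using f g by (auto simp: ae_zero_def)
    then have "AE x in Q. f x + g x = 0" by eventually_elim simp
    then show "vadd (C_rho_fun Q \<rho>) f g \<in> ae_zero Q \<rho>"
      using add_closed[of f g] f g by (auto simp: ae_zero_def ops)
  qed
qed

context
  fixes Q :: "'c measure" and \<rho>
  assumes Q: "prob_space Q" and \<rho>: "\<rho> \<in> majorants"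
begin

interpretation seminormed_vspace "C_rho_fun Q \<rho>" by (rule C_rho_fun_seminormed[OF Q \<rho>])

lemma C_rho_seminormed: "seminormed_vspace (C_rho Q \<rho>)"
  unfolding C_rho_def
  by (rule quotient_seminormed[OF ae_zero_subspace[OF Q \<rho>] ae_zero_null[OF Q \<rho>]])

lemma C_rho_carrier_eq: "carrier (C_rho Q \<rho>) = ae_class Q \<rho> ` carrier (C_rho_fun Q \<rho>)"
  by (simp add: C_rho_def ae_class_def[abs_def] quotient_space_def)

lemma C_rho_norm: "f \<in> carrier (C_rho_fun Q \<rho>) \<Longrightarrow> vnorm (C_rho Q \<rho>) (ae_class Q \<rho> f) = vnorm (C_rho_fun Q \<rho>) f"
  unfolding C_rho_def ae_class_def
  by (rule quotient_norm_null[OF ae_zero_subspace[OF Q \<rho>] ae_zero_null[OF Q \<rho>]])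

lemma C_rho_add:
  assumes "f \<in> carrier (C_rho_fun Q \<rho>)" "g \<in> carrier (C_rho_fun Q \<rho>)"
  shows "vadd (C_rho Q \<rho>) (ae_class Q \<rho> f) (ae_class Q \<rho> g) = ae_class Q \<rho> (\<lambda>x. f x + g x)"
  using quotient_add[OF ae_zero_subspace[OF Q \<rho>] assms]
  by (simp add: C_rho_def ae_class_def C_rho_fun_def)

lemma C_rho_scale:
  assumes "f \<in> carrier (C_rho_fun Q \<rho>)"
  shows "vscale (C_rho Q \<rho>) c (ae_class Q \<rho> f) = ae_class Q \<rho> (\<lambda>x. c * f x)"
  using quotient_scale[OF ae_zero_subspace[OF Q \<rho>] assms]
  by (simp add: C_rho_def ae_class_def C_rho_fun_def)

lemma C_rho_zero: "vzero (C_rho Q \<rho>) = ae_class Q \<rho> (\<lambda>x. 0)"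
  using quotient_zero[OF ae_zero_subspace[OF Q \<rho>]]
  by (simp add: C_rho_def ae_class_def C_rho_fun_def)

lemma ae_class_eq_iff:
  assumes f: "f \<in> carrier (C_rho_fun Q \<rho>)" and g: "g \<in> carrier (C_rho_fun Q \<rho>)"
  shows "ae_class Q \<rho> f = ae_class Q \<rho> g \<longleftrightarrow> (AE x in Q. f x = g x)"
proof -
  have add: "vadd (C_rho_fun Q \<rho>) f n = (\<lambda>x. f x + n x)" for n by (simp add: C_rho_fun_def)
  have "ae_class Q \<rho> f = ae_class Q \<rho> g \<longleftrightarrow> (\<exists>n\<in>ae_zero Q \<rho>. g = (\<lambda>x. f x + n x))"
    unfolding ae_class_def coset_eq_iff[OF ae_zero_subspace[OF Q \<rho>] f g] add ..
  also have "\<dots> \<longleftrightarrow> (AE x in Q. f x = g x)"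
  proof
    assume "\<exists>n\<in>ae_zero Q \<rho>. g = (\<lambda>x. f x + n x)"
    then obtain n where n: "AE x in Q. n x = 0" "g = (\<lambda>x. f x + n x)" by (auto simp: ae_zero_def)
    show "AE x in Q. f x = g x" using n(1) by eventually_elim (simp add: n(2))
  next
    assume ae: "AE x in Q. f x = g x"
    define n where "n = (\<lambda>x. g x + (- 1) * f x)"
    have "n \<in> carrier (C_rho_fun Q \<rho>)"
      using add_closed[OF g scale_closed[OF f, of "-1"]] by (simp add: n_def C_rho_fun_def)
    moreover have "AE x in Q. n x = 0" using ae by eventually_elim (simp add: n_def)
    ultimately have "n \<in> ae_zero Q \<rho>" by (simp add: ae_zero_def)
    then show "\<exists>n\<in>ae_zero Q \<rho>. g = (\<lambda>x. f x + n x)" by (rule bexI[rotated]) (simp add: n_def)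
  qed
  finally show ?thesis .
qed

lemma class_integral_ae_class:
  assumes f: "f \<in> carrier (C_rho_fun Q \<rho>)"
  shows "class_integral Q (ae_class Q \<rho> f) = integral\<^sup>L Q f"
proof -
  have "integral\<^sup>L Q h = integral\<^sup>L Q f" if h: "h \<in> ae_class Q \<rho> f" for h
  proof -
    have hc: "h \<in> carrier (C_rho_fun Q \<rho>)"
      using coset_subset[OF ae_zero_subspace[OF Q \<rho>] f] h by (auto simp: ae_class_def)
    have "ae_class Q \<rho> h = ae_class Q \<rho> f"
      using coset_eqI[OF ae_zero_subspace[OF Q \<rho>] f] h by (simp add: ae_class_def)
    then have "AE x in Q. h x = f x" using ae_class_eq_iff[OF hc f] by simp
    then show ?thesis
      by (rule integral_cong_AE[rotated 2]) (use hc f in \<open>auto simp: C_rho_fun_def\<close>)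
  qed
  moreover have "f \<in> ae_class Q \<rho> f"
    unfolding ae_class_def by (rule coset_refl[OF ae_zero_subspace[OF Q \<rho>] f])
  ultimately have "(\<lambda>h. integral\<^sup>L Q h) ` ae_class Q \<rho> f = {integral\<^sup>L Q f}" by blast
  then show ?thesis by (simp add: class_integral_def)
qed

end

context prob_ultraproduct
begin

section \<open>The operator on the ultralimit of Banach spaces\<close>

lemma represents_ulimI:
  fixes g :: "('i \<Rightarrow> 'a) set \<Rightarrow> complex"
  assumes "ulim_AE f g"
  shows "represents_ulim U M f g"
proof -
  have fun_eq: "ereal a = ulim_fun U h \<xi>"
    if lim: "\<And>x. x \<in> \<xi> \<Longrightarrow> ((\<lambda>i. h i (x i)) \<longlongrightarrow> a) U" and \<xi>: "\<xi> \<in> space N"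
    for h :: "'i \<Rightarrow> 'a \<Rightarrow> real" and a \<xi>
  proof -
    have "Lim U (\<lambda>i. ereal (h i (x i))) = ereal a" if "x \<in> \<xi>" for x
      by (rule tendsto_Lim[OF U_nonbot]) (simp add: lim[OF that])
    then have "(\<lambda>x. Lim U (\<lambda>i. ereal (h i (x i)))) ` \<xi> = (\<lambda>x. ereal a) ` \<xi>"
      by (intro image_cong refl)
    also have "\<dots> = {ereal a}" using nonempty_N[OF \<xi>] by blast
    finally have "(\<lambda>x. Lim U (\<lambda>i. ereal (h i (x i)))) ` \<xi> = {ereal a}" .
    then show ?thesis by (simp add: ulim_fun_def)
  qed
  have "AE \<xi> in N. \<xi> \<in> space N" by simp
  with assms[unfolded ulim_AE_def] show ?thesis
    unfolding represents_ulim_def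
  proof eventually_elim
    case (elim \<xi>)
    have "((\<lambda>i. Re (f i (x i))) \<longlongrightarrow> Re (g \<xi>)) U" "((\<lambda>i. Im (f i (x i))) \<longlongrightarrow> Im (g \<xi>)) U"
      if "x \<in> \<xi>" for x
      using elim(1) that by (auto intro: tendsto_Re tendsto_Im)
    then show ?case using elim(2) by (intro conjI fun_eq)
  qed
qed

lemma ulim_integral_norm:
  assumes f: "unif_integrable f" and fg: "ulim_AE f g" and g: "g \<in> borel_measurable N"
  shows "((\<lambda>i. \<integral>x. norm (f i x) \<partial>M i) \<longlongrightarrow> (\<integral>\<xi>. norm (g \<xi>) \<partial>N)) U"
proof -
  have gi: "integrable N g" by (rule ulim_integral(1)[OF f fg g])
  have fi: "integrable (M i) (f i)" for i using f by (simp add: unif_integrable_def)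
  have "(\<lambda>i. space (M i)) \<in> internal" by (simp add: internal_def)
  from ulim_set_integral_norm[OF f fg g this] show ?thesis
    unfolding ulim_set_space space_N[symmetric]
    by (simp add: set_integral_space fi gi)
qed

context
  fixes \<rho> assumes \<rho>: "\<rho> \<in> majorants"
begin

text \<open>
  The factors, their ultralimit, and the target space.
\<close>

abbreviation "B \<equiv> \<lambda>i. C_rho (M i) \<rho>"
abbreviation "BU \<equiv> ulim_space U B"
abbreviation "CN \<equiv> C_rho N \<rho>"

lemma B_seminormed: "seminormed_vspace (B i)" by (rule C_rho_seminormed[OF prob \<rho>])
lemma CN_seminormed: "seminormed_vspace CN" by (rule C_rho_seminormed[OF prob_space_N \<rho>])

interpretation L: vspace "linf_space B" by (rule linf_vspace[OF B_seminormed])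

lemmas null_sub = null_families_subspace[OF B_seminormed, where U = U]

lemma BU_vspace: "vspace BU"
  unfolding ulim_space_def by (rule L.quotient_vspace[OF null_sub])

lemma bounded_families_iff:
  "f \<in> bounded_families M \<rho> \<longleftrightarrow> (\<exists>K. \<forall>i. rho_bounded (M i) \<rho> K (f i))"
proof
  assume "f \<in> bounded_families M \<rho>"
  then have f: "\<And>i. f i \<in> carrier (C_rho_fun (M i) \<rho>)"
    "bdd_above (range (\<lambda>i. vnorm (B i) (ae_class (M i) \<rho> (f i))))"
    by (simp_all add: bounded_families_def linf_space_def)
  obtain K where "\<And>i. vnorm (B i) (ae_class (M i) \<rho> (f i)) \<le> K" using f(2) by (auto simp: bdd_above_def)
  then have "rho_bounded (M i) \<rho> K (f i)" for i
    using f(1) by (simp add: C_rho_bounded[OF prob \<rho>] C_rho_norm[OF prob \<rho>])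
  then show "\<exists>K. \<forall>i. rho_bounded (M i) \<rho> K (f i)" by blast
next
  assume "\<exists>K. \<forall>i. rho_bounded (M i) \<rho> K (f i)"
  then obtain K where K: "\<And>i. f i \<in> carrier (C_rho_fun (M i) \<rho>)" "\<And>i. vnorm (C_rho_fun (M i) \<rho>) (f i) \<le> K"
    by (auto simp: C_rho_bounded[OF prob \<rho>])
  have "bdd_above (range (\<lambda>i. vnorm (B i) (ae_class (M i) \<rho> (f i))))"
    using K by (intro bdd_aboveI[of _ K]) (auto simp: C_rho_norm[OF prob \<rho>])
  then show "f \<in> bounded_families M \<rho>"
    using K(1) by (simp add: bounded_families_def linf_space_def C_rho_carrier_eq[OF prob \<rho>])
qed

lemma bounded_carrier:
  assumes "f \<in> bounded_families M \<rho>"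
  shows "f i \<in> carrier (C_rho_fun (M i) \<rho>)" "(\<lambda>i. ae_class (M i) \<rho> (f i)) \<in> carrier (linf_space B)"
  using assms by (simp_all add: bounded_families_def)

lemma linf_carrier_ae_class:
  assumes "v \<in> carrier (linf_space B)"
  shows "\<exists>f\<in>bounded_families M \<rho>. v = (\<lambda>i. ae_class (M i) \<rho> (f i))"
proof -
  have "\<forall>i. \<exists>f. f \<in> carrier (C_rho_fun (M i) \<rho>) \<and> v i = ae_class (M i) \<rho> f"
    using assms by (auto simp: linf_space_def C_rho_carrier_eq[OF prob \<rho>])
  from choice[OF this] obtain f where f: "\<And>i. f i \<in> carrier (C_rho_fun (M i) \<rho>)" "\<And>i. v i = ae_class (M i) \<rho> (f i)"
    by blast
  have "v = (\<lambda>i. ae_class (M i) \<rho> (f i))" using f(2) by blast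
  then show ?thesis using f(1) assms by (auto simp: bounded_families_def)
qed

lemma BU_carrier: "carrier BU = ulim_class U M \<rho> ` bounded_families M \<rho>"
proof -
  have "carrier (linf_space B) = (\<lambda>f i. ae_class (M i) \<rho> (f i)) ` bounded_families M \<rho>"
    using linf_carrier_ae_class bounded_carrier(2) by blast
  then show ?thesis
    by (simp add: ulim_space_def L.quotient_carrier[OF null_sub] ulim_class_def[abs_def] image_image)
qed

lemma bounded_add:
  assumes "f \<in> bounded_families M \<rho>" "f' \<in> bounded_families M \<rho>"
  shows "(\<lambda>i x. f i x + f' i x) \<in> bounded_families M \<rho>"
    "vadd BU (ulim_class U M \<rho> f) (ulim_class U M \<rho> f') = ulim_class U M \<rho> (\<lambda>i x. f i x + f' i x)"
proof -
  note c = bounded_carrier[OF assms(1)] bounded_carrier[OF assms(2)]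
  have eq: "vadd (linf_space B) (\<lambda>i. ae_class (M i) \<rho> (f i)) (\<lambda>i. ae_class (M i) \<rho> (f' i)) =
      (\<lambda>i. ae_class (M i) \<rho> (\<lambda>x. f i x + f' i x))"
    using C_rho_add[OF prob \<rho> c(1) c(3)] by (simp add: linf_space_def)
  have "(\<lambda>x. f i x + f' i x) \<in> carrier (C_rho_fun (M i) \<rho>)" for i
    using vspace.add_closed[OF seminormed_vspace.axioms(1)[OF C_rho_fun_seminormed[OF prob \<rho>]] c(1) c(3)]
    by (simp add: C_rho_fun_def)
  then show "(\<lambda>i x. f i x + f' i x) \<in> bounded_families M \<rho>"
    using L.add_closed[OF c(2) c(4)] by (simp add: bounded_families_def eq)
  show "vadd BU (ulim_class U M \<rho> f) (ulim_class U M \<rho> f') = ulim_class U M \<rho> (\<lambda>i x. f i x + f' i x)"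
    unfolding ulim_space_def ulim_class_def L.quotient_add[OF null_sub c(2) c(4)] eq ..
qed

lemma bounded_scale:
  assumes "f \<in> bounded_families M \<rho>"
  shows "(\<lambda>i x. c * f i x) \<in> bounded_families M \<rho>"
    "vscale BU c (ulim_class U M \<rho> f) = ulim_class U M \<rho> (\<lambda>i x. c * f i x)"
proof -
  note b = bounded_carrier[OF assms]
  have eq: "vscale (linf_space B) c (\<lambda>i. ae_class (M i) \<rho> (f i)) = (\<lambda>i. ae_class (M i) \<rho> (\<lambda>x. c * f i x))"
    using C_rho_scale[OF prob \<rho> b(1)] by (simp add: linf_space_def)
  have "(\<lambda>x. c * f i x) \<in> carrier (C_rho_fun (M i) \<rho>)" for i
    using vspace.scale_closed[OF seminormed_vspace.axioms(1)[OF C_rho_fun_seminormed[OF prob \<rho>]] b(1)]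
    by (simp add: C_rho_fun_def)
  then show "(\<lambda>i x. c * f i x) \<in> bounded_families M \<rho>"
    using L.scale_closed[OF b(2), of c] by (simp add: bounded_families_def eq)
  show "vscale BU c (ulim_class U M \<rho> f) = ulim_class U M \<rho> (\<lambda>i x. c * f i x)"
    unfolding ulim_space_def ulim_class_def L.quotient_scale[OF null_sub b(2)] eq ..
qed

lemma bounded_families_unif_integrable:
  assumes "f \<in> bounded_families M \<rho>" shows "unif_integrable f"
  using assms unif_integrable_rho[OF \<rho>] by (auto simp: bounded_families_iff)

lemma bounded_ulim_exists:
  assumes "f \<in> bounded_families M \<rho>"
  shows "\<exists>g. g \<in> borel_measurable N \<and> ulim_AE f g"
proof -
  obtain K where K: "\<And>i. rho_bounded (M i) \<rho> K (f i)" using assms by (auto simp: bounded_families_iff)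
  have "(\<integral>x. norm (f i x) \<partial>M i) \<le> K" for i by (rule rho_bounded_integral(1)[OF prob \<rho> K])
  then show ?thesis
    by (intro ulim_AE_exists[where K = K] rho_bounded_integrable[OF K] always_eventually) blast
qed

lemma ulim_carrier:
  assumes "f \<in> bounded_families M \<rho>" "ulim_AE f g" "g \<in> borel_measurable N"
  shows "g \<in> carrier (C_rho_fun N \<rho>)"
  using assms ulim_rho_bounded[OF \<rho>] C_rho_bounded[OF prob_space_N \<rho>]
  by (auto simp: bounded_families_iff)

text \<open>
  Families with the same class differ by a family of functions whose norms, and hence
  whose \<open>L\<^sup>1\<close> norms, tend to \<open>0\<close>; so their ultralimits agree almost everywhere and \<open>\<Phi>\<close> is well defined.
\<close>

lemma ulim_class_eq_imp:
  assumes f: "f \<in> bounded_families M \<rho>" and f': "f' \<in> bounded_families M \<rho>"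
    and eq: "ulim_class U M \<rho> f = ulim_class U M \<rho> f'"
  shows "((\<lambda>i. \<integral>x. norm (f' i x - f i x) \<partial>M i) \<longlongrightarrow> 0) U"
proof -
  note c = bounded_carrier[OF f] bounded_carrier[OF f']
  have "\<exists>n\<in>null_families U B. (\<lambda>i. ae_class (M i) \<rho> (f' i)) =
      vadd (linf_space B) (\<lambda>i. ae_class (M i) \<rho> (f i)) n"
    using eq unfolding ulim_class_def L.coset_eq_iff[OF null_sub c(2) c(4)] .
  then obtain n where n: "n \<in> null_families U B"
    "(\<lambda>i. ae_class (M i) \<rho> (f' i)) = vadd (linf_space B) (\<lambda>i. ae_class (M i) \<rho> (f i)) n" by blast
  have nl: "n \<in> carrier (linf_space B)" "((\<lambda>i. vnorm (B i) (n i)) \<longlongrightarrow> 0) U"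
    using n(1) by (simp_all add: null_families_def)
  obtain h where h: "h \<in> bounded_families M \<rho>" "n = (\<lambda>i. ae_class (M i) \<rho> (h i))"
    using linf_carrier_ae_class[OF nl(1)] by blast
  note hc = bounded_carrier(1)[OF h(1)]
  have le: "(\<integral>x. norm (f' i x - f i x) \<partial>M i) \<le> vnorm (B i) (n i)" for i
  proof -
    have sum: "(\<lambda>x. f i x + h i x) \<in> carrier (C_rho_fun (M i) \<rho>)"
      using bounded_carrier(1)[OF bounded_add(1)[OF f h(1)]] .
    have "ae_class (M i) \<rho> (f' i) = ae_class (M i) \<rho> (\<lambda>x. f i x + h i x)"
      using fun_cong[OF n(2), of i] C_rho_add[OF prob \<rho> c(1) hc, of i] by (simp add: linf_space_def h(2))
    then have ae: "AE x in M i. f' i x = f i x + h i x"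
      by (simp add: ae_class_eq_iff[OF prob \<rho> c(3) sum])
    have m: "f i \<in> borel_measurable (M i)" "f' i \<in> borel_measurable (M i)" "h i \<in> borel_measurable (M i)"
      using c(1)[of i] c(3)[of i] hc[of i] by (auto simp: C_rho_fun_def)
    have "(\<integral>x. norm (f' i x - f i x) \<partial>M i) = (\<integral>x. norm (h i x) \<partial>M i)"
    proof (rule integral_cong_AE)
      show "AE x in M i. norm (f' i x - f i x) = norm (h i x)" using ae by eventually_elim simp
    qed (use m in simp_all)
    also have "\<dots> \<le> vnorm (C_rho_fun (M i) \<rho>) (h i)"
      by (rule rho_bounded_integral(1)[OF prob \<rho>]) (simp add: C_rho_bounded[OF prob \<rho>] hc)
    also have "\<dots> = vnorm (B i) (n i)" by (simp add: h(2) C_rho_norm[OF prob \<rho> hc])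
    finally show ?thesis .
  qed
  show ?thesis
    by (rule tendsto_sandwich[OF _ _ tendsto_const nl(2)]) (simp_all add: le)
qed

lemma ulim_class_eq_imp_AE:
  assumes f: "f \<in> bounded_families M \<rho>" and f': "f' \<in> bounded_families M \<rho>"
    and eq: "ulim_class U M \<rho> f = ulim_class U M \<rho> f'"
    and g: "ulim_AE f g" "g \<in> borel_measurable N" and g': "ulim_AE f' g'" "g' \<in> borel_measurable N"
  shows "AE \<xi> in N. g \<xi> = g' \<xi>"
proof -
  have i: "integrable (M i) (f i)" "integrable (M i) (f' i)" for i
    using bounded_families_unif_integrable[OF f] bounded_families_unif_integrable[OF f'] by (simp_all add: unif_integrable_def)
  have I: "integrable N (\<lambda>\<xi>. g' \<xi> - g \<xi>)"
    using ulim_integral(1)[OF bounded_families_unif_integrable[OF f] g] ulim_integral(1)[OF bounded_families_unif_integrable[OF f'] g']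
    by simp
  have "(\<integral>\<xi>. norm (g' \<xi> - g \<xi>) \<partial>N) \<le> 0 + e" if e: "e > 0" for e
  proof (rule ulim_Fatou(2)[OF _ _ ulim_AE_diff[OF g'(1) g(1)]])
    show "integrable (M i) (\<lambda>x. f' i x - f i x)" for i using i by simp
    show "eventually (\<lambda>i. (\<integral>x. norm (f' i x - f i x) \<partial>M i) \<le> 0 + e) U"
      using order_tendstoD(2)[OF ulim_class_eq_imp[OF f f' eq] e] by eventually_elim simp
    show "(\<lambda>\<xi>. g' \<xi> - g \<xi>) \<in> borel_measurable N" using g(2) g'(2) by simp
  qed
  then have "(\<integral>\<xi>. norm (g' \<xi> - g \<xi>) \<partial>N) \<le> 0" by (rule field_le_epsilon)
  then have "(\<integral>\<xi>. norm (g' \<xi> - g \<xi>) \<partial>N) = 0" by (simp add: antisym)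
  then have "AE \<xi> in N. norm (g' \<xi> - g \<xi>) = 0"
    using I by (subst (asm) integral_nonneg_eq_0_iff_AE) auto
  then show ?thesis by eventually_elim simp
qed

text \<open>
  The operator, by a choice of a representing family and of its ultralimit; \<open>\<Phi>_eq\<close> shows that the
  choice is irrelevant.
\<close>

definition \<Phi> :: "('i \<Rightarrow> ('a \<Rightarrow> complex) set) set \<Rightarrow> (('i \<Rightarrow> 'a) set \<Rightarrow> complex) set" where
  "\<Phi> P = (SOME G. \<exists>f\<in>bounded_families M \<rho>. \<exists>g\<in>borel_measurable N.
    ulim_class U M \<rho> f = P \<and> ulim_AE f g \<and> G = ae_class N \<rho> g)"

lemma \<Phi>_eq:
  assumes f: "f \<in> bounded_families M \<rho>" and fg: "ulim_AE f g" and g: "g \<in> borel_measurable N"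
  shows "\<Phi> (ulim_class U M \<rho> f) = ae_class N \<rho> g"
proof -
  have "\<exists>f'\<in>bounded_families M \<rho>. \<exists>g'\<in>borel_measurable N.
    ulim_class U M \<rho> f' = ulim_class U M \<rho> f \<and> ulim_AE f' g' \<and> \<Phi> (ulim_class U M \<rho> f) = ae_class N \<rho> g'"
    unfolding \<Phi>_def
    by (rule someI[of _ "ae_class N \<rho> g"]) (use assms in blast)
  then obtain f' g' where f': "f' \<in> bounded_families M \<rho>" and g': "g' \<in> borel_measurable N" "ulim_AE f' g'"
    and eq: "ulim_class U M \<rho> f' = ulim_class U M \<rho> f" and \<Phi>: "\<Phi> (ulim_class U M \<rho> f) = ae_class N \<rho> g'"
    by blast
  have "AE \<xi> in N. g' \<xi> = g \<xi>" by (rule ulim_class_eq_imp_AE[OF f' f eq g'(2,1) fg g])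
  then show ?thesis
    unfolding \<Phi> using ae_class_eq_iff[OF prob_space_N \<rho> ulim_carrier[OF f' g'(2,1)] ulim_carrier[OF f fg g]] by simp
qed

lemma \<Phi>_obtain:
  assumes "f \<in> bounded_families M \<rho>"
  obtains g where "g \<in> borel_measurable N" "ulim_AE f g" "g \<in> carrier (C_rho_fun N \<rho>)"
    "\<Phi> (ulim_class U M \<rho> f) = ae_class N \<rho> g"
  using bounded_ulim_exists[OF assms] ulim_carrier[OF assms] \<Phi>_eq[OF assms] by metis

lemma \<Phi>_linear: "linear_map BU CN \<Phi>"
  unfolding linear_map_def BU_carrier
proof (intro conjI ballI allI; elim imageE)
  fix P f assume f: "P = ulim_class U M \<rho> f" "f \<in> bounded_families M \<rho>"
  obtain g where g: "g \<in> borel_measurable N" "ulim_AE f g" "g \<in> carrier (C_rho_fun N \<rho>)" "\<Phi> P = ae_class N \<rho> g"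
    using \<Phi>_obtain[OF f(2)] f(1) by metis
  show "\<Phi> P \<in> carrier CN" using g by (simp add: C_rho_carrier_eq[OF prob_space_N \<rho>])
  fix c
  have "ulim_AE (\<lambda>i x. c * f i x) (\<lambda>\<xi>. c * g \<xi>)"
    by (rule ulim_AE_mult[OF ulim_AE_const g(2)])
  moreover have "(\<lambda>\<xi>. c * g \<xi>) \<in> borel_measurable N" using g(1) by simp
  ultimately have "\<Phi> (vscale BU c P) = ae_class N \<rho> (\<lambda>\<xi>. c * g \<xi>)"
    unfolding f(1) bounded_scale(2)[OF f(2)] by (rule \<Phi>_eq[OF bounded_scale(1)[OF f(2)]])
  then show "\<Phi> (vscale BU c P) = vscale CN c (\<Phi> P)"
    by (simp add: g(4) C_rho_scale[OF prob_space_N \<rho> g(3)])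
next
  fix P Q f f'
  assume f: "P = ulim_class U M \<rho> f" "f \<in> bounded_families M \<rho>"
    and f': "Q = ulim_class U M \<rho> f'" "f' \<in> bounded_families M \<rho>"
  obtain g where g: "g \<in> borel_measurable N" "ulim_AE f g" "g \<in> carrier (C_rho_fun N \<rho>)" "\<Phi> P = ae_class N \<rho> g"
    using \<Phi>_obtain[OF f(2)] f(1) by metis
  obtain g' where g': "g' \<in> borel_measurable N" "ulim_AE f' g'" "g' \<in> carrier (C_rho_fun N \<rho>)" "\<Phi> Q = ae_class N \<rho> g'"
    using \<Phi>_obtain[OF f'(2)] f'(1) by metis
  have "(\<lambda>\<xi>. g \<xi> + g' \<xi>) \<in> borel_measurable N" using g(1) g'(1) by simp
  with ulim_AE_add[OF g(2) g'(2)] have "\<Phi> (vadd BU P Q) = ae_class N \<rho> (\<lambda>\<xi>. g \<xi> + g' \<xi>)"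
    unfolding f(1) f'(1) bounded_add(2)[OF f(2) f'(2)] by (rule \<Phi>_eq[OF bounded_add(1)[OF f(2) f'(2)]])
  then show "\<Phi> (vadd BU P Q) = vadd CN (\<Phi> P) (\<Phi> Q)"
    by (simp add: g(4) g'(4) C_rho_add[OF prob_space_N \<rho> g(3) g'(3)])
qed

text \<open>
  Each member \<open>p\<close> of a class is itself the family of almost everywhere classes of some representing
  family, whose norm bound passes to the ultralimit by \<open>ulim_rho_bounded\<close>.
\<close>

lemma BU_norm_lower:
  assumes f: "f \<in> bounded_families M \<rho>" and p: "p \<in> ulim_class U M \<rho> f"
  shows "vnorm CN (\<Phi> (ulim_class U M \<rho> f)) \<le> vnorm (linf_space B) p"
proof -
  note c = bounded_carrier[OF f]
  have pc: "p \<in> carrier (linf_space B)"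
    using L.coset_subset[OF null_sub c(2)] p by (auto simp: ulim_class_def)
  obtain h where h: "h \<in> bounded_families M \<rho>" "p = (\<lambda>i. ae_class (M i) \<rho> (h i))"
    using linf_carrier_ae_class[OF pc] by blast
  have "ulim_class U M \<rho> h = ulim_class U M \<rho> f"
    using L.coset_eqI[OF null_sub c(2), of p] p by (simp add: ulim_class_def h(2))
  then obtain g where g: "g \<in> borel_measurable N" "ulim_AE h g" "g \<in> carrier (C_rho_fun N \<rho>)"
    "\<Phi> (ulim_class U M \<rho> f) = ae_class N \<rho> g"
    using \<Phi>_obtain[OF h(1)] by metis
  let ?K = "vnorm (linf_space B) p"
  have "rho_bounded (M i) \<rho> ?K (h i)" for i
  proof -
    have "vnorm (B i) (p i) \<le> ?K"
      using pc cSUP_upper[of i UNIV "\<lambda>i. vnorm (B i) (p i)"] by (simp add: linf_space_def)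
    then show ?thesis
      using bounded_carrier(1)[OF h(1), of i]
      by (simp add: h(2) C_rho_norm[OF prob \<rho>] C_rho_bounded[OF prob \<rho>])
  qed
  then have "rho_bounded N \<rho> ?K g" by (rule ulim_rho_bounded[OF \<rho> _ g(2,1)])
  then have "vnorm (C_rho_fun N \<rho>) g \<le> ?K" by (simp add: C_rho_bounded[OF prob_space_N \<rho>])
  then show ?thesis by (simp add: g(4) C_rho_norm[OF prob_space_N \<rho> g(3)])
qed

lemma BU_norm: "vnorm BU P = (INF p\<in>P. vnorm (linf_space B) p)"
  by (simp add: ulim_space_def quotient_space_def)

lemma ulim_class_self:
  "f \<in> bounded_families M \<rho> \<Longrightarrow> (\<lambda>i. ae_class (M i) \<rho> (f i)) \<in> ulim_class U M \<rho> f"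
  unfolding ulim_class_def by (rule L.coset_refl[OF null_sub bounded_carrier(2)])

lemma \<Phi>_contraction:
  assumes "P \<in> carrier BU" shows "vnorm CN (\<Phi> P) \<le> vnorm BU P"
proof -
  obtain f where f: "f \<in> bounded_families M \<rho>" "P = ulim_class U M \<rho> f"
    using assms by (auto simp: BU_carrier)
  show ?thesis
    unfolding BU_norm f(2)
    by (rule cINF_greatest[OF _ BU_norm_lower[OF f(1)]]) (use ulim_class_self[OF f(1)] in blast)
qed

lemma \<Phi>_lift:
  assumes "G \<in> carrier CN" and e: "e > 0"
  shows "\<exists>P\<in>carrier BU. \<Phi> P = G \<and> vnorm BU P \<le> vnorm CN G + e"
proof -
  obtain g where g: "g \<in> carrier (C_rho_fun N \<rho>)" "G = ae_class N \<rho> g"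
    using assms(1) by (auto simp: C_rho_carrier_eq[OF prob_space_N \<rho>])
  let ?c = "vnorm (C_rho_fun N \<rho>) g"
  have G: "vnorm CN G = ?c" by (simp add: g(2) C_rho_norm[OF prob_space_N \<rho> g(1)])
  have "rho_bounded N \<rho> ?c g" using g(1) by (simp add: C_rho_bounded[OF prob_space_N \<rho>])
  from rho_bounded_lift[OF \<rho> this e] obtain f where f: "\<And>i. rho_bounded (M i) \<rho> (?c + e) (f i)" "ulim_AE f g" by blast
  have fb: "f \<in> bounded_families M \<rho>" using f(1) bounded_families_iff by blast
  have gm: "g \<in> borel_measurable N" using g(1) by (auto simp: C_rho_fun_def)
  let ?P = "ulim_class U M \<rho> f" and ?p = "\<lambda>i. ae_class (M i) \<rho> (f i)"
  have "bdd_below (vnorm (linf_space B) ` ?P)"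
    using BU_norm_lower[OF fb] by (intro bdd_belowI2)
  then have "vnorm BU ?P \<le> vnorm (linf_space B) ?p"
    unfolding BU_norm by (rule cINF_lower[OF _ ulim_class_self[OF fb]])
  also have "\<dots> = (SUP i. vnorm (B i) (?p i))" by (simp add: linf_space_def)
  also have "\<dots> \<le> ?c + e"
  proof (rule cSUP_least)
    fix i
    show "vnorm (B i) (?p i) \<le> ?c + e"
      using f(1)[of i] bounded_carrier(1)[OF fb, of i] by (simp add: C_rho_norm[OF prob \<rho>] C_rho_bounded[OF prob \<rho>])
  qed simp
  finally have "vnorm BU ?P \<le> vnorm CN G + e" using G by simp
  moreover have "?P \<in> carrier BU" using fb by (simp add: BU_carrier)
  moreover have "\<Phi> ?P = G" unfolding g(2) by (rule \<Phi>_eq[OF fb f(2) gm])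
  ultimately show ?thesis by blast
qed

lemma \<Phi>_continuous: "continuous_linear_map BU CN \<Phi>"
  unfolding continuous_linear_map_def
  using \<Phi>_linear \<Phi>_contraction by (intro conjI exI[of _ 1]) simp_all

lemma \<Phi>_op_norm: "op_norm BU CN \<Phi> \<le> 1"
proof -
  interpret C: seminormed_vspace CN by (rule CN_seminormed)
  obtain P where "P \<in> carrier BU" "vnorm BU P \<le> vnorm CN (vzero CN) + 1"
    using \<Phi>_lift[OF C.zero_closed, of 1] by auto
  then have ne: "{P \<in> carrier BU. vnorm BU P \<le> 1} \<noteq> {}" using C.norm_zero by auto
  show ?thesis
    unfolding op_norm_def
    by (rule cSUP_least[OF ne]) (use \<Phi>_contraction order_trans in blast)
qed

lemma \<Phi>_integral:
  assumes f: "f \<in> bounded_families M \<rho>"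
  shows "((\<lambda>i. \<integral>x. f i x \<partial>M i) \<longlongrightarrow> class_integral N (\<Phi> (ulim_class U M \<rho> f))) U"
proof -
  obtain g where g: "g \<in> borel_measurable N" "ulim_AE f g" "g \<in> carrier (C_rho_fun N \<rho>)"
    "\<Phi> (ulim_class U M \<rho> f) = ae_class N \<rho> g" using \<Phi>_obtain[OF f] .
  show ?thesis
    unfolding g(4) class_integral_ae_class[OF prob_space_N \<rho> g(3)]
    by (rule ulim_integral(2)[OF bounded_families_unif_integrable[OF f] g(2,1)])
qed

lemma \<Phi>_ker:
  "ker BU CN \<Phi> = {ulim_class U M \<rho> f | f. f \<in> bounded_families M \<rho> \<and>
    ((\<lambda>i. \<integral>x. norm (f i x) \<partial>M i) \<longlongrightarrow> 0) U}"
proof -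
  have "\<Phi> (ulim_class U M \<rho> f) = vzero CN \<longleftrightarrow> ((\<lambda>i. \<integral>x. norm (f i x) \<partial>M i) \<longlongrightarrow> 0) U"
    if f: "f \<in> bounded_families M \<rho>" for f
  proof -
    obtain g where g: "g \<in> borel_measurable N" "ulim_AE f g" "g \<in> carrier (C_rho_fun N \<rho>)"
      "\<Phi> (ulim_class U M \<rho> f) = ae_class N \<rho> g" using \<Phi>_obtain[OF f] .
    have gi: "integrable N g" using g(3) by (simp add: C_rho_fun_def)
    have lim: "((\<lambda>i. \<integral>x. norm (f i x) \<partial>M i) \<longlongrightarrow> (\<integral>\<xi>. norm (g \<xi>) \<partial>N)) U"
      by (rule ulim_integral_norm[OF bounded_families_unif_integrable[OF f] g(2,1)])
    have z: "(\<lambda>\<xi>. 0) \<in> carrier (C_rho_fun N \<rho>)"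
      using vspace.zero_closed[OF seminormed_vspace.axioms(1)[OF C_rho_fun_seminormed[OF prob_space_N \<rho>]]]
      by (simp add: C_rho_fun_def)
    have "\<Phi> (ulim_class U M \<rho> f) = vzero CN \<longleftrightarrow> (AE \<xi> in N. g \<xi> = 0)"
      unfolding g(4) C_rho_zero[OF prob_space_N \<rho>] ae_class_eq_iff[OF prob_space_N \<rho> g(3) z] ..
    also have "\<dots> \<longleftrightarrow> (\<integral>\<xi>. norm (g \<xi>) \<partial>N) = 0"
      using gi by (subst integral_nonneg_eq_0_iff_AE) auto
    also have "\<dots> \<longleftrightarrow> ((\<lambda>i. \<integral>x. norm (f i x) \<partial>M i) \<longlongrightarrow> 0) U"
      using lim tendsto_unique[OF U_nonbot lim] by metis
    finally show ?thesis .
  qed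
  then show ?thesis unfolding ker_def BU_carrier by blast
qed

lemma \<Phi>_isometric: "isometric_isomorphism (quotient_space BU (ker BU CN \<Phi>)) CN (induced_map \<Phi>)"
  by (rule isometric_isomorphism_quotient[OF BU_vspace seminormed_vspace.axioms(1)[OF CN_seminormed]
    \<Phi>_linear \<Phi>_contraction \<Phi>_lift])

end

end

theorem proposition2p3p2:
  fixes U :: "'i filter" and M :: "'i \<Rightarrow> 'a measure" and \<rho> :: "real \<Rightarrow> real"
    and N :: "('i \<Rightarrow> 'a) set measure"
    and E :: "('i \<Rightarrow> ('a \<Rightarrow> complex) set) set nspace"
    and C :: "(('i \<Rightarrow> 'a) set \<Rightarrow> complex) set nspace"
  assumes "ultrafilter U"
    and "\<And>i. prob_space (M i)"
    and "\<rho> \<in> majorants"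
    and N: "N = ulim_measure U M"
    and E: "E = ulim_space U (\<lambda>i. C_rho (M i) \<rho>)"
    and C: "C = C_rho N \<rho>"
  shows "\<exists>\<Phi>.
      (\<forall>f\<in>bounded_families M \<rho>. \<exists>g\<in>carrier (C_rho_fun N \<rho>).
          represents_ulim U M f g \<and> \<Phi> (ulim_class U M \<rho> f) = ae_class N \<rho> g) \<and>
      continuous_linear_map E C \<Phi> \<and> op_norm E C \<Phi> \<le> 1 \<and>
      (\<forall>f\<in>bounded_families M \<rho>.
          ((\<lambda>i. \<integral>x. f i x \<partial>M i) \<longlongrightarrow> class_integral N (\<Phi> (ulim_class U M \<rho> f))) U) \<and>
      ker E C \<Phi> = {ulim_class U M \<rho> f | f. f \<in> bounded_families M \<rho> \<and>
          ((\<lambda>i. \<integral>x. norm (f i x) \<partial>M i) \<longlongrightarrow> 0) U} \<and>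
      isometric_isomorphism (quotient_space E (ker E C \<Phi>)) C (induced_map \<Phi>)"
proof -
  interpret prob_ultraproduct U M by (rule prob_ultraproduct.intro[OF assms(1,2)])
  note \<rho> = assms(3)
  show ?thesis
    unfolding C E N
  proof (intro exI[of _ "\<Phi> \<rho>"] conjI ballI)
    fix f assume f: "f \<in> bounded_families M \<rho>"
    obtain g where "g \<in> carrier (C_rho_fun (ulim_measure U M) \<rho>)" "ulim_AE f g"
      "\<Phi> \<rho> (ulim_class U M \<rho> f) = ae_class (ulim_measure U M) \<rho> g"
      using \<Phi>_obtain[OF \<rho> f] by metis
    then show "\<exists>g\<in>carrier (C_rho_fun (ulim_measure U M) \<rho>).
        represents_ulim U M f g \<and> \<Phi> \<rho> (ulim_class U M \<rho> f) = ae_class (ulim_measure U M) \<rho> g"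
      using represents_ulimI by blast
    show "((\<lambda>i. \<integral>x. f i x \<partial>M i) \<longlongrightarrow>
        class_integral (ulim_measure U M) (\<Phi> \<rho> (ulim_class U M \<rho> f))) U"
      by (rule \<Phi>_integral[OF \<rho> f])
  qed (rule \<Phi>_continuous[OF \<rho>] \<Phi>_op_norm[OF \<rho>] \<Phi>_ker[OF \<rho>] \<Phi>_isometric[OF \<rho>])+
qed

end
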